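(* Let $X$ be an h-homogeneous zero-dimensional compact Hausdorff topological space and let $G=\mathrm{Homeo}(X)$ be equipped with the compact-open topology. Then the universal minimal $G$-space $M(G)$ is isomorphic (as a $G$-space) to $\Phi(X)$, the space of maximal chains on $X$.
   Context: A zero-dimensional compact Hausdorff space $X$ is h-homogeneous if every nonempty clopen subset of $X$ is homeomorphic to $X$. For a compact Hausdorff space $X$, $\mathrm{Exp}(X)$ denotes the space of nonempty closed subsets of $X$ with the Vietoris topology. A chain is a subset $C\subset \mathrm{Exp}(X)$ such that for any $E,F\in C$ either $E\subset F$ or $F\subset E$; it is maximal if it is maximal under inclusion among chains. $\Phi(X)$ is the set of all maximal chains, a closed (hence compact) subset of $\mathrm{Exp}(\mathrm{Exp}(X))$ (Vietoris topology), with the $G$-action $g c=\{gF: F\in c\}$. For a topological group $G$, a compact Hausdorff $G$-space is minimal if it has no nonempty proper closed invariant subsets; the universal minimal $G$-space $M(G)$ is the (unique up to isomorphism) minimal $G$-space which admits a continuous $G$-equivariant surjection onto every minimal $G$-space. *)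

theory Defs
  imports "HOL-Analysis.Analysis"
begin

definition zero_dimensional :: "'a topology \<Rightarrow> bool" where
  "zero_dimensional X \<longleftrightarrow>
     (\<forall>U x. openin X U \<and> x \<in> U \<longrightarrow> (\<exists>V. openin X V \<and> closedin X V \<and> x \<in> V \<and> V \<subseteq> U))"

definition h_homogeneous :: "'a topology \<Rightarrow> bool" where
  "h_homogeneous X \<longleftrightarrow>
     zero_dimensional X \<and> compact_space X \<and> Hausdorff_space X \<and>
     (\<forall>C. openin X C \<and> closedin X C \<and> C \<noteq> {} \<longrightarrow> subtopology X C homeomorphic_space X)"

text \<open>Homeomorphisms of X, normalised to be the identity outside the carrier.
  The group operation is composition, the unit is id.\<close>
definition Homeo :: "'a topology \<Rightarrow> ('a \<Rightarrow> 'a) set" where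
  "Homeo X = {g. homeomorphic_map X X g \<and> (\<forall>x. x \<notin> topspace X \<longrightarrow> g x = x)}"

definition compact_open :: "'a topology \<Rightarrow> ('a \<Rightarrow> 'a) set \<Rightarrow> ('a \<Rightarrow> 'a) topology" where
  "compact_open X H =
     topology_generated_by {{g \<in> H. g ` K \<subseteq> U} | K U. compactin X K \<and> openin X U}"

definition Exp :: "'a topology \<Rightarrow> 'a set set" where
  "Exp X = {F. closedin X F \<and> F \<noteq> {}}"

definition Vietoris :: "'a topology \<Rightarrow> 'a set topology" where
  "Vietoris X = topology_generated_by
     ({{F \<in> Exp X. F \<subseteq> U} | U. openin X U} \<union> {{F \<in> Exp X. F \<inter> U \<noteq> {}} | U. openin X U})"

definition is_chain :: "'a set set \<Rightarrow> bool" where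
  "is_chain C \<longleftrightarrow> (\<forall>E\<in>C. \<forall>F\<in>C. E \<subseteq> F \<or> F \<subseteq> E)"

definition maximal_chains :: "'a topology \<Rightarrow> 'a set set set" where
  "maximal_chains X = {C. C \<subseteq> Exp X \<and> is_chain C \<and>
       (\<forall>D. D \<subseteq> Exp X \<and> is_chain D \<and> C \<subseteq> D \<longrightarrow> D = C)}"

definition Phi :: "'a topology \<Rightarrow> 'a set set topology" where
  "Phi X = subtopology (Vietoris (Vietoris X)) (maximal_chains X)"

definition Phi_action :: "('a \<Rightarrow> 'a) \<Rightarrow> 'a set set \<Rightarrow> 'a set set" where
  "Phi_action g c = (\<lambda>F. g ` F) ` c"

definition G_space :: "('a \<Rightarrow> 'a) set \<Rightarrow> ('a \<Rightarrow> 'a) topology \<Rightarrow> 'b topology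
    \<Rightarrow> (('a \<Rightarrow> 'a) \<Rightarrow> 'b \<Rightarrow> 'b) \<Rightarrow> bool" where
  "G_space G T Y act \<longleftrightarrow>
     topspace T = G \<and> compact_space Y \<and> Hausdorff_space Y \<and>
     continuous_map (prod_topology T Y) Y (\<lambda>(g, y). act g y) \<and>
     (\<forall>y\<in>topspace Y. act id y = y) \<and>
     (\<forall>g\<in>G. \<forall>h\<in>G. \<forall>y\<in>topspace Y. act (g \<circ> h) y = act g (act h y))"

definition minimal_G_space :: "('a \<Rightarrow> 'a) set \<Rightarrow> ('a \<Rightarrow> 'a) topology \<Rightarrow> 'b topology
    \<Rightarrow> (('a \<Rightarrow> 'a) \<Rightarrow> 'b \<Rightarrow> 'b) \<Rightarrow> bool" where
  "minimal_G_space G T Y act \<longleftrightarrow>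
     G_space G T Y act \<and> topspace Y \<noteq> {} \<and>
     (\<forall>A. closedin Y A \<and> (\<forall>g\<in>G. act g ` A \<subseteq> A) \<longrightarrow> A = {} \<or> A = topspace Y)"

definition equivariant_surjection :: "('a \<Rightarrow> 'a) set \<Rightarrow> 'b topology \<Rightarrow> (('a \<Rightarrow> 'a) \<Rightarrow> 'b \<Rightarrow> 'b)
    \<Rightarrow> 'c topology \<Rightarrow> (('a \<Rightarrow> 'a) \<Rightarrow> 'c \<Rightarrow> 'c) \<Rightarrow> ('b \<Rightarrow> 'c) \<Rightarrow> bool" where
  "equivariant_surjection G Y act Z act' f \<longleftrightarrow>
     continuous_map Y Z f \<and> f ` topspace Y = topspace Z \<and>
     (\<forall>g\<in>G. \<forall>y\<in>topspace Y. f (act g y) = act' g (f y))"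

end

theory Submission
  imports Defs
begin

text \<open>
  A maximal chain \<open>c\<close> orders every finite clopen partition of \<open>X\<close>: a cell \<open>A\<close> comes before \<open>B\<close> if some member of
  \<open>c\<close> meets \<open>A\<close> and misses \<open>B\<close>. These orderings determine \<open>c\<close>, and since \<open>Homeo X\<close> acts transitively on
  labelled clopen partitions with a given number of cells, every orbit in the space of maximal chains is
  dense. Given a minimal flow \<open>Z\<close>, take a minimal subflow \<open>M\<close> of the product of the space of maximal chains
  with \<open>Z\<close>; both projections of \<open>M\<close> are onto, so it suffices that \<open>M\<close> is the graph of a function. If \<open>(c, z)\<close>
  and \<open>(c, z')\<close> were in \<open>M\<close> with \<open>z \<noteq> z'\<close>, separate \<open>z\<close> and \<open>z'\<close> by a continuous real function \<open>f\<close> and choose a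
  clopen partition \<open>p\<close> so fine that homeomorphisms preserving its cells change \<open>f\<close> only a little. Up to a
  small error, \<open>f (h z)\<close> then depends only on the labelled partition pulled back from \<open>p\<close> along \<open>h\<close>. Finitely
  many approximate values of \<open>f\<close> are a colouring, and the dual Ramsey theorem of Graham and Rothschild yields a
  point \<open>(d, w)\<close> of \<open>M\<close> for which \<open>f (h w)\<close> is nearly determined by the ordering that \<open>h d\<close> induces on
  \<open>p\<close>. By minimality this holds at every point of \<open>M\<close>, contradicting that the orbit of \<open>(c, z)\<close> accumulates at
  \<open>(c, z')\<close>.
\<close>

section \<open>The dual Ramsey theorem for rigid words\<close>

text \<open>The Ramsey theorem is a dual one because the finite objects are quotients of
  \<open>X\<close>. If a chain orders the \<open>n\<close> cells of a partition, a coarser partition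
  is a word giving each cell a letter, and the chain orders the coarser cells by first occurrence in
  this word. Coarsenings whose labels already increase along the chain are thus exactly the rigid
  words, and coarsening twice is substitution.

  A chain may order the pullback of \<open>p\<close> along \<open>h\<close> in several ways, so a
  colour records values of \<open>f\<close> for all permutations \<open>\<sigma>\<close> of the
  labels at once. Values in the unit interval are rounded down to multiples of 1/8, whence nine
  colours per permutation; the rounding error and two displacements of less than 1/8 stay below the
  bound 1/2.

  Ramsey controls only those \<open>h\<close> whose pullback of \<open>p\<close> is coarser than a
  given partition \<open>q\<close>. As \<open>X\<close> need not be metrizable, no sequence of such
  \<open>q\<close> need exhaust the group; instead the condition is closed for each pair of
  homeomorphisms, and compactness yields one point of \<open>M\<close> satisfying all of them. Such
  points form a closed invariant set.\<close>

text \<open>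
  Parameter words: \<open>rigid a k w\<close> means that \<open>w\<close> uses the constants \<open>{..<a}\<close> and all the parameters
  \<open>{a..<a + k}\<close>, with the first occurrences of the parameters in increasing order. With \<open>a = 0\<close> these are the
  rigid surjections onto \<open>{..<k}\<close>.
\<close>
fun rigid :: "nat \<Rightarrow> nat \<Rightarrow> nat list \<Rightarrow> bool" where
  "rigid a k [] \<longleftrightarrow> k = 0"
| "rigid a k (x # w) \<longleftrightarrow> x < a \<and> rigid a k w \<or> x = a \<and> 0 < k \<and> rigid (Suc a) (k - 1) w"

definition rwords :: "nat \<Rightarrow> nat \<Rightarrow> nat \<Rightarrow> nat list set" where
  "rwords a k n = {w. length w = n \<and> rigid a k w}"

text \<open>Composition of words seen as maps from positions to letters: constants below
  \<open>a\<close> stay, and the parameter \<open>a + i\<close> becomes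
  \<open>v ! i\<close>.\<close>

definition subst :: "nat \<Rightarrow> nat list \<Rightarrow> nat list \<Rightarrow> nat list" where
  "subst a v w = map ((!) ([0..<a] @ v)) w"

text \<open>Renumbers the parameters so that \<open>a\<close> becomes free for a new parameter that
  occurs earlier.\<close>

definition shift :: "nat \<Rightarrow> nat list \<Rightarrow> nat list" where
  "shift a = map (\<lambda>x. if x < a then x else Suc x)"

lemma rigid_letters: "rigid a k w \<Longrightarrow> x \<in> set w \<Longrightarrow> x < a + k"
  by (induction a k w rule: rigid.induct) auto

lemma rigid_0: "rigid a 0 w \<longleftrightarrow> set w \<subseteq> {..<a}"
  by (induction w) auto

lemma rwords_0: "rwords a 0 n = {w. set w \<subseteq> {..<a} \<and> length w = n}"
  by (auto simp: rwords_def rigid_0)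

lemma rigid_append: "rigid a k u \<Longrightarrow> rigid (a + k) m w \<Longrightarrow> rigid a (k + m) (u @ w)"
proof (induction a k u rule: rigid.induct)
  case (2 a k x u)
  then show ?case by (cases k) auto
qed simp

lemma rigid_shift: "rigid b m w \<Longrightarrow> a \<le> b \<Longrightarrow> rigid (Suc b) m (shift a w)"
  by (induction b m w rule: rigid.induct) (auto simp: shift_def)

text \<open>The induction reads \<open>w\<close> and keeps in \<open>pre\<close> the values of the
  constants and of all parameters met so far; each fresh parameter of \<open>w\<close> moves the
  next letter of \<open>v\<close> into it. If that letter is itself a fresh parameter, the target
  alphabet \<open>a\<close> grows together with \<open>b\<close>.\<close>

lemma rigid_map_nth:
  "rigid b m w \<Longrightarrow> length pre = b \<Longrightarrow> set pre \<subseteq> {..<a} \<Longrightarrow> length v = m \<Longrightarrow> rigid a k v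
    \<Longrightarrow> rigid a k (map ((!) (pre @ v)) w)"
proof (induction b m w arbitrary: pre a v k rule: rigid.induct)
  case (2 b m x w)
  show ?case
  proof (cases "x < b")
    case True
    then have "pre ! x < a" using 2 by (metis lessThan_iff nth_mem subsetD)
    moreover have "rigid a k (map ((!) (pre @ v)) w)"
      using True 2 by auto
    ultimately show ?thesis using True 2 by (simp add: nth_append)
  next
    case False
    with 2 have xb: "x = b" "0 < m" and w: "rigid (Suc b) (m - 1) w" by auto
    then obtain y v' where v: "v = y # v'" using 2 by (cases v) auto
    have eq: "map ((!) (pre @ v)) (x # w) = y # map ((!) ((pre @ [y]) @ v')) w"
      using xb 2 v by (simp add: nth_append)
    show ?thesis
    proof (cases "y < a")
      case True
      then have "rigid a k v'" using 2(7) v by auto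
      then have "rigid a k (map ((!) ((pre @ [y]) @ v')) w)"
        using 2 xb w v True by (intro 2(2)) auto
      then show ?thesis unfolding eq using True by simp
    next
      case False
      then have "rigid (Suc a) (k-1) v'" and ya: "y = a" "0 < k" using 2(7) v by auto
      then have "rigid (Suc a) (k - 1) (map ((!) ((pre @ [y]) @ v')) w)"
        using 2 xb w v by (intro 2(2)) auto
      then show ?thesis unfolding eq using ya by simp
    qed
  qed
qed simp

text \<open>The inequality \<open>b \<le> a\<close> lets a word over few constants be filled with
  letters of a larger alphabet; the induction on the alphabet in the Hales-Jewett theorem depends on
  it.\<close>

lemma subst_in_rwords:
  "w \<in> rwords b m n \<Longrightarrow> v \<in> rwords a k m \<Longrightarrow> b \<le> a \<Longrightarrow> subst b v w \<in> rwords a k n"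
  unfolding rwords_def subst_def using rigid_map_nth[of b m w "[0..<b]" a v k]
  by (simp add: lessThan_atLeast0)

lemma map_nth_map_nth:
  "set w \<subseteq> {..<length u} \<Longrightarrow> map ((!) l) (map ((!) u) w) = map ((!) (map ((!) l) u)) w"
  by auto

lemma map_nth_upt: "b \<le> a \<Longrightarrow> map ((!) ([0..<a] @ v)) [0..<b] = [0..<b]"
  by (rule nth_equalityI) (auto simp: nth_append)

lemma map_nth_upt_Suc: "map ((!) ([0..<a] @ y # v)) [0..<Suc a] = [0..<a] @ [y]"
  by (rule nth_equalityI) (auto simp: nth_append less_Suc_eq)

text \<open>Associativity of composition: the letters of \<open>w\<close> all point into
  \<open>[0..<b] @ u\<close>, so the filling may be carried out on \<open>u\<close> first.\<close>

lemma subst_subst: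
  assumes "w \<in> rwords b m n" "length u = m" "b \<le> a"
  shows "subst a v (subst b u w) = subst b (subst a v u) w"
proof -
  have "set w \<subseteq> {..<length ([0..<b] @ u)}" using assms rigid_letters by (fastforce simp: rwords_def)
  from map_nth_map_nth[OF this, of "[0..<a] @ v"]
  show ?thesis unfolding subst_def map_append map_nth_upt[OF assms(3)] .
qed

text \<open>After \<open>shift\<close> no letter equals \<open>a\<close>, so the value
  \<open>y\<close> given to that parameter is never read.\<close>

lemma subst_shift:
  assumes "w \<in> rwords a m n" "length v = m"
  shows "subst a (y # v) (shift a w) = subst a v w"
proof -
  have "\<forall>x\<in>set w. x < a + m" using assms rigid_letters by (fastforce simp: rwords_def)
  then show ?thesis using assms by (auto simp: subst_def shift_def nth_append Suc_diff_le)
qed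

lemma subst_Cons_line:
  assumes "w \<in> rwords a 1 n"
  shows "subst a (y # v) w = subst a [y] w"
proof -
  have "\<forall>x\<in>set w. x < a + 1" using assms rigid_letters by (fastforce simp: rwords_def)
  then show ?thesis by (auto simp: subst_def nth_append)
qed

lemma subst_append: "subst a v (u @ w) = subst a v u @ subst a v w"
  by (simp add: subst_def)

lemma length_subst[simp]: "length (subst a v w) = length w"
  by (simp add: subst_def)

lemma length_shift[simp]: "length (shift a w) = length w"
  by (simp add: shift_def)

text \<open>A line followed by an \<open>m\<close>-parameter word on fresh parameters: this is how
  the Ramsey arguments raise the dimension.\<close>

lemma line_append:
  assumes "u \<in> rwords a 1 n" "w \<in> rwords a m n'"
  shows "u @ shift a w \<in> rwords a (Suc m) (n + n')"
  using rigid_append[of a 1 u m "shift a w"] rigid_shift[of a m w a] assms by (auto simp: rwords_def)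

lemma subst_line_append:
  assumes "u \<in> rwords a 1 n" "w \<in> rwords a m n'" "length v = m"
  shows "subst a (y # v) (u @ shift a w) = subst a [y] u @ subst a v w"
  using subst_Cons_line[OF assms(1)] subst_shift[OF assms(2,3)] by (simp add: subst_append)

lemma finite_rwords: "finite (rwords a k n)"
  by (rule finite_subset[OF _ finite_lists_length_eq[of "{..<a+k}" n]]) (use rigid_letters in \<open>auto simp: rwords_def\<close>)

text \<open>Colours \<open>u\<close> by the whole function \<open>\<gamma> u\<close> on
  \<open>D\<close>, coded as a number since \<open>ramsey\<close> colours with numbers. The bound
  involves only \<open>r\<close> and \<open>card D\<close>, so the length of words can be fixed
  before a colouring is given.\<close>

lemma product_colouring:
  fixes \<gamma> :: "'u \<Rightarrow> 'd \<Rightarrow> nat"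
  assumes "finite D" "finite C" "card C \<le> r" "\<forall>u\<in>U. \<forall>d\<in>D. \<gamma> u d \<in> C"
  obtains C' and \<gamma>' :: "'u \<Rightarrow> nat" where "finite C'" "card C' \<le> r ^ card D" "\<gamma>' ` U \<subseteq> C'"
    "\<forall>u u'. \<gamma>' u = \<gamma>' u' \<longrightarrow> (\<forall>d\<in>D. \<gamma> u d = \<gamma> u' d)"
proof -
  obtain L where L: "set L = D" "distinct L" using finite_distinct_list[OF assms(1)] by blast
  define \<gamma>' where "\<gamma>' u = to_nat (map (\<gamma> u) L)" for u
  define C' where "C' = (to_nat :: nat list \<Rightarrow> nat) ` {l. set l \<subseteq> C \<and> length l = length L}"
  show ?thesis
  proof
    show "finite C'" unfolding C'_def by (intro finite_imageI finite_lists_length_eq assms)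
    have "card C' \<le> card {l. set l \<subseteq> C \<and> length l = length L}"
      unfolding C'_def by (intro card_image_le finite_lists_length_eq assms)
    also have "\<dots> = card C ^ length L" by (rule card_lists_length_eq) (use assms in auto)
    also have "\<dots> \<le> r ^ length L" by (rule power_mono) (use assms in auto)
    finally show "card C' \<le> r ^ card D" using L distinct_card by metis
    show "\<gamma>' ` U \<subseteq> C'"
      unfolding \<gamma>'_def C'_def using assms(4) L by (intro image_subsetI imageI) (simp add: image_subset_iff)
    show "\<forall>u u'. \<gamma>' u = \<gamma>' u' \<longrightarrow> (\<forall>d\<in>D. \<gamma> u d = \<gamma> u' d)"
      using L by (auto simp: \<gamma>'_def)
  qed
qed

section \<open>The Hales-Jewett theorem, by induction on the alphabet\<close>

text \<open>The Graham-Rothschild property of \<open>n\<close>; for \<open>k = 0\<close> it is the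
  Hales-Jewett property, with lines for \<open>m = 1\<close>. Colours come from an arbitrary finite
  set \<open>C\<close> so that a colour can be deleted in an induction on \<open>r\<close>.\<close>

definition ramsey :: "nat \<Rightarrow> nat \<Rightarrow> nat \<Rightarrow> nat \<Rightarrow> nat \<Rightarrow> bool" where
  "ramsey a k m r n \<longleftrightarrow> (\<forall>(\<gamma> :: nat list \<Rightarrow> nat) C. finite C \<and> card C \<le> r \<and> \<gamma> ` rwords a k n \<subseteq> C \<longrightarrow>
      (\<exists>W\<in>rwords a m n. \<exists>q. \<forall>v\<in>rwords a k m. \<gamma> (subst a v W) = q))"

lemma ramseyD:
  fixes \<gamma> :: "nat list \<Rightarrow> nat"
  assumes "ramsey a k m r n" "finite C" "card C \<le> r" "\<gamma> ` rwords a k n \<subseteq> C"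
  obtains W q where "W \<in> rwords a m n" "\<And>v. v \<in> rwords a k m \<Longrightarrow> \<gamma> (subst a v W) = q"
proof -
  have "\<exists>W\<in>rwords a m n. \<exists>q. \<forall>v\<in>rwords a k m. \<gamma> (subst a v W) = q"
    using assms(1)[unfolded ramsey_def, rule_format, of C \<gamma>] assms by simp
  then show thesis using that by blast
qed

text \<open>Words are cut into two blocks. If the first block is coloured by its effect on all
  second blocks, it admits a line along which nothing changes; with that line frozen at the letter
  0, the second block takes care of the \<open>m\<close> remaining parameters.\<close>

lemma hales_jewett_multi:
  assumes "\<And>r. \<exists>n. ramsey a 0 1 r n" "0 < a"
  shows "\<exists>n. ramsey a 0 m r n"
proof (induction m)
  case 0
  have "ramsey a 0 0 r 0" by (auto simp: ramsey_def rwords_def)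
  then show ?case by blast
next
  case (Suc m)
  then obtain n' where n': "ramsey a 0 m r n'" by blast
  \<comment> \<open>The length \<open>n'\<close> of the second block comes first, since the number
    of colours for the first block depends on it.\<close>
  obtain n where n: "ramsey a 0 1 (r ^ card (rwords a 0 n')) n" using assms by blast
  have "ramsey a 0 (Suc m) r (n + n')"
    unfolding ramsey_def
  proof (intro allI impI, elim conjE)
    fix \<gamma> :: "nat list \<Rightarrow> nat" and C
    assume C: "finite C" "card C \<le> r" and \<gamma>: "\<gamma> ` rwords a 0 (n + n') \<subseteq> C"
    have app: "\<forall>u\<in>rwords a 0 n. \<forall>v\<in>rwords a 0 n'. \<gamma> (u @ v) \<in> C"
      using \<gamma> by (force simp: rwords_0)
    obtain \<gamma>' :: "nat list \<Rightarrow> nat" and C' where C': "finite C'" "card C' \<le> r ^ card (rwords a 0 n')" "\<gamma>' ` rwords a 0 n \<subseteq> C'"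
      and eq[rule_format]: "\<forall>u u'. \<gamma>' u = \<gamma>' u' \<longrightarrow> (\<forall>v\<in>rwords a 0 n'. \<gamma> (u @ v) = \<gamma> (u' @ v))"
      by (rule product_colouring[where \<gamma> = "\<lambda>u v. \<gamma> (u @ v)", OF finite_rwords C app]) (rule that)
    obtain U q where U: "U \<in> rwords a 1 n" and q: "\<And>v. v \<in> rwords a 0 1 \<Longrightarrow> \<gamma>' (subst a v U) = q"
      using ramseyD[OF n C'] by metis
    have line: "[x] \<in> rwords a 0 1" if "x < a" for x using that by (simp add: rwords_def)
    have U0: "subst a [0] U \<in> rwords a 0 n" using subst_in_rwords[OF U line[OF assms(2)]] by simp
    have "(\<lambda>v. \<gamma> (subst a [0] U @ v)) ` rwords a 0 n' \<subseteq> C" using app U0 by blast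
    from ramseyD[OF n' C this] obtain W q' where W: "W \<in> rwords a m n'"
      and q': "\<And>v. v \<in> rwords a 0 m \<Longrightarrow> \<gamma> (subst a [0] U @ subst a v W) = q'" by metis
    have "\<gamma> (subst a w (U @ shift a W)) = q'" if w: "w \<in> rwords a 0 (Suc m)" for w
    proof -
      obtain x v where xv: "w = x # v" "x < a" "v \<in> rwords a 0 m" using w by (cases w) (auto simp: rwords_def)
      then have "subst a w (U @ shift a W) = subst a [x] U @ subst a v W"
        using subst_line_append[OF U W] by (auto simp: rwords_def)
      moreover have "\<gamma> (subst a [x] U @ subst a v W) = \<gamma> (subst a [0] U @ subst a v W)"
        using eq[of "subst a [x] U" "subst a [0] U" "subst a v W"] q line xv assms subst_in_rwords[OF W] by simp
      ultimately show ?thesis using q' xv by simp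
    qed
    then show "\<exists>W\<in>rwords a (Suc m) (n + n'). \<exists>q. \<forall>v\<in>rwords a 0 (Suc m). \<gamma> (subst a v W) = q"
      using line_append[OF U W] by blast
  qed
  then show ?case by blast
qed

text \<open>Passing from the alphabet of size \<open>a\<close> to size \<open>Suc a\<close>: in a subspace whose words over the old
  letters are all red, a red word using the new letter \<open>a\<close> yields a red line by turning its occurrences of
  \<open>a\<close> into the variable; if there is none, the subspace of words starting with \<open>a\<close> misses red.\<close>
lemma hales_jewett_step:
  assumes multi: "\<And>m r. \<exists>n. ramsey a 0 m r n" and "0 < a"
  shows "\<exists>n. ramsey (Suc a) 0 1 r n"
proof (induction r)
  case 0
  \<comment> \<open>Vacuous: the empty word would need a colour from an empty set.\<close>
  have "ramsey (Suc a) 0 1 0 0" by (auto simp: ramsey_def rwords_0)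
  then show ?case by blast
next
  case (Suc r)
  then obtain n' where n': "ramsey (Suc a) 0 1 r n'" by blast
  \<comment> \<open>The parameter in excess of \<open>n'\<close> is spent on the letter
    \<open>a\<close> when no word using \<open>a\<close> is red.\<close>
  obtain n where n: "ramsey a 0 (Suc n') (Suc r) n" using multi by blast
  have "ramsey (Suc a) 0 1 (Suc r) n"
    unfolding ramsey_def
  proof (intro allI impI, elim conjE)
    fix \<gamma> :: "nat list \<Rightarrow> nat" and C
    assume C: "finite C" "card C \<le> Suc r" and \<gamma>: "\<gamma> ` rwords (Suc a) 0 n \<subseteq> C"
    have "\<gamma> ` rwords a 0 n \<subseteq> C" using \<gamma> by (force simp: rwords_0)
    from ramseyD[OF n C this] obtain W red where W: "W \<in> rwords a (Suc n') n"
      and red: "\<And>v. v \<in> rwords a 0 (Suc n') \<Longrightarrow> \<gamma> (subst a v W) = red" by metis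
    have mem: "subst a v W \<in> rwords (Suc a) 0 n" if "v \<in> rwords (Suc a) 0 (Suc n')" for v
      using subst_in_rwords[OF W that] by simp
    \<comment> \<open>The constant word 0 shows that \<open>red\<close> occurs in \<open>C\<close>,
      so that deleting it leaves at most \<open>r\<close> colours.\<close>
    have "replicate (Suc n') 0 \<in> rwords a 0 (Suc n')" using assms by (auto simp: rwords_0)
    then have "red \<in> C" using red subst_in_rwords[OF W] \<open>\<gamma> ` rwords a 0 n \<subseteq> C\<close> by fastforce
    have line: "\<exists>W\<in>rwords (Suc a) 1 n. \<exists>q. \<forall>v\<in>rwords (Suc a) 0 1. \<gamma> (subst (Suc a) v W) = q"
      if "V \<in> rwords (Suc a) 1 (Suc n')" and q: "\<And>x. x \<le> a \<Longrightarrow> \<gamma> (subst a (subst (Suc a) [x] V) W) = q" for V q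
    proof (intro bexI exI ballI)
      show "subst a V W \<in> rwords (Suc a) 1 n" using subst_in_rwords[OF W that(1)] by simp
      fix v assume "v \<in> rwords (Suc a) 0 1"
      then obtain x where "v = [x]" "x \<le> a" by (auto simp: rwords_0 length_Suc_conv)
      then show "\<gamma> (subst (Suc a) v (subst a V W)) = q"
        using q subst_subst[OF W, of V "Suc a" v] that by (simp add: rwords_def)
    qed
    show "\<exists>W\<in>rwords (Suc a) 1 n. \<exists>q. \<forall>v\<in>rwords (Suc a) 0 1. \<gamma> (subst (Suc a) v W) = q"
    proof (cases "\<exists>v\<in>rwords (Suc a) 0 (Suc n'). a \<in> set v \<and> \<gamma> (subst a v W) = red")
      case True
      then obtain v where v: "v \<in> rwords (Suc a) 0 (Suc n')" "a \<in> set v" "\<gamma> (subst a v W) = red" by blast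
      \<comment> \<open>Over the alphabet of size \<open>Suc a\<close> the first parameter has
        number \<open>Suc a\<close>.\<close>
      define V where "V = map (\<lambda>x. if x = a then Suc a else x) v"
      have "rigid (Suc a) 1 (map (\<lambda>x. if x = a then Suc a else x) u)"
        if "set u \<subseteq> {..<Suc a}" "a \<in> set u" for u
        using that by (induction u) (auto simp: rigid_0)
      then have V: "V \<in> rwords (Suc a) 1 (Suc n')" using v by (simp add: V_def rwords_def rigid_0)
      have ev: "subst (Suc a) [x] V = map (\<lambda>y. if y = a then x else y) v" for x
        using v by (auto simp: V_def subst_def rwords_0 nth_append less_Suc_eq simp del: upt_Suc)
      show ?thesis
      proof (rule line[OF V])
        fix x assume "x \<le> a"
        show "\<gamma> (subst a (subst (Suc a) [x] V) W) = red"
        proof (cases "x = a")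
          case True
          then have "map (\<lambda>y. if y = a then x else y) v = v" by (induction v) auto
          then show ?thesis using ev v by simp
        next
          case False
          then show ?thesis unfolding ev using \<open>x \<le> a\<close> v by (intro red) (force simp: rwords_0)
        qed
      qed
    next
      case False
      have "(\<lambda>v. \<gamma> (subst a (a # v) W)) ` rwords (Suc a) 0 n' \<subseteq> C - {red}"
      proof (rule image_subsetI)
        fix v assume v: "v \<in> rwords (Suc a) 0 n'"
        then have "a # v \<in> rwords (Suc a) 0 (Suc n')" by (auto simp: rwords_0)
        then show "\<gamma> (subst a (a # v) W) \<in> C - {red}" using False mem \<gamma> by fastforce
      qed
      moreover have "card (C - {red}) \<le> r" using C \<open>red \<in> C\<close> by simp
      ultimately obtain U q where U: "U \<in> rwords (Suc a) 1 n'"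
        and q: "\<And>v. v \<in> rwords (Suc a) 0 1 \<Longrightarrow> \<gamma> (subst a (a # subst (Suc a) v U) W) = q"
        using ramseyD[OF n', of "C - {red}" "\<lambda>v. \<gamma> (subst a (a # v) W)"] C by (metis finite_Diff)
      show ?thesis
      proof (rule line)
        show "a # U \<in> rwords (Suc a) 1 (Suc n')" using U by (simp add: rwords_def)
        fix x assume "x \<le> a"
        then have "[x] \<in> rwords (Suc a) 0 1" by (simp add: rwords_def)
        moreover have "subst (Suc a) [x] (a # U) = a # subst (Suc a) [x] U"
          by (simp add: subst_def nth_append del: upt_Suc)
        ultimately show "\<gamma> (subst a (subst (Suc a) [x] (a # U)) W) = q" using q by simp
      qed
    qed
  qed
  then show ?case by blast
qed

theorem hales_jewett:
  assumes "0 < a"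
  shows "\<exists>n. ramsey a 0 m r n"
proof -
  have "\<exists>n. ramsey (Suc b) 0 1 r n" for b r
  proof (induction b arbitrary: r)
    case 0
    have "rwords (Suc 0) 0 1 = {[0]}" by (auto simp: rwords_0 length_Suc_conv)
    moreover have "[1] \<in> rwords (Suc 0) 1 1" by (simp add: rwords_def)
    ultimately have "ramsey (Suc 0) 0 1 r 1" unfolding ramsey_def by auto
    then show ?case by blast
  next
    case (Suc b)
    then show ?case using hales_jewett_step[of "Suc b"] hales_jewett_multi[of "Suc b"] by blast
  qed
  with assms show ?thesis using hales_jewett_multi[of a] by (metis gr0_conv_Suc)
qed

text \<open>
  Once a word \<open>v\<close> has used its first parameter, that parameter acts as a further constant. So the case of \<open>k\<close>
  parameters over \<open>Suc a\<close> constants makes the colour independent of all that follows the initial segment of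
  constants of \<open>v\<close>; that segment is then treated by the Hales-Jewett theorem.
\<close>
lemma ramsey_Suc_by_initial_segment:
  assumes IH: "\<And>m r. \<exists>n. ramsey (Suc a) k m r n"
  shows "\<exists>n. \<forall>(\<gamma> :: nat list \<Rightarrow> nat) C. finite C \<and> card C \<le> r \<and> \<gamma> ` rwords a (Suc k) n \<subseteq> C \<longrightarrow>
      (\<exists>W\<in>rwords a m n. \<forall>v\<in>rwords a (Suc k) m. \<forall>v'\<in>rwords a (Suc k) m.
        takeWhile (\<lambda>x. x < a) v = takeWhile (\<lambda>x. x < a) v' \<longrightarrow> \<gamma> (subst a v W) = \<gamma> (subst a v' W))"
proof (induction m arbitrary: r)
  case 0
  have "rwords a (Suc k) 0 = {}" by (auto simp: rwords_def)
  moreover have "[] \<in> rwords a 0 0" by (simp add: rwords_def)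
  ultimately show ?case by (intro exI[of _ 0]) auto
next
  case (Suc m)
  \<comment> \<open>A word will be coloured by its \<open>a\<close> colours for the \<open>a\<close>
    possible constant first letters, hence the exponent.\<close>
  from Suc[of "r ^ card {..<a}"] obtain n1 where n1: "\<forall>(\<gamma> :: nat list \<Rightarrow> nat) C.
      finite C \<and> card C \<le> r ^ card {..<a} \<and> \<gamma> ` rwords a (Suc k) n1 \<subseteq> C \<longrightarrow>
      (\<exists>W\<in>rwords a m n1. \<forall>v\<in>rwords a (Suc k) m. \<forall>v'\<in>rwords a (Suc k) m.
        takeWhile (\<lambda>x. x < a) v = takeWhile (\<lambda>x. x < a) v' \<longrightarrow> \<gamma> (subst a v W) = \<gamma> (subst a v' W))"
    by (rule exE)
  obtain n0 where n0: "ramsey (Suc a) k n1 r n0" using IH by blast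
  show ?case
  proof (intro exI[of _ "Suc n0"] allI impI, elim conjE)
    fix \<gamma> :: "nat list \<Rightarrow> nat" and C
    assume C: "finite C" "card C \<le> r" and \<gamma>: "\<gamma> ` rwords a (Suc k) (Suc n0) \<subseteq> C"
    have "(\<lambda>w. \<gamma> (a # w)) ` rwords (Suc a) k n0 \<subseteq> C"
      using \<gamma> by (auto simp: rwords_def)
    from ramseyD[OF n0 C this] obtain W0 q where W0: "W0 \<in> rwords (Suc a) n1 n0"
      and q: "\<And>v. v \<in> rwords (Suc a) k n1 \<Longrightarrow> \<gamma> (a # subst (Suc a) v W0) = q" by metis
    have mem0: "y # subst a (y # w) W0 \<in> rwords a (Suc k) (Suc n0)"
      if "y < a" "w \<in> rwords a (Suc k) n1" for y w
    proof -
      \<comment> \<open>The letter \<open>a\<close>, a constant of \<open>W0\<close>, takes the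
        value \<open>y\<close> here.\<close>
      have "map ((!) (([0..<a] @ [y]) @ w)) W0 \<in> rwords a (Suc k) n0"
        using rigid_map_nth[of "Suc a" n1 W0 "[0..<a] @ [y]" a w "Suc k"] that W0 by (force simp: rwords_def)
      then show ?thesis using that by (simp add: rwords_def subst_def)
    qed
    have app0: "\<forall>u\<in>rwords a (Suc k) n1. \<forall>y\<in>{..<a}. \<gamma> (y # subst a (y # u) W0) \<in> C"
      using mem0 \<gamma> by (metis image_subset_iff lessThan_iff)
    obtain \<gamma>' :: "nat list \<Rightarrow> nat" and C' where C': "finite C'" "card C' \<le> r ^ card {..<a}" "\<gamma>' ` rwords a (Suc k) n1 \<subseteq> C'"
      and eq[rule_format]: "\<forall>u u'. \<gamma>' u = \<gamma>' u' \<longrightarrow>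
        (\<forall>y\<in>{..<a}. \<gamma> (y # subst a (y # u) W0) = \<gamma> (y # subst a (y # u') W0))"
      by (rule product_colouring[where \<gamma> = "\<lambda>u y. \<gamma> (y # subst a (y # u) W0)", OF finite_lessThan C app0]) (rule that)
    from n1[rule_format, OF conjI[OF C'(1) conjI[OF C'(2,3)]]] obtain W1 where W1: "W1 \<in> rwords a m n1"
      and W1'[rule_format]: "\<forall>v\<in>rwords a (Suc k) m. \<forall>v'\<in>rwords a (Suc k) m.
        takeWhile (\<lambda>x. x < a) v = takeWhile (\<lambda>x. x < a) v' \<longrightarrow> \<gamma>' (subst a v W1) = \<gamma>' (subst a v' W1)"
      by (rule bexE)
    have S1: "shift a W1 \<in> rwords (Suc a) m n1" using W1 rigid_shift[of a m W1 a] by (simp add: rwords_def)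
    \<comment> \<open>\<open>W\<close> opens with its first parameter \<open>a\<close>, which
      \<open>W0\<close> regards as a constant. A filling that starts with a parameter has empty
      initial segment and is governed by \<open>W0\<close>; one that starts with a constant is
      governed by \<open>W1\<close>.\<close>
    define W where "W = a # subst (Suc a) (shift a W1) W0"
    have W: "W \<in> rwords a (Suc m) (Suc n0)"
      using subst_in_rwords[OF W0 S1] by (simp add: W_def rwords_def)
    have small: "subst a (y # v) W = y # subst a (y # subst a v W1) W0" if "length v = m" for y v
    proof -
      have "set W0 \<subseteq> {..<length ([0..<Suc a] @ shift a W1)}"
        using W0 S1 rigid_letters by (fastforce simp: rwords_def)
      note map_nth_map_nth[OF this, of "[0..<a] @ y # v"]
      also have "map ((!) ([0..<a] @ y # v)) ([0..<Suc a] @ shift a W1) = [0..<a] @ y # subst a v W1"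
        using subst_shift[OF W1 that, of y] unfolding map_append map_nth_upt_Suc by (simp add: subst_def)
      finally have "map ((!) ([0..<a] @ y # v)) (subst (Suc a) (shift a W1) W0) = subst a (y # subst a v W1) W0"
        unfolding subst_def .
      then show ?thesis unfolding W_def by (simp add: subst_def[of a "y # v" "a # _"] nth_append)
    qed
    have large: "subst a (a # v) W = a # subst (Suc a) (subst (Suc a) v (shift a W1)) W0" if "length v = m" for v
    proof -
      have "[0..<a] @ a # v = [0..<Suc a] @ v" by simp
      then have "subst a (a # v) W = subst (Suc a) v W" by (simp only: subst_def)
      also have "\<dots> = a # subst (Suc a) v (subst (Suc a) (shift a W1) W0)"
        by (simp add: W_def subst_def nth_append del: upt_Suc)
      finally have "subst a (a # v) W = a # subst (Suc a) v (subst (Suc a) (shift a W1) W0)" .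
      then show ?thesis using subst_subst[OF W0, of "shift a W1" "Suc a" v] S1 by (simp add: rwords_def)
    qed
    have "\<gamma> (subst a v W) = \<gamma> (subst a v' W)"
      if v: "v \<in> rwords a (Suc k) (Suc m)" and v': "v' \<in> rwords a (Suc k) (Suc m)"
        and tw: "takeWhile (\<lambda>x. x < a) v = takeWhile (\<lambda>x. x < a) v'" for v v'
    proof -
      obtain y u y' u' where yu: "v = y # u" "v' = y' # u'" using v v' by (cases v; cases v') (auto simp: rwords_def)
      have len: "length u = m" "length u' = m" using v v' yu by (auto simp: rwords_def)
      show ?thesis
      proof (cases "y < a")
        case True
        then have "y' = y" "takeWhile (\<lambda>x. x < a) u = takeWhile (\<lambda>x. x < a) u'"
          using tw yu by (auto split: if_splits)
        moreover have "u \<in> rwords a (Suc k) m" "u' \<in> rwords a (Suc k) m"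
          using True calculation v v' yu by (auto simp: rwords_def)
        ultimately show ?thesis
          using small[OF len(1), of y] small[OF len(2), of y] eq[OF W1', of u u' y] True yu by simp
      next
        case False
        then have "\<not> y' < a" using tw yu by (auto split: if_splits)
        then have y: "y = a" "y' = a" and u: "u \<in> rwords (Suc a) k m" "u' \<in> rwords (Suc a) k m"
          using False v v' yu by (auto simp: rwords_def)
        show ?thesis
          using large[OF len(1)] large[OF len(2)] yu y
            q[OF subst_in_rwords[OF S1 u(1)]] q[OF subst_in_rwords[OF S1 u(2)]] by simp
      qed
    qed
    then show "\<exists>W\<in>rwords a (Suc m) (Suc n0). \<forall>v\<in>rwords a (Suc k) (Suc m). \<forall>v'\<in>rwords a (Suc k) (Suc m).
        takeWhile (\<lambda>x. x < a) v = takeWhile (\<lambda>x. x < a) v' \<longrightarrow> \<gamma> (subst a v W) = \<gamma> (subst a v' W)"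
      using W by blast
  qed
qed

section \<open>Ramsey theorem for initial segments of constants, and the dual Ramsey theorem\<close>

definition short_words :: "nat \<Rightarrow> nat \<Rightarrow> nat list set" where
  "short_words a n = {u. set u \<subseteq> {..<a} \<and> length u \<le> n}"

text \<open>Concatenated Hales-Jewett lines: as long as the filling puts constants into the blocks,
  their values do not affect the colour, and the initial segment stops within the first block that
  receives a parameter. Only the number of blocks passed remains.\<close>

lemma initial_segment_colour_by_length:
  assumes "0 < a"
  shows "\<exists>n. \<forall>(\<gamma> :: nat list \<Rightarrow> nat) C. finite C \<and> card C \<le> r \<and> \<gamma> ` short_words a n \<subseteq> C \<longrightarrow>
      (\<exists>W\<in>rwords a m n. \<exists>q. \<forall>v. length v = m \<and> \<not> set v \<subseteq> {..<a} \<longrightarrow>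
        \<gamma> (takeWhile (\<lambda>x. x < a) (subst a v W)) = q (length (takeWhile (\<lambda>x. x < a) v)))"
proof (induction m)
  case 0
  have "[] \<in> rwords a 0 0" by (simp add: rwords_def)
  then show ?case by (intro exI[of _ 0]) auto
next
  case (Suc m)
  then obtain n' where n': "\<forall>(\<gamma> :: nat list \<Rightarrow> nat) C. finite C \<and> card C \<le> r \<and> \<gamma> ` short_words a n' \<subseteq> C \<longrightarrow>
      (\<exists>W\<in>rwords a m n'. \<exists>q. \<forall>v. length v = m \<and> \<not> set v \<subseteq> {..<a} \<longrightarrow>
        \<gamma> (takeWhile (\<lambda>x. x < a) (subst a v W)) = q (length (takeWhile (\<lambda>x. x < a) v)))"
    by (rule exE)
  have fin: "finite (short_words a n')" unfolding short_words_def by (rule finite_lists_length_le) simp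
  obtain n where n: "ramsey a 0 1 (r ^ card (short_words a n')) n" using hales_jewett[OF assms] by blast
  show ?case
  proof (intro exI[of _ "n + n'"] allI impI, elim conjE)
    fix \<gamma> :: "nat list \<Rightarrow> nat" and C
    assume C: "finite C" "card C \<le> r" and \<gamma>: "\<gamma> ` short_words a (n + n') \<subseteq> C"
    have app: "\<forall>u\<in>rwords a 0 n. \<forall>v\<in>short_words a n'. \<gamma> (u @ v) \<in> C"
      using \<gamma> by (force simp: rwords_0 short_words_def)
    obtain \<gamma>' :: "nat list \<Rightarrow> nat" and C' where C': "finite C'" "card C' \<le> r ^ card (short_words a n')" "\<gamma>' ` rwords a 0 n \<subseteq> C'"
      and eq[rule_format]: "\<forall>u u'. \<gamma>' u = \<gamma>' u' \<longrightarrow> (\<forall>v\<in>short_words a n'. \<gamma> (u @ v) = \<gamma> (u' @ v))"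
      by (rule product_colouring[where \<gamma> = "\<lambda>u v. \<gamma> (u @ v)", OF fin C app]) (rule that)
    obtain U q where U: "U \<in> rwords a 1 n" and q: "\<And>v. v \<in> rwords a 0 1 \<Longrightarrow> \<gamma>' (subst a v U) = q"
      using ramseyD[OF n C'] by metis
    have line: "subst a [x] U \<in> rwords a 0 n" "\<gamma>' (subst a [x] U) = q" if "x < a" for x
      using that q subst_in_rwords[OF U, of "[x]" a 0] by (auto simp: rwords_def)
    have "(\<lambda>v. \<gamma> (subst a [0] U @ v)) ` short_words a n' \<subseteq> C" using app line assms by blast
    from n'[rule_format, OF conjI[OF C(1) conjI[OF C(2) this]]] obtain W q' where W: "W \<in> rwords a m n'"
      and q'[rule_format]: "\<forall>v. length v = m \<and> \<not> set v \<subseteq> {..<a} \<longrightarrow>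
        \<gamma> (subst a [0] U @ takeWhile (\<lambda>x. x < a) (subst a v W)) = q' (length (takeWhile (\<lambda>x. x < a) v))"
      by (elim bexE exE)
    \<comment> \<open>Length 0 means that the first block already receives a parameter; the initial
      segment is then that of \<open>U\<close> itself.\<close>
    define q'' where "q'' j = (case j of 0 \<Rightarrow> \<gamma> (takeWhile (\<lambda>x. x < a) U) | Suc i \<Rightarrow> q' i)" for j
    have "\<gamma> (takeWhile (\<lambda>x. x < a) (subst a w (U @ shift a W))) = q'' (length (takeWhile (\<lambda>x. x < a) w))"
      if w: "length w = Suc m" "\<not> set w \<subseteq> {..<a}" for w
    proof -
      obtain x v where xv: "w = x # v" "length v = m" using w by (cases w) auto
      have s: "subst a w (U @ shift a W) = subst a [x] U @ subst a v W"
        using subst_line_append[OF U W] xv by simp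
      show ?thesis
      proof (cases "x < a")
        case True
        have "set (subst a [x] U) \<subseteq> {..<a}" using line[OF True] by (simp add: rwords_0)
        then have "takeWhile (\<lambda>x. x < a) (subst a [x] U @ subst a v W)
            = subst a [x] U @ takeWhile (\<lambda>x. x < a) (subst a v W)"
          by (intro takeWhile_append2) auto
        moreover have "takeWhile (\<lambda>x. x < a) (subst a v W) \<in> short_words a n'"
          using length_takeWhile_le[of "\<lambda>x. x < a" "subst a v W"] W
          by (auto simp: short_words_def rwords_def dest: set_takeWhileD)
        ultimately have "\<gamma> (takeWhile (\<lambda>x. x < a) (subst a w (U @ shift a W)))
            = \<gamma> (subst a [0] U @ takeWhile (\<lambda>x. x < a) (subst a v W))"
          using s eq[of "subst a [x] U" "subst a [0] U" "takeWhile (\<lambda>x. x < a) (subst a v W)"] line True assms by simp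
        also have "\<dots> = q' (length (takeWhile (\<lambda>x. x < a) v))" using q' xv w True by auto
        finally show ?thesis using True xv by (simp add: q''_def)
      next
        case False
        have "\<exists>y\<in>set (subst a [x] u). \<not> y < a" "takeWhile (\<lambda>x. x < a) (subst a [x] u) = takeWhile (\<lambda>x. x < a) u"
          if "rigid a 1 u" for u
          using that False by (induction u) (auto simp: subst_def nth_append)
        then have U': "\<exists>y\<in>set (subst a [x] U). \<not> y < a" "takeWhile (\<lambda>x. x < a) (subst a [x] U) = takeWhile (\<lambda>x. x < a) U"
          using U by (auto simp: rwords_def)
        then have "takeWhile (\<lambda>x. x < a) (subst a w (U @ shift a W)) = takeWhile (\<lambda>x. x < a) U"
          using s U' takeWhile_append1 by metis
        then show ?thesis using False xv by (simp add: q''_def)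
      qed
    qed
    then show "\<exists>W\<in>rwords a (Suc m) (n + n'). \<exists>q. \<forall>v. length v = Suc m \<and> \<not> set v \<subseteq> {..<a} \<longrightarrow>
        \<gamma> (takeWhile (\<lambda>x. x < a) (subst a v W)) = q (length (takeWhile (\<lambda>x. x < a) v))"
      using line_append[OF U W] by blast
  qed
qed

text \<open>Fresh parameters at the positions marked \<open>True\<close> and the constant 0
  elsewhere; this restricts the lengths of initial segments to a chosen set.\<close>

fun mark :: "nat \<Rightarrow> bool list \<Rightarrow> nat list" where
  "mark b [] = []"
| "mark b (True # bs) = b # mark (Suc b) bs"
| "mark b (False # bs) = 0 # mark b bs"

lemma length_mark[simp]: "length (mark b bs) = length bs"
  by (induction b bs rule: mark.induct) auto

lemma rigid_mark: "0 < b \<Longrightarrow> rigid b (length (filter id bs)) (mark b bs)"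
  by (induction b bs rule: mark.induct) auto

text \<open>The letter 0 stays constant, so the first letter that is not a constant sits at a marked
  position. During the induction \<open>pre\<close> also collects the values, all of them constants,
  of the parameters already passed.\<close>

lemma length_takeWhile_mark:
  "length pre = b \<Longrightarrow> 0 < b \<Longrightarrow> set pre \<subseteq> {..<a} \<Longrightarrow> length v = length (filter id bs) \<Longrightarrow> \<not> set v \<subseteq> {..<a} \<Longrightarrow>
    length (takeWhile (\<lambda>x. x < a) (map ((!) (pre @ v)) (mark b bs))) \<in> {l. l < length bs \<and> bs ! l}"
proof (induction b bs arbitrary: pre v rule: mark.induct)
  case (2 b bs)
  then obtain y v' where v: "v = y # v'" by (cases v) auto
  show ?case
  proof (cases "y < a")
    case True
    have "length (takeWhile (\<lambda>x. x < a) (map ((!) ((pre @ [y]) @ v')) (mark (Suc b) bs))) \<in> {l. l < length bs \<and> bs ! l}"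
      by (rule 2(1)) (use 2 v True in auto)
    moreover have "(pre @ v) ! b = y" "(pre @ [y]) @ v' = pre @ v" using 2 v by auto
    ultimately show ?thesis using True by simp
  next
    case False
    moreover have "(pre @ v) ! b = y" using 2 v by auto
    ultimately show ?thesis by simp
  qed
next
  case (3 b bs)
  have "pre ! 0 < a" using 3 nth_mem by fastforce
  moreover have "length (takeWhile (\<lambda>x. x < a) (map ((!) (pre @ v)) (mark b bs))) \<in> {l. l < length bs \<and> bs ! l}"
    by (rule 3(1)) (use 3 in auto)
  moreover have "(pre @ v) ! 0 = pre ! 0" using 3 by (simp add: nth_append)
  ultimately show ?case by simp
qed auto

text \<open>Pigeonhole on lengths: among \<open>r * m\<close> lengths some \<open>m\<close> share a
  colour, and a word with parameters only at the corresponding positions realises no other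
  length.\<close>

lemma initial_segment_ramsey:
  assumes "0 < a"
  shows "\<exists>n. \<forall>(\<gamma> :: nat list \<Rightarrow> nat) C. finite C \<and> card C \<le> r \<and> \<gamma> ` short_words a n \<subseteq> C \<longrightarrow>
      (\<exists>W\<in>rwords a m n. \<exists>q. \<forall>v. length v = m \<and> \<not> set v \<subseteq> {..<a} \<longrightarrow>
        \<gamma> (takeWhile (\<lambda>x. x < a) (subst a v W)) = q)"
proof -
  from initial_segment_colour_by_length[OF assms, of r "r * m"] obtain n
    where n: "\<forall>(\<gamma> :: nat list \<Rightarrow> nat) C. finite C \<and> card C \<le> r \<and> \<gamma> ` short_words a n \<subseteq> C \<longrightarrow>
      (\<exists>W\<in>rwords a (r * m) n. \<exists>q. \<forall>v. length v = r * m \<and> \<not> set v \<subseteq> {..<a} \<longrightarrow>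
        \<gamma> (takeWhile (\<lambda>x. x < a) (subst a v W)) = q (length (takeWhile (\<lambda>x. x < a) v)))"
    by (rule exE)
  show ?thesis
  proof (intro exI[of _ n] allI impI, elim conjE)
    fix \<gamma> :: "nat list \<Rightarrow> nat" and C
    assume C: "finite C" "card C \<le> r" and \<gamma>: "\<gamma> ` short_words a n \<subseteq> C"
    from n[rule_format, OF conjI[OF C(1) conjI[OF C(2) \<gamma>]]] obtain W q where W: "W \<in> rwords a (r * m) n"
      and q[rule_format]: "\<forall>v. length v = r * m \<and> \<not> set v \<subseteq> {..<a} \<longrightarrow>
        \<gamma> (takeWhile (\<lambda>x. x < a) (subst a v W)) = q (length (takeWhile (\<lambda>x. x < a) v))"
      by (elim bexE exE)
    have "q j \<in> C" if "j < r * m" for j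
    proof -
      \<comment> \<open>A filling whose initial segment has length exactly \<open>j\<close>, so that
        \<open>q j\<close> is a colour that occurs.\<close>
      define v where "v = replicate j 0 @ replicate (r * m - j) a"
      have v: "length v = r * m" "\<not> set v \<subseteq> {..<a}" "length (takeWhile (\<lambda>x. x < a) v) = j"
        using that assms by (auto simp: v_def takeWhile_append)
      have "takeWhile (\<lambda>x. x < a) (subst a v W) \<in> short_words a n"
        using length_takeWhile_le[of "\<lambda>x. x < a" "subst a v W"] W
        by (auto simp: short_words_def rwords_def dest: set_takeWhileD)
      then show ?thesis using q[of v] v \<gamma> by auto
    qed
    then have qC: "q ` {..<r * m} \<subseteq> C" by auto
    have "\<exists>c. m \<le> card {j \<in> {..<r * m}. q j = c}"
    proof (rule ccontr)
      assume neg: "\<nexists>c. m \<le> card {j \<in> {..<r * m}. q j = c}"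
      then have "0 < m" by (metis gr0I le0)
      have "card {..<r * m} = (\<Sum>c\<in>C. card {j \<in> {..<r * m}. q j = c})"
        using sum.group[OF _ C(1) qC, of "\<lambda>_. 1::nat"] by simp
      also have "\<dots> \<le> (\<Sum>c\<in>C. m - 1)"
        by (rule sum_mono) (metis neg \<open>0 < m\<close> Suc_pred' less_Suc_eq_le not_le)
      also have "\<dots> \<le> r * (m - 1)" using C by simp
      finally have "r * m \<le> r * (m - 1)" by simp
      moreover have "0 < r"
      proof -
        have "[] \<in> short_words a n" by (simp add: short_words_def)
        then show ?thesis using \<gamma> C by (metis card_gt_0_iff empty_iff image_subset_iff le_zero_eq neq0_conv)
      qed
      ultimately show False using \<open>0 < m\<close> by simp
    qed
    then obtain c where "m \<le> card {j \<in> {..<r * m}. q j = c}" by (rule exE)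
    then obtain J where "J \<subseteq> {j \<in> {..<r * m}. q j = c}" "card J = m" by (rule obtain_subset_with_card_n)
    then have J: "J \<subseteq> {..<r * m}" "card J = m" "\<And>j. j \<in> J \<Longrightarrow> q j = c" by auto
    define bs where "bs = map (\<lambda>j. j \<in> J) [0..<r * m]"
    have bs: "length bs = r * m" "length (filter id bs) = m"
    proof -
      show "length bs = r * m" by (simp add: bs_def)
      have "{i. i < r * m \<and> bs ! i} = J" using J by (auto simp: bs_def)
      then show "length (filter id bs) = m" using J by (simp add: length_filter_conv_card bs_def)
    qed
    have Y: "mark a bs \<in> rwords a m (r * m)" using rigid_mark[OF assms, of bs] bs by (simp add: rwords_def)
    show "\<exists>W\<in>rwords a m n. \<exists>q. \<forall>v. length v = m \<and> \<not> set v \<subseteq> {..<a} \<longrightarrow>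
        \<gamma> (takeWhile (\<lambda>x. x < a) (subst a v W)) = q"
    proof (intro bexI exI allI impI, elim conjE)
      show "subst a (mark a bs) W \<in> rwords a m n" using subst_in_rwords[OF W Y] by simp
      fix v assume v: "length v = m" "\<not> set v \<subseteq> {..<a}"
      define y where "y = subst a v (mark a bs)"
      have l: "length (takeWhile (\<lambda>x. x < a) y) \<in> {l. l < length bs \<and> bs ! l}"
        unfolding y_def subst_def by (rule length_takeWhile_mark) (use v bs assms in auto)
      then have "length (takeWhile (\<lambda>x. x < a) y) \<in> J" by (auto simp: bs_def)
      moreover have "length y = r * m" using bs by (simp add: y_def)
      moreover have "\<not> set y \<subseteq> {..<a}"
      proof
        assume "set y \<subseteq> {..<a}"
        then have "takeWhile (\<lambda>x. x < a) y = y" by (intro takeWhile_eq_all_conv[THEN iffD2]) auto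
        then have "length (takeWhile (\<lambda>x. x < a) y) = length y" by (rule arg_cong)
        then show False using l bs \<open>length y = r * m\<close> by simp
      qed
      ultimately have "\<gamma> (takeWhile (\<lambda>x. x < a) (subst a y W)) = c" using q[of y] J by simp
      moreover have "subst a v (subst a (mark a bs) W) = subst a y W"
        using subst_subst[OF W, of "mark a bs" a v] bs by (simp add: y_def)
      ultimately show "\<gamma> (takeWhile (\<lambda>x. x < a) (subst a v (subst a (mark a bs) W))) = c" by simp
    qed
  qed
qed

text \<open>Induction on \<open>k\<close>, with the number of constants varying: the case of
  \<open>k\<close> parameters over one more constant reduces the colouring to one of initial
  segments, and the pigeonhole result makes that one constant.\<close>

lemma ramsey_pos:
  assumes "0 < a"
  shows "\<exists>n. ramsey a k m r n"
  using assms
proof (induction k arbitrary: a m r)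
  case 0
  then show ?case by (rule hales_jewett)
next
  case (Suc k)
  have IH: "\<exists>n. ramsey (Suc a) k m r n" for m r by (rule Suc.IH) simp
  define tw where "tw = takeWhile (\<lambda>x. x < a)"
  \<comment> \<open>One colour more than \<open>r\<close>: the default value 0 goes to short words
    that are not the initial segment of any word in \<open>rwords a (Suc k) M\<close>.\<close>
  from initial_segment_ramsey[OF Suc.prems, of "Suc r" m, folded tw_def] obtain M
    where M: "\<forall>(\<gamma> :: nat list \<Rightarrow> nat) C. finite C \<and> card C \<le> Suc r \<and> \<gamma> ` short_words a M \<subseteq> C \<longrightarrow>
      (\<exists>W\<in>rwords a m M. \<exists>q. \<forall>v. length v = m \<and> \<not> set v \<subseteq> {..<a} \<longrightarrow> \<gamma> (tw (subst a v W)) = q)"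
    by (rule exE)
  from ramsey_Suc_by_initial_segment[OF IH, of r M, folded tw_def] obtain n
    where n: "\<forall>(\<gamma> :: nat list \<Rightarrow> nat) C. finite C \<and> card C \<le> r \<and> \<gamma> ` rwords a (Suc k) n \<subseteq> C \<longrightarrow>
      (\<exists>W\<in>rwords a M n. \<forall>v\<in>rwords a (Suc k) M. \<forall>v'\<in>rwords a (Suc k) M.
        tw v = tw v' \<longrightarrow> \<gamma> (subst a v W) = \<gamma> (subst a v' W))"
    by (rule exE)
  have "ramsey a (Suc k) m r n"
    unfolding ramsey_def
  proof (intro allI impI, elim conjE)
    fix \<gamma> :: "nat list \<Rightarrow> nat" and C
    assume C: "finite C" "card C \<le> r" and \<gamma>: "\<gamma> ` rwords a (Suc k) n \<subseteq> C"
    from n[rule_format, OF conjI[OF C(1) conjI[OF C(2) \<gamma>]]] obtain W1 where W1: "W1 \<in> rwords a M n"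
      and W1'[rule_format]: "\<forall>v\<in>rwords a (Suc k) M. \<forall>v'\<in>rwords a (Suc k) M.
        tw v = tw v' \<longrightarrow> \<gamma> (subst a v W1) = \<gamma> (subst a v' W1)"
      by (rule bexE)
    define P where "P u v \<longleftrightarrow> v \<in> rwords a (Suc k) M \<and> tw v = u" for u v
    define \<psi> where "\<psi> u = (if \<exists>v. P u v then \<gamma> (subst a (SOME v. P u v) W1) else 0)" for u
    have \<psi>: "\<psi> (tw v) = \<gamma> (subst a v W1)" if "v \<in> rwords a (Suc k) M" for v
    proof -
      have "P (tw v) v" using that by (simp add: P_def)
      then have "P (tw v) (SOME w. P (tw v) w)" by (rule someI)
      then have "\<gamma> (subst a (SOME w. P (tw v) w) W1) = \<gamma> (subst a v W1)"
        using W1'[of "SOME w. P (tw v) w" v] that by (simp only: P_def)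
      then show ?thesis using \<open>P (tw v) v\<close> unfolding \<psi>_def by (simp only: if_True) metis
    qed
    have "\<psi> u \<in> insert 0 C" for u
    proof (cases "\<exists>v. P u v")
      case True
      then obtain v where v: "v \<in> rwords a (Suc k) M" "tw v = u" by (auto simp: P_def)
      have "subst a v W1 \<in> rwords a (Suc k) n" using subst_in_rwords[OF W1 v(1)] by simp
      then show ?thesis using \<psi>[OF v(1)] v \<gamma> by auto
    qed (simp add: \<psi>_def)
    then have \<psi>_ran: "\<psi> ` short_words a M \<subseteq> insert 0 C" by (intro image_subsetI)
    have "finite (insert 0 C)" "card (insert 0 C) \<le> Suc r" using C by (simp_all add: card_insert_if)
    from M[rule_format, OF conjI[OF this(1) conjI[OF this(2) \<psi>_ran]]] obtain W2 q where W2: "W2 \<in> rwords a m M"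
      and q[rule_format]: "\<forall>v. length v = m \<and> \<not> set v \<subseteq> {..<a} \<longrightarrow> \<psi> (tw (subst a v W2)) = q"
      by (elim bexE exE)
    show "\<exists>W\<in>rwords a m n. \<exists>q. \<forall>v\<in>rwords a (Suc k) m. \<gamma> (subst a v W) = q"
    proof (intro bexI exI ballI)
      show "subst a W2 W1 \<in> rwords a m n" using subst_in_rwords[OF W1 W2] by simp
      fix v assume v: "v \<in> rwords a (Suc k) m"
      have "\<not> set w \<subseteq> {..<a}" if "rigid a (Suc k) w" for w using that by (induction w) auto
      then have "\<psi> (tw (subst a v W2)) = q" using q[of v] v by (auto simp: rwords_def)
      moreover have "subst a v W2 \<in> rwords a (Suc k) M" using subst_in_rwords[OF W2 v] by simp
      ultimately show "\<gamma> (subst a v (subst a W2 W1)) = q"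
        using \<psi> subst_subst[OF W1, of W2 a v] W2 by (simp add: rwords_def)
    qed
  qed
  then show ?case by blast
qed

text \<open>A nonempty rigid word without constants begins with 0, and from then on 0 acts as a
  constant. Deleting this letter leads to the case of one constant.\<close>

theorem dual_ramsey:
  assumes "0 < k" "0 < m"
  shows "\<exists>n>0. ramsey 0 k m r n"
proof -
  obtain k' m' where km: "k = Suc k'" "m = Suc m'" using assms by (meson gr0_implies_Suc)
  obtain n where n: "ramsey (Suc 0) k' m' r n" using ramsey_pos by blast
  have R: "w \<in> rwords 0 (Suc j) (Suc l) \<longleftrightarrow> (\<exists>v. w = 0 # v \<and> v \<in> rwords (Suc 0) j l)" for w j l
    by (cases w) (auto simp: rwords_def)
  have S: "subst 0 (0 # v) (0 # w) = 0 # subst (Suc 0) v w" for v w by (simp add: subst_def)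
  have "ramsey 0 k m r (Suc n)"
    unfolding ramsey_def
  proof (intro allI impI, elim conjE)
    fix \<gamma> :: "nat list \<Rightarrow> nat" and C
    assume C: "finite C" "card C \<le> r" and \<gamma>: "\<gamma> ` rwords 0 k (Suc n) \<subseteq> C"
    then have "(\<lambda>w. \<gamma> (0 # w)) ` rwords (Suc 0) k' n \<subseteq> C" by (auto simp: km R)
    from ramseyD[OF n C this] obtain W q where "W \<in> rwords (Suc 0) m' n"
      and "\<And>v. v \<in> rwords (Suc 0) k' m' \<Longrightarrow> \<gamma> (0 # subst (Suc 0) v W) = q" by metis
    then show "\<exists>W\<in>rwords 0 m (Suc n). \<exists>q. \<forall>v\<in>rwords 0 k m. \<gamma> (subst 0 v W) = q"
      unfolding km by (intro bexI[of _ "0 # W"] exI[of _ q]) (auto simp: R S)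
  qed
  then show ?thesis by blast
qed

section \<open>The Vietoris topology and the compact-open topology\<close>

text \<open>Alexander's subbase theorem, transferred from the description by unions of finite
  intersections to \<open>topology_generated_by\<close>.\<close>

lemma compact_space_generated_by:
  assumes fin: "\<And>C. C \<subseteq> \<B> \<Longrightarrow> \<Union>C = \<Union>\<B> \<Longrightarrow> \<exists>C'. finite C' \<and> C' \<subseteq> C \<and> \<Union>C' = \<Union>\<B>"
  shows "compact_space (topology_generated_by \<B>)"
proof -
  let ?T = "topology (arbitrary union_of (finite intersection_of (\<lambda>x. x \<in> \<B>) relative_to \<Union>\<B>))"
  have "openin ?T = openin (topology_generated_by \<B>)"
  proof (rule ext, rule iffI)
    fix V assume "openin ?T V"
    then show "openin (topology_generated_by \<B>) V"
      by (rule minimal_topology_subbase[rotated 2])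
        (auto intro: topology_generated_by_Basis simp: openin_Union)
  next
    fix V assume "openin (topology_generated_by \<B>) V"
    then have "generate_topology_on \<B> V" by (rule openin_topology_generated_by)
    then show "openin ?T V"
    proof induction
      case (Basis s)
      have "openin ?T (\<Union>\<B> \<inter> s)"
        unfolding openin_subbase using Basis
        by (intro arbitrary_union_of_inc relative_to_inc finite_intersection_of_inc)
      moreover have "\<Union>\<B> \<inter> s = s" using Basis by blast
      ultimately show ?case by simp
    qed auto
  qed
  then have "?T = topology_generated_by \<B>" by (metis topology_eq)
  then show ?thesis
    by (rule Alexander_subbase) (use fin in simp)
qed

lemma Vietoris_subbasis_Union:
  "\<Union>({{F \<in> Exp X. F \<subseteq> U} | U. openin X U} \<union> {{F \<in> Exp X. F \<inter> U \<noteq> {}} | U. openin X U}) = Exp X"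
proof -
  have "Exp X = {F \<in> Exp X. F \<subseteq> topspace X}" by (auto simp: Exp_def closedin_def)
  then show ?thesis by blast
qed

lemma topspace_Vietoris[simp]: "topspace (Vietoris X) = Exp X"
  unfolding Vietoris_def topology_generated_by_topspace Vietoris_subbasis_Union ..

lemma openin_Vietoris_subset: "openin X U \<Longrightarrow> openin (Vietoris X) {F \<in> Exp X. F \<subseteq> U}"
  unfolding Vietoris_def by (rule topology_generated_by_Basis) blast

lemma openin_Vietoris_hit: "openin X U \<Longrightarrow> openin (Vietoris X) {F \<in> Exp X. F \<inter> U \<noteq> {}}"
  unfolding Vietoris_def by (rule topology_generated_by_Basis) blast

lemma Exp_subset: "F \<in> Exp X \<Longrightarrow> F \<subseteq> topspace X"
  by (simp add: Exp_def closedin_subset)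

lemma closedin_Vietoris_hit:
  assumes "closedin X C"
  shows "closedin (Vietoris X) {F \<in> Exp X. F \<inter> C \<noteq> {}}"
proof -
  have "openin (Vietoris X) {F \<in> Exp X. F \<subseteq> topspace X - C}"
    by (rule openin_Vietoris_subset) (use assms in blast)
  moreover have "topspace (Vietoris X) - {F \<in> Exp X. F \<inter> C \<noteq> {}} = {F \<in> Exp X. F \<subseteq> topspace X - C}"
    using Exp_subset by fastforce
  ultimately show ?thesis unfolding closedin_def by auto
qed

lemma closedin_Vietoris_miss:
  assumes "openin X U"
  shows "closedin (Vietoris X) {F \<in> Exp X. F \<inter> U = {}}"
proof -
  have "topspace (Vietoris X) - {F \<in> Exp X. F \<inter> U = {}} = {F \<in> Exp X. F \<inter> U \<noteq> {}}"
    using Exp_subset by fastforce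
  then show ?thesis unfolding closedin_def using openin_Vietoris_hit[OF assms] by auto
qed

lemma openin_Vietoris_miss:
  assumes "closedin X C"
  shows "openin (Vietoris X) {F \<in> Exp X. F \<inter> C = {}}"
proof -
  have "{F \<in> Exp X. F \<inter> C = {}} = topspace (Vietoris X) - {F \<in> Exp X. F \<inter> C \<noteq> {}}"
    by auto
  then show ?thesis using openin_diff[OF openin_topspace closedin_Vietoris_hit[OF assms]] by simp
qed

text \<open>By Alexander's theorem only subbasic covers matter. Let \<open>K\<close> be the part of
  \<open>X\<close> that the open sets of hit type in the cover leave out. If \<open>K\<close> is
  nonempty, it is itself a point of \<open>Exp X\<close> in no set of hit type, so the cover
  contains the set of all \<open>F \<subseteq> U\<close> for some \<open>U\<close> containing
  \<open>K\<close>; every other \<open>F\<close> meets the compact complement of \<open>U\<close>,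
  for which finitely many hit sets suffice. If \<open>K\<close> is empty, \<open>X\<close> plays the
  role of that complement.\<close>

lemma compact_space_Vietoris:
  assumes "compact_space X"
  shows "compact_space (Vietoris X)"
  unfolding Vietoris_def
proof (rule compact_space_generated_by, unfold Vietoris_subbasis_Union)
  fix \<C> assume \<C>: "\<C> \<subseteq> {{F \<in> Exp X. F \<subseteq> U} | U. openin X U} \<union> {{F \<in> Exp X. F \<inter> U \<noteq> {}} | U. openin X U}"
    and cover: "\<Union>\<C> = Exp X"
  define \<V> where "\<V> = {V. openin X V \<and> {F \<in> Exp X. F \<inter> V \<noteq> {}} \<in> \<C>}"
  have V_open: "openin X V" if "V \<in> \<V>" for V using that by (simp add: \<V>_def)
  define K where "K = topspace X - \<Union>\<V>"
  have clK: "closedin X K" by (auto simp: K_def \<V>_def)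
  have fin: "\<exists>\<F>. finite \<F> \<and> \<F> \<subseteq> \<C> \<and> (\<forall>F\<in>Exp X. F \<inter> C \<noteq> {} \<longrightarrow> F \<in> \<Union>\<F>)"
    if C: "closedin X C" "C \<subseteq> \<Union>\<V>" for C
  proof -
    have "compactin X C" using C assms closedin_compact_space by blast
    then have "\<exists>\<W>. finite \<W> \<and> \<W> \<subseteq> \<V> \<and> C \<subseteq> \<Union>\<W>"
      using C(2) V_open by (intro compactinD)
    then obtain \<W> where \<W>: "finite \<W>" "\<W> \<subseteq> \<V>" "C \<subseteq> \<Union>\<W>" by blast
    show ?thesis
    proof (intro exI conjI ballI impI)
      show "finite ((\<lambda>V. {F \<in> Exp X. F \<inter> V \<noteq> {}}) ` \<W>)" using \<W> by simp
      show "(\<lambda>V. {F \<in> Exp X. F \<inter> V \<noteq> {}}) ` \<W> \<subseteq> \<C>" using \<W> by (auto simp: \<V>_def)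
      fix F assume F: "F \<in> Exp X" "F \<inter> C \<noteq> {}"
      then obtain x V where "x \<in> F" "V \<in> \<W>" "x \<in> V" using \<W>(3) by blast
      then show "F \<in> \<Union>((\<lambda>V. {F \<in> Exp X. F \<inter> V \<noteq> {}}) ` \<W>)" using F by blast
    qed
  qed
  have up: "\<Union>\<F> \<subseteq> Exp X" if "\<F> \<subseteq> \<C>" for \<F> using Union_mono[OF that] cover by simp
  show "\<exists>\<C>'. finite \<C>' \<and> \<C>' \<subseteq> \<C> \<and> \<Union>\<C>' = Exp X"
  proof (cases "K = {}")
    case True
    then have "topspace X \<subseteq> \<Union>\<V>" by (auto simp: K_def)
    then obtain \<F> where \<F>: "finite \<F>" "\<F> \<subseteq> \<C>" "\<forall>F\<in>Exp X. F \<inter> topspace X \<noteq> {} \<longrightarrow> F \<in> \<Union>\<F>"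
      using fin[of "topspace X"] by auto
    have "F \<in> \<Union>\<F>" if "F \<in> Exp X" for F
    proof -
      have "F \<inter> topspace X \<noteq> {}" using that Exp_subset[OF that] by (auto simp: Exp_def)
      then show ?thesis using \<F> that by blast
    qed
    then have "\<Union>\<F> = Exp X" using up[OF \<F>(2)] by blast
    then show ?thesis using \<F> by blast
  next
    case False
    then have "K \<in> Exp X" using clK by (simp add: Exp_def)
    then obtain c where c: "c \<in> \<C>" "K \<in> c" using cover by blast
    have "\<nexists>V. openin X V \<and> c = {F \<in> Exp X. F \<inter> V \<noteq> {}}"
      using c by (auto simp: K_def \<V>_def)
    moreover have "c \<in> {{F \<in> Exp X. F \<subseteq> U} | U. openin X U} \<union> {{F \<in> Exp X. F \<inter> U \<noteq> {}} | U. openin X U}"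
      using \<C> c(1) by (rule subsetD)
    ultimately obtain U where U: "openin X U" "c = {F \<in> Exp X. F \<subseteq> U}" by auto
    have "closedin X (topspace X - U)" "topspace X - U \<subseteq> \<Union>\<V>"
      using U c by (auto simp: K_def)
    from fin[OF this] obtain \<F> where \<F>: "finite \<F>" "\<F> \<subseteq> \<C>" "\<forall>F\<in>Exp X. F \<inter> (topspace X - U) \<noteq> {} \<longrightarrow> F \<in> \<Union>\<F>"
      by (elim exE conjE)
    have "F \<in> \<Union>(insert c \<F>)" if "F \<in> Exp X" for F
      using \<F> U that Exp_subset[OF that] by (cases "F \<subseteq> U") auto
    moreover have "insert c \<F> \<subseteq> \<C>" using c \<F> by simp
    ultimately have "\<Union>(insert c \<F>) = Exp X" using up by blast
    then show ?thesis using \<F>(1) \<open>insert c \<F> \<subseteq> \<C>\<close> finite_insert by blast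
  qed
qed

lemma Hausdorff_space_Vietoris:
  assumes "compact_space X" "Hausdorff_space X"
  shows "Hausdorff_space (Vietoris X)"
proof -
  have reg: "regular_space X" using assms compact_Hausdorff_imp_regular_space by blast
  have sep: "\<exists>U V. openin (Vietoris X) U \<and> openin (Vietoris X) V \<and> E \<in> U \<and> F \<in> V \<and> disjnt U V"
    if EF: "E \<in> Exp X" "F \<in> Exp X" "x \<in> E" "x \<notin> F" for E F x
  proof -
    have "closedin X F" "x \<in> topspace X - F" using EF Exp_subset by (auto simp: Exp_def)
    then obtain U V where UV: "openin X U" "openin X V" "x \<in> U" "F \<subseteq> V" "disjnt U V"
      using reg unfolding regular_space_def by metis
    show ?thesis
    proof (intro exI conjI)
      show "openin (Vietoris X) {E \<in> Exp X. E \<inter> U \<noteq> {}}" by (rule openin_Vietoris_hit) fact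
      show "openin (Vietoris X) {F \<in> Exp X. F \<subseteq> V}" by (rule openin_Vietoris_subset) fact
      show "disjnt {E \<in> Exp X. E \<inter> U \<noteq> {}} {F \<in> Exp X. F \<subseteq> V}"
        using UV(5) unfolding disjnt_def by blast
    qed (use EF UV in auto)
  qed
  show ?thesis
    unfolding Hausdorff_space_def
  proof (intro allI impI, elim conjE)
    fix E F assume "E \<in> topspace (Vietoris X)" "F \<in> topspace (Vietoris X)" "E \<noteq> F"
    then have EF: "E \<in> Exp X" "F \<in> Exp X" "E \<noteq> F" by auto
    then consider x where "x \<in> E" "x \<notin> F" | x where "x \<in> F" "x \<notin> E" by blast
    then show "\<exists>U V. openin (Vietoris X) U \<and> openin (Vietoris X) V \<and> E \<in> U \<and> F \<in> V \<and> disjnt U V"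
    proof cases
      case 1
      then show ?thesis using sep EF by blast
    next
      case 2
      then show ?thesis using sep[of F E x] EF by (metis disjnt_sym)
    qed
  qed
qed

text \<open>Stated for an arbitrary parameter space and map so that it can be iterated, from points
  to closed sets and on to sets of closed sets. A condition \<open>F \<subseteq> U\<close> needs the
  tube lemma for the compact \<open>F\<close>; for a hit set one point of \<open>F\<close>
  suffices.\<close>

lemma continuous_map_Vietoris_action:
  assumes X: "compact_space X" "Hausdorff_space X"
    and act: "continuous_map (prod_topology T X) X (\<lambda>(g, x). \<phi> g x)"
  shows "continuous_map (prod_topology T (Vietoris X)) (Vietoris X) (\<lambda>(g, F). \<phi> g ` F)"
proof -
  have im: "\<phi> g ` F \<in> Exp X" if g: "g \<in> topspace T" and F: "F \<in> Exp X" for g F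
  proof -
    have "continuous_map X X ((\<lambda>(g, x). \<phi> g x) \<circ> (\<lambda>x. (g, x)))"
      by (rule continuous_map_compose[OF _ act]) (use g in \<open>simp add: continuous_map_pairwise o_def\<close>)
    then have "continuous_map X X (\<phi> g)" by (simp add: o_def)
    moreover have "compactin X F" using F X closedin_compact_space by (auto simp: Exp_def)
    ultimately have "compactin X (\<phi> g ` F)" using image_compactin by blast
    then show ?thesis using X F compactin_imp_closedin by (auto simp: Exp_def)
  qed
  have pre: "openin (prod_topology T X) {p \<in> topspace T \<times> topspace X. \<phi> (fst p) (snd p) \<in> U}" if "openin X U" for U
    using openin_continuous_map_preimage[OF act that] by (simp add: case_prod_beta)
  have "continuous_map (prod_topology T (Vietoris X)) (topology_generated_by
     ({{F \<in> Exp X. F \<subseteq> U} | U. openin X U} \<union> {{F \<in> Exp X. F \<inter> U \<noteq> {}} | U. openin X U})) (\<lambda>(g, F). \<phi> g ` F)"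
    unfolding continuous_on_generated_topo_iff Vietoris_subbasis_Union
  proof (intro conjI allI impI)
    show "(\<lambda>(g, F). \<phi> g ` F) ` topspace (prod_topology T (Vietoris X)) \<subseteq> Exp X" using im by auto
    fix S assume "S \<in> {{F \<in> Exp X. F \<subseteq> U} | U. openin X U} \<union> {{F \<in> Exp X. F \<inter> U \<noteq> {}} | U. openin X U}"
    then consider U where "openin X U" "S = {F \<in> Exp X. F \<subseteq> U}"
      | U where "openin X U" "S = {F \<in> Exp X. F \<inter> U \<noteq> {}}" by blast
    then show "openin (prod_topology T (Vietoris X)) ((\<lambda>(g, F). \<phi> g ` F) -` S \<inter> topspace (prod_topology T (Vietoris X)))"
    proof cases
      case 1
      show ?thesis
      proof (subst openin_subopen, rule ballI)
        fix p assume "p \<in> (\<lambda>(g, F). \<phi> g ` F) -` S \<inter> topspace (prod_topology T (Vietoris X))"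
        then obtain g F where p: "p = (g, F)" and g: "g \<in> topspace T" and F: "F \<in> Exp X" and gF: "\<phi> g ` F \<in> S" by auto
        from gF have sub: "{g} \<times> F \<subseteq> {p \<in> topspace T \<times> topspace X. \<phi> (fst p) (snd p) \<in> U}"
          using 1 g Exp_subset[OF F] by auto
        have "compactin X F" using F X closedin_compact_space by (auto simp: Exp_def)
        from tube_lemma_right[OF pre[OF 1(1)] this g sub] obtain N V where NV: "openin T N" "openin X V" "g \<in> N" "F \<subseteq> V"
          "N \<times> V \<subseteq> {p \<in> topspace T \<times> topspace X. \<phi> (fst p) (snd p) \<in> U}" by (elim exE conjE)
        show "\<exists>W. openin (prod_topology T (Vietoris X)) W \<and> p \<in> W \<and>
          W \<subseteq> (\<lambda>(g, F). \<phi> g ` F) -` S \<inter> topspace (prod_topology T (Vietoris X))"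
        proof (intro exI conjI)
          show "openin (prod_topology T (Vietoris X)) (N \<times> {F \<in> Exp X. F \<subseteq> V})"
            using NV openin_Vietoris_subset[OF NV(2)] by (simp add: openin_prod_Times_iff)
          show "N \<times> {F \<in> Exp X. F \<subseteq> V} \<subseteq> (\<lambda>(g, F). \<phi> g ` F) -` S \<inter> topspace (prod_topology T (Vietoris X))"
          proof (rule subsetI, elim SigmaE)
            fix p' h E assume p': "p' = (h, E)" and "h \<in> N" "E \<in> {F \<in> Exp X. F \<subseteq> V}"
            then have "h \<in> N" "E \<in> Exp X" "E \<subseteq> V" by auto
            moreover have "h \<in> topspace T" using \<open>h \<in> N\<close> NV openin_subset by blast
            moreover have "\<phi> h ` E \<subseteq> U" using NV(5) calculation by fastforce
            ultimately show "p' \<in> (\<lambda>(g, F). \<phi> g ` F) -` S \<inter> topspace (prod_topology T (Vietoris X))" using im 1 p' by auto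
          qed
        qed (use NV F p in auto)
      qed
    next
      case 2
      show ?thesis
      proof (subst openin_subopen, rule ballI)
        fix p assume "p \<in> (\<lambda>(g, F). \<phi> g ` F) -` S \<inter> topspace (prod_topology T (Vietoris X))"
        then obtain g F where p: "p = (g, F)" and g: "g \<in> topspace T" and F: "F \<in> Exp X" and gF: "\<phi> g ` F \<in> S" by auto
        from gF obtain x where x: "x \<in> F" "\<phi> g x \<in> U" using 2 by blast
        then have "(g, x) \<in> {p \<in> topspace T \<times> topspace X. \<phi> (fst p) (snd p) \<in> U}"
          using g F Exp_subset by force
        from pre[OF 2(1), unfolded openin_prod_topology_alt, rule_format, OF this] obtain N V where NV: "openin T N" "openin X V" "g \<in> N" "x \<in> V"
          "N \<times> V \<subseteq> {p \<in> topspace T \<times> topspace X. \<phi> (fst p) (snd p) \<in> U}" by (elim exE conjE)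
        show "\<exists>W. openin (prod_topology T (Vietoris X)) W \<and> p \<in> W \<and>
          W \<subseteq> (\<lambda>(g, F). \<phi> g ` F) -` S \<inter> topspace (prod_topology T (Vietoris X))"
        proof (intro exI conjI)
          show "openin (prod_topology T (Vietoris X)) (N \<times> {F \<in> Exp X. F \<inter> V \<noteq> {}})"
            using NV openin_Vietoris_hit[OF NV(2)] by (simp add: openin_prod_Times_iff)
          show "N \<times> {F \<in> Exp X. F \<inter> V \<noteq> {}} \<subseteq> (\<lambda>(g, F). \<phi> g ` F) -` S \<inter> topspace (prod_topology T (Vietoris X))"
          proof (rule subsetI, elim SigmaE)
            fix p' h E assume p': "p' = (h, E)" and "h \<in> N" "E \<in> {F \<in> Exp X. F \<inter> V \<noteq> {}}"
            then have "h \<in> N" "E \<in> Exp X" "E \<inter> V \<noteq> {}" by auto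
            moreover have "h \<in> topspace T" using \<open>h \<in> N\<close> NV openin_subset by blast
            moreover have "\<phi> h ` E \<inter> U \<noteq> {}" using NV(5) calculation by fastforce
            ultimately show "p' \<in> (\<lambda>(g, F). \<phi> g ` F) -` S \<inter> topspace (prod_topology T (Vietoris X))" using im 2 p' by auto
          qed
        qed (use NV F x p in auto)
      qed
    qed
  qed
  then show ?thesis unfolding Vietoris_def[of X] .
qed

lemma topspace_compact_open[simp]: "topspace (compact_open X H) = H"
proof -
  have "H = {g \<in> H. g ` {} \<subseteq> {}}" by auto
  moreover have "compactin X {}" "openin X {}" by auto
  ultimately show ?thesis unfolding compact_open_def topology_generated_by_topspace by blast
qed

text \<open>Regularity gives a closed, hence compact, neighbourhood \<open>K\<close> of
  \<open>x\<close> that \<open>g\<close> maps into \<open>U\<close>; the subbasic set of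
  \<open>K\<close> and \<open>U\<close> does the rest.\<close>

lemma continuous_map_compact_open_eval:
  assumes X: "compact_space X" "Hausdorff_space X" and H: "\<And>g. g \<in> H \<Longrightarrow> continuous_map X X g"
  shows "continuous_map (prod_topology (compact_open X H) X) X (\<lambda>(g, x). g x)"
proof -
  have reg: "regular_space X" using X compact_Hausdorff_imp_regular_space by blast
  show ?thesis
    unfolding continuous_map_def
  proof (intro conjI allI impI)
    show "(\<lambda>(g, x). g x) \<in> topspace (prod_topology (compact_open X H) X) \<rightarrow> topspace X"
      using H by (auto simp: continuous_map_def)
    fix U assume U: "openin X U"
    show "openin (prod_topology (compact_open X H) X)
      {p \<in> topspace (prod_topology (compact_open X H) X). (case p of (g, x) \<Rightarrow> g x) \<in> U}"
    proof (subst openin_subopen, rule ballI)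
      fix p assume "p \<in> {p \<in> topspace (prod_topology (compact_open X H) X). (case p of (g, x) \<Rightarrow> g x) \<in> U}"
      then obtain g x where p: "p = (g, x)" and gx: "g \<in> H" "x \<in> topspace X" "g x \<in> U" by auto
      have "openin X {x \<in> topspace X. g x \<in> U}" using H gx U by (simp add: continuous_map_def)
      then obtain V K where VK: "openin X V" "closedin X K" "x \<in> V" "V \<subseteq> K" "K \<subseteq> {x \<in> topspace X. g x \<in> U}"
        using reg[folded neighbourhood_base_of_closedin, unfolded neighbourhood_base_of, rule_format, of "{x \<in> topspace X. g x \<in> U}" x] gx
        by auto
      have "compactin X K" using VK X closedin_compact_space by blast
      then have "openin (compact_open X H) {g \<in> H. g ` K \<subseteq> U}"
        unfolding compact_open_def using U by (intro topology_generated_by_Basis) blast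
      then have "openin (prod_topology (compact_open X H) X) ({g \<in> H. g ` K \<subseteq> U} \<times> V)"
        using VK by (simp add: openin_prod_Times_iff)
      then show "\<exists>W. openin (prod_topology (compact_open X H) X) W \<and> p \<in> W \<and>
          W \<subseteq> {p \<in> topspace (prod_topology (compact_open X H) X). (case p of (g, x) \<Rightarrow> g x) \<in> U}"
        using VK gx p by (intro exI[of _ "{g \<in> H. g ` K \<subseteq> U} \<times> V"]) auto
    qed
  qed
qed

section \<open>Maximal chains as orderings of clopen partitions\<close>

text \<open>The finite intersection property for indexed families; asking for a point of
  \<open>topspace Y\<close> makes empty families harmless.\<close>

lemma compact_space_index_fip:
  assumes "compact_space Y" "\<And>i. i \<in> I \<Longrightarrow> closedin Y (K i)"
    and fip: "\<And>J. finite J \<Longrightarrow> J \<subseteq> I \<Longrightarrow> \<exists>y\<in>topspace Y. \<forall>i\<in>J. y \<in> K i"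
  shows "\<exists>y\<in>topspace Y. \<forall>i\<in>I. y \<in> K i"
proof -
  let ?\<U> = "insert (topspace Y) (K ` I)"
  have "\<forall>\<F>. finite \<F> \<and> \<F> \<subseteq> ?\<U> \<longrightarrow> \<Inter>\<F> \<noteq> {}"
  proof (intro allI impI, elim conjE)
    fix \<F> assume \<F>: "finite \<F>" "\<F> \<subseteq> ?\<U>"
    then have "finite (\<F> - {topspace Y})" "\<F> - {topspace Y} \<subseteq> K ` I" by auto
    then obtain J where J: "J \<subseteq> I" "finite J" "\<F> - {topspace Y} = K ` J" by (rule finite_subset_image[THEN exE]) blast
    from fip[OF J(2,1)] obtain y where "y \<in> topspace Y" "\<forall>i\<in>J. y \<in> K i" by (elim bexE)
    then have "y \<in> \<Inter>\<F>" using J by blast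
    then show "\<Inter>\<F> \<noteq> {}" by blast
  qed
  moreover have "\<forall>C\<in>?\<U>. closedin Y C" using assms by auto
  ultimately have "\<Inter>?\<U> \<noteq> {}" using assms(1)[unfolded compact_space_fip, rule_format, of ?\<U>] by blast
  then show ?thesis by auto
qed

lemma finite_chain_least:
  assumes "finite J" "J \<noteq> {}" "is_chain J"
  shows "\<exists>M\<in>J. \<forall>F\<in>J. M \<subseteq> F"
  using assms
proof (induction J rule: finite_ne_induct)
  case (insert E J)
  then obtain M where M: "M \<in> J" "\<forall>F\<in>J. M \<subseteq> F" by (auto simp: is_chain_def)
  then consider "E \<subseteq> M" | "M \<subseteq> E" using insert.prems by (auto simp: is_chain_def)
  then show ?case
  proof cases
    case 1
    then have "\<forall>F\<in>insert E J. E \<subseteq> F" using M by auto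
    then show ?thesis by blast
  next
    case 2
    then show ?thesis using M by blast
  qed
qed simp

lemma finite_chain_greatest:
  assumes "finite J" "J \<noteq> {}" "is_chain J"
  shows "\<exists>M\<in>J. \<forall>F\<in>J. F \<subseteq> M"
  using assms
proof (induction J rule: finite_ne_induct)
  case (insert E J)
  then obtain M where M: "M \<in> J" "\<forall>F\<in>J. F \<subseteq> M" by (auto simp: is_chain_def)
  then consider "E \<subseteq> M" | "M \<subseteq> E" using insert.prems by (auto simp: is_chain_def)
  then show ?case
  proof cases
    case 2
    then have "\<forall>F\<in>insert E J. F \<subseteq> E" using M by auto
    then show ?thesis by blast
  next
    case 1
    then show ?thesis using M by blast
  qed
qed simp

lemma is_chain_subset: "is_chain C \<Longrightarrow> D \<subseteq> C \<Longrightarrow> is_chain D"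
  by (auto simp: is_chain_def)

section \<open>The order that a chain induces on clopen sets\<close>

definition clopenin :: "'a topology \<Rightarrow> 'a set \<Rightarrow> bool" where
  "clopenin X A \<longleftrightarrow> openin X A \<and> closedin X A"

definition before :: "'a set set \<Rightarrow> 'a set \<Rightarrow> 'a set \<Rightarrow> bool" where
  "before c A B \<longleftrightarrow> (\<exists>F\<in>c. F \<inter> A \<noteq> {} \<and> F \<inter> B = {})"

lemma before_asym: "is_chain c \<Longrightarrow> before c A B \<Longrightarrow> \<not> before c B A"
  unfolding before_def is_chain_def by blast

lemma before_trans:
  assumes "is_chain c" "before c A B" "before c B D"
  shows "before c A D"
proof -
  obtain E F where EF: "E \<in> c" "E \<inter> A \<noteq> {}" "E \<inter> B = {}" "F \<in> c" "F \<inter> B \<noteq> {}" "F \<inter> D = {}"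
    using assms(2,3) unfolding before_def by (elim bexE conjE)
  then have "\<not> F \<subseteq> E" by blast
  moreover have "E \<subseteq> F \<or> F \<subseteq> E" using assms(1) EF(1,4) by (simp add: is_chain_def)
  ultimately have "E \<subseteq> F" by blast
  then show ?thesis unfolding before_def using EF by blast
qed

lemma clopen_separation:
  assumes "zero_dimensional X" "closedin X F" "x \<in> topspace X" "x \<notin> F"
  obtains A where "clopenin X A" "x \<in> A" "A \<inter> F = {}"
proof -
  have "openin X (topspace X - F)" "x \<in> topspace X - F" using assms by auto
  then obtain A where "openin X A" "closedin X A" "x \<in> A" "A \<subseteq> topspace X - F"
    using assms(1) unfolding zero_dimensional_def by blast
  then show thesis using that by (auto simp: clopenin_def)
qed

lemma maximal_chainsD:
  assumes "c \<in> maximal_chains X"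
  shows "c \<subseteq> Exp X" "is_chain c"
  using assms by (auto simp: maximal_chains_def)

lemma maximal_chains_absorb:
  assumes c: "c \<in> maximal_chains X" and E: "E \<in> Exp X" "\<And>F. F \<in> c \<Longrightarrow> E \<subseteq> F \<or> F \<subseteq> E"
  shows "E \<in> c"
proof -
  have "is_chain (insert E c)"
    using maximal_chainsD[OF c] E(2) by (auto simp: is_chain_def)
  moreover have "insert E c \<subseteq> Exp X" using maximal_chainsD[OF c] E by simp
  moreover have "\<And>D. D \<subseteq> Exp X \<Longrightarrow> is_chain D \<Longrightarrow> c \<subseteq> D \<Longrightarrow> D = c" using c by (simp add: maximal_chains_def)
  ultimately have "insert E c = c" by blast
  then show ?thesis by blast
qed

lemma topspace_in_maximal_chain:
  assumes "c \<in> maximal_chains X" "topspace X \<noteq> {}"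
  shows "topspace X \<in> c"
  by (rule maximal_chains_absorb[OF assms(1)])
    (use assms maximal_chainsD[OF assms(1)] Exp_subset in \<open>auto simp: Exp_def\<close>)

text \<open>By compactness the members of \<open>c\<close> that meet \<open>A\<close> share a point
  \<open>x0\<close> of \<open>A\<close>. The closure of the union of all members missing
  \<open>A\<close>, enlarged by \<open>x0\<close>, is comparable with every member and so belongs to
  \<open>c\<close>. It meets \<open>A\<close>, and it misses \<open>B\<close> unless some member
  reaches \<open>B\<close> before \<open>A\<close>.\<close>

lemma maximal_chain_total:
  assumes X: "compact_space X" "Hausdorff_space X" and c: "c \<in> maximal_chains X"
    and A: "closedin X A" "openin X A" "A \<noteq> {}" and B: "openin X B" "A \<inter> B = {}"
  shows "before c A B \<or> before c B A"
proof (rule disjCI)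
  assume nb: "\<not> before c B A"
  note ch = maximal_chainsD[OF c]
  define L where "L = {F \<in> c. F \<inter> A = {}}"
  define U where "U = {F \<in> c. F \<inter> A \<noteq> {}}"
  have fip: "\<exists>y\<in>topspace X. \<forall>F\<in>J. y \<in> F \<inter> A" if J: "finite J" "J \<subseteq> U" for J
  proof (cases "J = {}")
    case True
    then show ?thesis using A closedin_subset[OF A(1)] by blast
  next
    case False
    have "is_chain J" using J ch is_chain_subset[of c J] by (auto simp: U_def)
    from finite_chain_least[OF J(1) False this] obtain M where M: "M \<in> J" "\<forall>F\<in>J. M \<subseteq> F" by (elim bexE)
    have "M \<in> U" using M J by blast
    then obtain y where y: "y \<in> M" "y \<in> A" by (auto simp: U_def)
    then have "y \<in> topspace X" using closedin_subset[OF A(1)] by blast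
    then show ?thesis using M y by blast
  qed
  have cl: "closedin X (F \<inter> A)" if "F \<in> U" for F
    using that ch A by (auto simp: U_def Exp_def)
  have "\<exists>y\<in>topspace X. \<forall>F\<in>U. y \<in> F \<inter> A"
    by (rule compact_space_index_fip) (fact X(1) cl fip)+
  then obtain x0 where x0: "x0 \<in> topspace X" "\<And>F. F \<in> U \<Longrightarrow> x0 \<in> F \<inter> A" by blast
  obtain a where a: "a \<in> A" using A by blast
  then have "topspace X \<noteq> {}" using closedin_subset[OF A(1)] by blast
  from topspace_in_maximal_chain[OF c this] have "topspace X \<in> U"
    using a closedin_subset[OF A(1)] by (auto simp: U_def)
  then have x0A: "x0 \<in> A" using x0 by blast
  define K where "K = X closure_of \<Union>L"
  define E where "E = insert x0 K"
  have "closedin X {x0}" using x0 X by (simp add: closedin_Hausdorff_singleton)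
  then have clE: "closedin X E" using closedin_Un[of X "{x0}" K] by (simp add: E_def K_def)
  then have "E \<in> Exp X" by (simp add: Exp_def E_def)
  moreover have "E \<subseteq> F \<or> F \<subseteq> E" if F: "F \<in> c" for F
  proof (cases "F \<in> U")
    case True
    have "G \<subseteq> F" if "G \<in> L" for G
    proof -
      have "\<not> F \<subseteq> G" using that True by (auto simp: U_def L_def)
      then show ?thesis using that F ch(2) by (auto simp: L_def is_chain_def)
    qed
    then have "\<Union>L \<subseteq> F" by blast
    moreover have "closedin X F" using F ch by (auto simp: Exp_def)
    ultimately have "K \<subseteq> F" unfolding K_def by (rule closure_of_minimal)
    then show ?thesis using x0 True by (auto simp: E_def)
  next
    case False
    then have "F \<in> L" using F by (auto simp: U_def L_def)
    moreover have "\<Union>L \<subseteq> topspace X" using ch Exp_subset by (fastforce simp: L_def)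
    then have "\<Union>L \<subseteq> K" unfolding K_def by (rule closure_of_subset)
    ultimately show ?thesis by (auto simp: E_def)
  qed
  ultimately have "E \<in> c" by (rule maximal_chains_absorb[OF c])
  moreover have "E \<inter> A \<noteq> {}" using x0A by (auto simp: E_def)
  moreover have "E \<inter> B = {}"
  proof -
    have "B \<inter> \<Union>L = {}" using nb by (auto simp: L_def before_def)
    then have "B \<inter> K = {}" unfolding K_def using B(1) by (simp add: openin_Int_closure_of_eq_empty)
    then show ?thesis using x0A B by (auto simp: E_def)
  qed
  ultimately show "before c A B" by (auto simp: before_def)
qed

text \<open>A closed set outside \<open>c\<close> is incomparable with some member \<open>E\<close>.
  Hitting the complement of \<open>E\<close> and missing one point \<open>y\<close> of
  \<open>E\<close> is an open condition that preserves incomparability.\<close>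

lemma maximal_chain_closed:
  assumes X: "compact_space X" "Hausdorff_space X" "topspace X \<noteq> {}" and c: "c \<in> maximal_chains X"
  shows "c \<in> Exp (Vietoris X)"
proof -
  note ch = maximal_chainsD[OF c]
  have "openin (Vietoris X) (Exp X - c)"
  proof (subst openin_subopen, rule ballI)
    fix F assume F: "F \<in> Exp X - c"
    then obtain E where E: "E \<in> c" "\<not> E \<subseteq> F" "\<not> F \<subseteq> E" using maximal_chains_absorb[OF c, of F] by blast
    then obtain x y where xy: "x \<in> F" "x \<notin> E" "y \<in> E" "y \<notin> F" by blast
    have EX: "closedin X E" "E \<subseteq> topspace X" using E ch Exp_subset by (auto simp: Exp_def)
    have FX: "F \<subseteq> topspace X" using F Exp_subset by blast
    have "closedin X {y}" using xy EX X by (intro closedin_Hausdorff_singleton) auto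
    then have o: "openin (Vietoris X) {G \<in> Exp X. G \<inter> {y} = {}}" by (rule openin_Vietoris_miss)
    have "openin X (topspace X - E)" using EX by blast
    from openin_Int[OF openin_Vietoris_hit[OF this] o]
    show "\<exists>T. openin (Vietoris X) T \<and> F \<in> T \<and> T \<subseteq> Exp X - c"
    proof (intro exI conjI)
      show "F \<in> {F \<in> Exp X. F \<inter> (topspace X - E) \<noteq> {}} \<inter> {G \<in> Exp X. G \<inter> {y} = {}}"
        using F xy FX by auto
      show "{F \<in> Exp X. F \<inter> (topspace X - E) \<noteq> {}} \<inter> {G \<in> Exp X. G \<inter> {y} = {}} \<subseteq> Exp X - c"
      proof
        fix G assume G: "G \<in> {F \<in> Exp X. F \<inter> (topspace X - E) \<noteq> {}} \<inter> {G \<in> Exp X. G \<inter> {y} = {}}"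
        then have "\<not> G \<subseteq> E" "\<not> E \<subseteq> G" using xy by auto
        then show "G \<in> Exp X - c" using G E ch(2) by (auto simp: is_chain_def)
      qed
    qed
  qed
  moreover have "c \<noteq> {}" using topspace_in_maximal_chain[OF c X(3)] by blast
  ultimately show ?thesis using ch by (auto simp: Exp_def closedin_def)
qed

text \<open>Together with totality this describes maximal chains by conditions on pairs of disjoint
  clopen sets, each clopen in the double hyperspace. For maximality, let \<open>F\<close> be
  comparable with all of \<open>C\<close> but not in it. Compactness yields a clopen
  \<open>A\<close> that meets \<open>F\<close> and is missed by the members below \<open>F\<close>,
  and a clopen \<open>B\<close> that misses \<open>F\<close> and is met by the members above. Then
  neither of \<open>A - B\<close> and \<open>B\<close> comes before the other.\<close>

lemma maximal_chainI:
  assumes X: "compact_space X" "Hausdorff_space X" "zero_dimensional X" and C: "C \<in> Exp (Vietoris X)"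
    and asym: "\<And>A B. clopenin X A \<Longrightarrow> clopenin X B \<Longrightarrow> A \<inter> B = {} \<Longrightarrow> before C A B \<Longrightarrow> \<not> before C B A"
    and total: "\<And>A B. clopenin X A \<Longrightarrow> clopenin X B \<Longrightarrow> A \<inter> B = {} \<Longrightarrow> A \<noteq> {} \<Longrightarrow> before C A B \<or> before C B A"
  shows "C \<in> maximal_chains X"
proof -
  have CX: "C \<subseteq> Exp X" using Exp_subset[OF C] by simp
  have clC: "closedin (Vietoris X) C" using C by (simp add: Exp_def)
  have chain: "is_chain C"
    unfolding is_chain_def
  proof (intro ballI, rule ccontr)
    fix E F assume EF: "E \<in> C" "F \<in> C" "\<not> (E \<subseteq> F \<or> F \<subseteq> E)"
    then obtain x y where xy: "x \<in> E" "x \<notin> F" "y \<in> F" "y \<notin> E" by blast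
    have cl: "closedin X E" "closedin X F" using EF CX by (auto simp: Exp_def)
    then have "E \<subseteq> topspace X" "F \<subseteq> topspace X" by (auto dest: closedin_subset)
    note cl = cl this
    obtain A where A: "clopenin X A" "x \<in> A" "A \<inter> F = {}"
      using clopen_separation[OF X(3) cl(2), of x] xy cl by blast
    obtain B where B: "clopenin X B" "y \<in> B" "B \<inter> E = {}"
      using clopen_separation[OF X(3) cl(1), of y] xy cl by blast
    have "clopenin X (A - B)" using A B by (auto simp: clopenin_def)
    moreover have "before C (A - B) B" using EF xy A B unfolding before_def by blast
    moreover have "before C B (A - B)" using EF xy A B unfolding before_def by blast
    ultimately show False using asym[of "A - B" B] B by blast
  qed
  have cmp: "compact_space (Vietoris X)" using X by (simp add: compact_space_Vietoris)
  have "F \<in> C" if D: "D \<subseteq> Exp X" "is_chain D" "C \<subseteq> D" and F: "F \<in> D" for D F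
  proof (rule ccontr)
    assume nF: "F \<notin> C"
    have FE: "F \<in> Exp X" using D F by blast
    then have FX: "F \<in> Exp X" "closedin X F" "F \<subseteq> topspace X" using Exp_subset[OF FE] by (auto simp: Exp_def)
    have comp: "E \<subseteq> F \<or> F \<subseteq> E" if "E \<in> C" for E using that D F by (auto simp: is_chain_def)
    have clF: "closedin (Vietoris X) {E \<in> Exp X. E \<subseteq> F}"
    proof -
      have "{E \<in> Exp X. E \<subseteq> F} = {E \<in> Exp X. E \<inter> (topspace X - F) = {}}" using Exp_subset by blast
      then show ?thesis using closedin_Vietoris_miss[of X "topspace X - F"] FX by auto
    qed
    \<comment> \<open>Otherwise finitely many clopen sets meeting \<open>F\<close> are all met by
      one member below \<open>F\<close>, the largest of finitely many. Compactness then gives a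
      member below \<open>F\<close> that meets every such set, and this can only be
      \<open>F\<close>.\<close>
    have "\<exists>A. clopenin X A \<and> A \<inter> F \<noteq> {} \<and> (\<forall>E\<in>C. E \<subseteq> F \<longrightarrow> E \<inter> A = {})"
    proof (rule ccontr)
      assume neg: "\<not> ?thesis"
      define I where "I = {A. clopenin X A \<and> A \<inter> F \<noteq> {}}"
      define K where "K A = C \<inter> {E \<in> Exp X. E \<subseteq> F} \<inter> {E \<in> Exp X. E \<inter> A \<noteq> {}}" for A
      have KI: "\<exists>E\<in>C. E \<subseteq> F \<and> E \<inter> A \<noteq> {}" if "A \<in> I" for A using neg that by (auto simp: I_def)
      have clK: "closedin (Vietoris X) (K A)" if "A \<in> I" for A
        unfolding K_def using clC clF closedin_Vietoris_hit[of X A] that by (intro closedin_Int) (auto simp: I_def clopenin_def)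
      have fip: "\<exists>E\<in>topspace (Vietoris X). \<forall>A\<in>J. E \<in> K A" if J: "finite J" "J \<subseteq> I" for J
      proof (cases "J = {}")
        case True
        then show ?thesis using FX by auto
      next
        case False
        obtain e where e: "\<And>A. A \<in> J \<Longrightarrow> e A \<in> C \<and> e A \<subseteq> F \<and> e A \<inter> A \<noteq> {}" using KI J by (metis subsetD)
        then have "is_chain (e ` J)" using is_chain_subset[OF chain, of "e ` J"] by blast
        moreover have "finite (e ` J)" "e ` J \<noteq> {}" using J False by auto
        ultimately obtain M where M: "M \<in> e ` J" "\<forall>F\<in>e ` J. F \<subseteq> M"
          using finite_chain_greatest[of "e ` J"] by auto
        have "M \<in> K A" if "A \<in> J" for A
        proof -
          have "M \<in> C" "M \<subseteq> F" using M e by auto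
          moreover have "M \<inter> A \<noteq> {}" using M e[OF that] that by blast
          ultimately show ?thesis using CX by (auto simp: K_def)
        qed
        moreover have "M \<in> topspace (Vietoris X)" using M e CX by auto
        ultimately show ?thesis by blast
      qed
      have "\<exists>E\<in>topspace (Vietoris X). \<forall>A\<in>I. E \<in> K A"
        by (rule compact_space_index_fip) (fact cmp clK fip)+
      then obtain E where E: "E \<in> topspace (Vietoris X)" "\<And>A. A \<in> I \<Longrightarrow> E \<in> K A" by blast
      obtain z where z: "z \<in> F" using FX by (auto simp: Exp_def)
      have "topspace X \<in> I" using z FX by (auto simp: I_def clopenin_def)
      from E(2)[OF this] have E': "E \<in> C" "E \<subseteq> F" "closedin X E" by (auto simp: K_def Exp_def)
      have "F \<subseteq> E"
      proof
        fix x assume x: "x \<in> F"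
        show "x \<in> E"
        proof (rule ccontr)
          assume "x \<notin> E"
          then obtain A where A: "clopenin X A" "x \<in> A" "A \<inter> E = {}"
            using clopen_separation[OF X(3) E'(3), of x] x FX by blast
          then have "A \<in> I" using x by (auto simp: I_def)
          then show False using E(2) A by (auto simp: K_def)
        qed
      qed
      then show False using E' nF by auto
    qed
    then obtain A where A: "clopenin X A" "A \<inter> F \<noteq> {}" "\<And>E. E \<in> C \<Longrightarrow> E \<subseteq> F \<Longrightarrow> E \<inter> A = {}" by blast
    \<comment> \<open>Dually, a finite union of clopen sets missing \<open>F\<close> still misses
      \<open>F\<close>. If no \<open>B\<close> worked, compactness would give a member above
      \<open>F\<close> that misses every clopen set missing \<open>F\<close>, again \<open>F\<close>
      itself.\<close>
    have "\<exists>B. clopenin X B \<and> B \<inter> F = {} \<and> (\<forall>E\<in>C. F \<subseteq> E \<longrightarrow> E \<inter> B \<noteq> {})" if "F \<noteq> topspace X"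
    proof (rule ccontr)
      assume neg: "\<not> ?thesis"
      define I where "I = {B. clopenin X B \<and> B \<inter> F = {}}"
      define S where "S = (\<Inter>x\<in>F. {E \<in> Exp X. E \<inter> {x} \<noteq> {}})"
      define K where "K B = C \<inter> S \<inter> {E \<in> Exp X. E \<inter> B = {}}" for B
      have clS: "closedin (Vietoris X) S"
        unfolding S_def
      proof (rule closedin_INT)
        show "F \<noteq> {}" using FX by (auto simp: Exp_def)
        fix x assume "x \<in> F"
        then have "closedin X {x}" using FX X by (intro closedin_Hausdorff_singleton) auto
        then show "closedin (Vietoris X) {E \<in> Exp X. E \<inter> {x} \<noteq> {}}" by (rule closedin_Vietoris_hit)
      qed
      have Siff: "E \<in> S \<longleftrightarrow> F \<subseteq> E" if "E \<in> C" for E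
        using that CX FX by (auto simp: S_def Exp_def)
      have clK: "closedin (Vietoris X) (K B)" if "B \<in> I" for B
        unfolding K_def using clC clS closedin_Vietoris_miss[of X B] that by (intro closedin_Int) (auto simp: I_def clopenin_def)
      have fip: "\<exists>E\<in>topspace (Vietoris X). \<forall>B\<in>J. E \<in> K B" if J: "finite J" "J \<subseteq> I" for J
      proof -
        have "clopenin X (\<Union>J)" using J by (auto simp: I_def clopenin_def intro!: closedin_Union)
        moreover have "\<Union>J \<inter> F = {}" using J by (auto simp: I_def)
        ultimately have "\<not> (\<forall>E\<in>C. F \<subseteq> E \<longrightarrow> E \<inter> \<Union>J \<noteq> {})"
          using neg[unfolded not_ex, rule_format, of "\<Union>J"] by simp
        then obtain E where "E \<in> C" "F \<subseteq> E" "E \<inter> \<Union>J = {}" by blast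
        then have "\<forall>B\<in>J. E \<in> K B" "E \<in> topspace (Vietoris X)" using Siff CX by (auto simp: K_def)
        then show ?thesis by blast
      qed
      have "\<exists>E\<in>topspace (Vietoris X). \<forall>B\<in>I. E \<in> K B"
        by (rule compact_space_index_fip) (fact cmp clK fip)+
      then obtain E where E: "E \<in> topspace (Vietoris X)" "\<And>B. B \<in> I \<Longrightarrow> E \<in> K B" by blast
      have "{} \<in> I" by (auto simp: I_def clopenin_def)
      from E(2)[OF this] have E': "E \<in> C" "F \<subseteq> E" "E \<subseteq> topspace X"
        using Siff CX Exp_subset[of E X] by (auto simp: K_def)
      have "E \<subseteq> F"
      proof
        fix x assume x: "x \<in> E"
        show "x \<in> F"
        proof (rule ccontr)
          assume "x \<notin> F"
          then obtain B where B: "clopenin X B" "x \<in> B" "B \<inter> F = {}"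
            using clopen_separation[OF X(3) FX(2), of x] x E' by blast
          then have "B \<in> I" by (auto simp: I_def)
          then show False using E(2) B x by (auto simp: K_def)
        qed
      qed
      then show False using E' nF by auto
    qed
    \<comment> \<open>For \<open>F = topspace X\<close> the empty set serves as
      \<open>B\<close>.\<close>
    then obtain B where B: "clopenin X B" "B \<inter> F = {}" "\<And>E. E \<in> C \<Longrightarrow> F \<subseteq> E \<Longrightarrow> F \<noteq> topspace X \<Longrightarrow> E \<inter> B \<noteq> {}"
      by (metis clopenin_def closedin_empty inf_bot_left openin_empty)
    have "clopenin X (A - B)" "(A - B) \<inter> B = {}" "A - B \<noteq> {}" using A B by (auto simp: clopenin_def)
    from total[OF this(1) B(1) this(2,3)] consider E where "E \<in> C" "E \<inter> (A - B) \<noteq> {}" "E \<inter> B = {}"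
      | E where "E \<in> C" "E \<inter> B \<noteq> {}" "E \<inter> (A - B) = {}" unfolding before_def by blast
    then show False
    proof cases
      case 1
      have "\<not> E \<subseteq> F" using A(3)[OF 1(1)] 1 by blast
      moreover from this comp[OF 1(1)] have "F \<subseteq> E" by blast
      ultimately show False using B(3)[OF 1(1)] 1 CX Exp_subset by blast
    next
      case 2
      have "\<not> E \<subseteq> F" using 2 B by blast
      then have "F \<subseteq> E" using comp 2 by blast
      then show False using 2 A B by blast
    qed
  qed
  then show ?thesis using CX chain unfolding maximal_chains_def by blast
qed

text \<open>The relation says that \<open>C\<close> hits a clopen subset of the hyperspace, namely
  the sets meeting \<open>A\<close> and missing \<open>B\<close>.\<close>

lemma clopen_before:
  assumes "clopenin X A" "clopenin X B"
  shows "openin (Vietoris (Vietoris X)) {C \<in> Exp (Vietoris X). before C A B}"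
    and "closedin (Vietoris (Vietoris X)) {C \<in> Exp (Vietoris X). before C A B}"
proof -
  let ?S = "{F \<in> Exp X. F \<inter> A \<noteq> {}} \<inter> {F \<in> Exp X. F \<inter> B = {}}"
  have eq: "{C \<in> Exp (Vietoris X). before C A B} = {C \<in> Exp (Vietoris X). C \<inter> ?S \<noteq> {}}"
    using Exp_subset[of _ "Vietoris X"] by (auto simp: before_def) blast+
  have "openin (Vietoris X) ?S"
    by (intro openin_Int openin_Vietoris_hit openin_Vietoris_miss) (use assms in \<open>auto simp: clopenin_def\<close>)
  then show "openin (Vietoris (Vietoris X)) {C \<in> Exp (Vietoris X). before C A B}"
    unfolding eq by (rule openin_Vietoris_hit)
  have "closedin (Vietoris X) ?S"
    by (intro closedin_Int closedin_Vietoris_hit closedin_Vietoris_miss) (use assms in \<open>auto simp: clopenin_def\<close>)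
  then show "closedin (Vietoris (Vietoris X)) {C \<in> Exp (Vietoris X). before C A B}"
    unfolding eq by (rule closedin_Vietoris_hit)
qed

lemma maximal_chains_subset:
  assumes "compact_space X" "Hausdorff_space X" "topspace X \<noteq> {}"
  shows "maximal_chains X \<subseteq> Exp (Vietoris X)"
  using maximal_chain_closed[OF assms] by blast

lemma topspace_Phi:
  assumes "compact_space X" "Hausdorff_space X" "topspace X \<noteq> {}"
  shows "topspace (Phi X) = maximal_chains X"
  using maximal_chains_subset[OF assms] by (auto simp: Phi_def)

lemma closedin_maximal_chains:
  assumes X: "compact_space X" "Hausdorff_space X" "zero_dimensional X" "topspace X \<noteq> {}"
  shows "closedin (Vietoris (Vietoris X)) (maximal_chains X)"
proof -
  let ?V = "Vietoris (Vietoris X)"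
  define P where "P = {(A, B). clopenin X A \<and> clopenin X B \<and> A \<inter> B = {} \<and> A \<noteq> {}}"
  define b where "b A B = {C \<in> Exp (Vietoris X). before C A B}" for A B
  have b: "openin ?V (b A B)" "closedin ?V (b A B)" if "clopenin X A" "clopenin X B" for A B
    using clopen_before[OF that] by (auto simp: b_def)
  have "maximal_chains X = topspace ?V \<inter> (\<Inter>(A, B)\<in>P. (topspace ?V - b A B \<inter> b B A) \<inter> (b A B \<union> b B A))" (is "_ = ?R")
  proof (intro subset_antisym subsetI)
    fix c assume c: "c \<in> maximal_chains X"
    then have "c \<in> Exp (Vietoris X)" using maximal_chains_subset X by blast
    moreover have "c \<in> (topspace ?V - b A B \<inter> b B A) \<inter> (b A B \<union> b B A)" if "(A, B) \<in> P" for A B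
      using that before_asym[OF maximal_chainsD(2)[OF c]] maximal_chain_total[OF X(1,2) c, of A B] calculation
      by (auto simp: b_def P_def clopenin_def)
    ultimately show "c \<in> ?R" by auto
  next
    fix c assume c: "c \<in> ?R"
    show "c \<in> maximal_chains X"
    proof (rule maximal_chainI[OF X(1-3)])
      show cE: "c \<in> Exp (Vietoris X)" using c by simp
      fix A B assume AB: "clopenin X A" "clopenin X B" "A \<inter> B = {}"
      {
        assume "A \<noteq> {}"
        then have "(A, B) \<in> P" using AB by (simp add: P_def)
        then show "before c A B \<or> before c B A" using c by (auto simp: b_def)
      }
      assume b: "before c A B"
      then have "A \<noteq> {}" by (auto simp: before_def)
      then have "(A, B) \<in> P" using AB by (simp add: P_def)
      then show "\<not> before c B A" using c b cE by (auto simp: b_def)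
    qed
  qed
  moreover have "closedin ?V (?R)"
  proof (cases "P = {}")
    case False
    have "closedin ?V (\<Inter>(A, B)\<in>P. (topspace ?V - b A B \<inter> b B A) \<inter> (b A B \<union> b B A))"
    proof (rule closedin_INT[OF False], clarify)
      fix A B assume "(A, B) \<in> P"
      then have AB: "clopenin X A" "clopenin X B" by (auto simp: P_def)
      then show "closedin ?V ((topspace ?V - b A B \<inter> b B A) \<inter> (b A B \<union> b B A))"
        by (intro closedin_Int closedin_diff closedin_topspace openin_Int closedin_Un b)
    qed
    then show ?thesis by blast
  next
    case True
    then show ?thesis using closedin_topspace[of ?V] by simp
  qed
  ultimately show ?thesis by simp
qed

lemma Phi_compact_Hausdorff:
  assumes X: "compact_space X" "Hausdorff_space X" "zero_dimensional X" "topspace X \<noteq> {}"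
  shows "compact_space (Phi X)" "Hausdorff_space (Phi X)"
  using closedin_maximal_chains[OF X] X
  by (auto simp: Phi_def compact_space_Vietoris Hausdorff_space_Vietoris Hausdorff_space_subtopology
      intro!: compact_space_subtopology closedin_compact_space)

lemma clopen_before_Phi:
  assumes X: "compact_space X" "Hausdorff_space X" "topspace X \<noteq> {}" and AB: "clopenin X A" "clopenin X B"
  shows "openin (Phi X) {c \<in> maximal_chains X. before c A B}"
    and "closedin (Phi X) {c \<in> maximal_chains X. before c A B}"
proof -
  have "{c \<in> maximal_chains X. before c A B} = maximal_chains X \<inter> {C \<in> Exp (Vietoris X). before C A B}"
    using maximal_chains_subset[OF X] by blast
  then show "openin (Phi X) {c \<in> maximal_chains X. before c A B}"
    "closedin (Phi X) {c \<in> maximal_chains X. before c A B}"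
    using clopen_before[OF AB] by (auto simp: Phi_def openin_subtopology_Int2 closedin_subtopology_Int_closed)
qed

text \<open>If every member of \<open>c\<close> were comparable with every member of
  \<open>c'\<close>, maximality would make the chains equal. So there are incomparable members, and
  clopen sets around a point of each difference separate the chains.\<close>

lemma maximal_chains_separated:
  assumes X: "zero_dimensional X" and c: "c \<in> maximal_chains X" "c' \<in> maximal_chains X" "c \<noteq> c'"
  obtains A B where "clopenin X A" "clopenin X B" "A \<inter> B = {}" "before c A B" "before c' B A"
proof -
  note ch = maximal_chainsD[OF c(1)] maximal_chainsD[OF c(2)]
  have "\<exists>E\<in>c. \<exists>F\<in>c'. \<not> E \<subseteq> F \<and> \<not> F \<subseteq> E"
  proof (rule ccontr)
    assume neg: "\<not> ?thesis"
    have "E \<in> c'" if "E \<in> c" for E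
      by (rule maximal_chains_absorb[OF c(2)]) (use neg that ch in auto)
    moreover have "E \<in> c" if "E \<in> c'" for E
      by (rule maximal_chains_absorb[OF c(1)]) (use neg that ch in auto)
    ultimately show False using c by blast
  qed
  then obtain E F x y where EF: "E \<in> c" "F \<in> c'" and xy: "x \<in> E" "x \<notin> F" "y \<in> F" "y \<notin> E" by blast
  have cl: "closedin X E" "closedin X F" using EF ch by (auto simp: Exp_def)
  then have "E \<subseteq> topspace X" "F \<subseteq> topspace X" by (auto dest: closedin_subset)
  note cl = cl this
  obtain A where A: "clopenin X A" "x \<in> A" "A \<inter> F = {}"
    using clopen_separation[OF X cl(2), of x] xy cl by blast
  obtain B where B: "clopenin X B" "y \<in> B" "B \<inter> E = {}"
    using clopen_separation[OF X cl(1), of y] xy cl by blast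
  show thesis
  proof (rule that)
    show "clopenin X (A - B)" using A B by (auto simp: clopenin_def)
    show "clopenin X B" by fact
    show "before c (A - B) B" "before c' B (A - B)" using EF xy A B unfolding before_def by blast+
  qed blast
qed

lemma maximal_chains_nonempty: "maximal_chains X \<noteq> {}"
proof -
  let ?A = "{D. D \<subseteq> Exp X \<and> is_chain D}"
  have "\<exists>U\<in>?A. \<forall>D\<in>\<C>. D \<subseteq> U" if "subset.chain ?A \<C>" for \<C>
  proof (intro bexI ballI)
    show "\<Union>\<C> \<in> ?A"
    proof (intro CollectI conjI)
      show "\<Union>\<C> \<subseteq> Exp X" using that by (auto simp: subset.chain_def)
      show "is_chain (\<Union>\<C>)"
        unfolding is_chain_def
      proof (intro ballI)
        fix E F assume "E \<in> \<Union>\<C>" "F \<in> \<Union>\<C>"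
        then obtain D D' where D: "D \<in> \<C>" "D' \<in> \<C>" "E \<in> D" "F \<in> D'" by blast
        then have "D \<subset> D' \<or> D = D' \<or> D' \<subset> D" using that unfolding subset.chain_def by simp blast
        then have "D \<subseteq> D' \<or> D' \<subseteq> D" by (elim disjE) (simp_all add: less_le)
        then obtain D'' where "D'' \<in> \<C>" "E \<in> D''" "F \<in> D''" using D by blast
        moreover from this have "is_chain D''" using that by (auto simp: subset.chain_def)
        ultimately show "E \<subseteq> F \<or> F \<subseteq> E" by (auto simp: is_chain_def)
      qed
    qed
    show "D \<subseteq> \<Union>\<C>" if "D \<in> \<C>" for D using that by blast
  qed
  from subset_Zorn[OF this] obtain M where "M \<in> ?A" "\<forall>D\<in>?A. M \<subseteq> D \<longrightarrow> D = M" by (rule bexE)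
  then have "M \<in> maximal_chains X" by (auto simp: maximal_chains_def)
  then show ?thesis by blast
qed

section \<open>Labelled clopen partitions\<close>

lemma Homeo_homeomorphic: "g \<in> Homeo X \<Longrightarrow> homeomorphic_map X X g"
  by (simp add: Homeo_def)

lemma Homeo_continuous: "g \<in> Homeo X \<Longrightarrow> continuous_map X X g"
  using Homeo_homeomorphic homeomorphic_imp_continuous_map by blast

lemma Homeo_image: "g \<in> Homeo X \<Longrightarrow> g ` topspace X = topspace X"
  using Homeo_homeomorphic homeomorphic_imp_surjective_map by blast

lemma Homeo_in_topspace:
  assumes "g \<in> Homeo X"
  shows "g x \<in> topspace X \<longleftrightarrow> x \<in> topspace X"
  using Homeo_image[OF assms] assms by (cases "x \<in> topspace X") (auto simp: Homeo_def)

text \<open>The normalisation outside the carrier makes \<open>g\<close> a bijection of the whole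
  type, so that \<open>inv g\<close> is the inverse in the group.\<close>

lemma Homeo_bij:
  assumes "g \<in> Homeo X"
  shows "bij g"
proof -
  have inj: "inj_on g (topspace X)" using Homeo_homeomorphic[OF assms] homeomorphic_imp_injective_map by blast
  have out: "g x = x" if "x \<notin> topspace X" for x using assms that by (simp add: Homeo_def)
  have "inj g"
  proof (rule injI)
    fix x y assume eq: "g x = g y"
    then have "x \<in> topspace X \<longleftrightarrow> y \<in> topspace X" using Homeo_in_topspace[OF assms] by metis
    then show "x = y" using eq inj out by (cases "x \<in> topspace X") (auto dest: inj_onD)
  qed
  moreover have "y \<in> range g" for y
  proof (cases "y \<in> topspace X")
    case True
    then show ?thesis using Homeo_image[OF assms] by blast
  next
    case False
    then show ?thesis using out[of y] by (metis rangeI)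
  qed
  ultimately show ?thesis by (auto simp: bij_def)
qed

lemma Homeo_id: "id \<in> Homeo X"
  by (simp add: Homeo_def)

lemma Homeo_comp: "g \<in> Homeo X \<Longrightarrow> h \<in> Homeo X \<Longrightarrow> g \<circ> h \<in> Homeo X"
  unfolding Homeo_def using homeomorphic_map_compose[of X X h X g] by auto

lemma Homeo_inv:
  assumes "g \<in> Homeo X"
  shows "inv g \<in> Homeo X"
proof -
  obtain h where h: "homeomorphic_maps X X g h" using Homeo_homeomorphic[OF assms] by (auto simp: homeomorphic_map_maps)
  have "homeomorphic_map X X h" using h homeomorphic_maps_map by blast
  moreover have "h x = inv g x" if "x \<in> topspace X" for x
  proof -
    have "g (h x) = x" using h that by (simp add: homeomorphic_maps_def)
    then show ?thesis using Homeo_bij[OF assms] by (metis bij_inv_eq_iff)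
  qed
  ultimately have "homeomorphic_map X X (inv g)" by (rule homeomorphic_map_eq)
  moreover have "inv g x = x" if "x \<notin> topspace X" for x
  proof -
    have "g x = x" using assms that by (simp add: Homeo_def)
    then show ?thesis using Homeo_bij[OF assms] by (metis bij_inv_eq_iff)
  qed
  ultimately show ?thesis by (simp add: Homeo_def)
qed

lemma Homeo_inv_comp:
  assumes "g \<in> Homeo X"
  shows "g \<circ> inv g = id" "inv g \<circ> g = id"
  using Homeo_bij[OF assms] by (auto simp: bij_def surj_iff inj_iff)

lemma Homeo_Exp:
  assumes "g \<in> Homeo X" "F \<in> Exp X"
  shows "g ` F \<in> Exp X"
  using assms homeomorphic_imp_closed_map[OF Homeo_homeomorphic[OF assms(1)]] by (auto simp: Exp_def closed_map_def)

lemma is_chain_Phi_action: "is_chain c \<Longrightarrow> is_chain (Phi_action g c)"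
  unfolding is_chain_def Phi_action_def ball_simps by (meson image_mono)

lemma Phi_action_comp: "Phi_action (g \<circ> h) c = Phi_action g (Phi_action h c)"
  by (simp add: Phi_action_def image_image image_comp)

lemma Phi_action_id: "Phi_action id c = c"
  by (simp add: Phi_action_def)

lemma Phi_action_maximal:
  assumes g: "g \<in> Homeo X" and c: "c \<in> maximal_chains X"
  shows "Phi_action g c \<in> maximal_chains X"
proof -
  note ch = maximal_chainsD[OF c]
  have sub: "Phi_action h d \<subseteq> Exp X" if "d \<subseteq> Exp X" "h \<in> Homeo X" for h d
    using that Homeo_Exp by (auto simp: Phi_action_def)
  have "D = Phi_action g c" if D: "D \<subseteq> Exp X" "is_chain D" "Phi_action g c \<subseteq> D" for D
  proof -
    have "Phi_action (inv g) (Phi_action g c) \<subseteq> Phi_action (inv g) D"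
      using D(3) unfolding Phi_action_def by (rule image_mono)
    then have "c \<subseteq> Phi_action (inv g) D"
      using Homeo_inv_comp[OF g] by (metis Phi_action_comp Phi_action_id)
    then have "Phi_action (inv g) D = c"
      using c sub[OF D(1) Homeo_inv[OF g]] is_chain_Phi_action[OF D(2), of "inv g"] unfolding maximal_chains_def by simp
    then show ?thesis using Homeo_inv_comp[OF g] by (metis Phi_action_comp Phi_action_id)
  qed
  then show ?thesis using sub[OF ch(1) g] is_chain_Phi_action[OF ch(2), of g] unfolding maximal_chains_def by simp
qed

lemma before_Phi_action: "before (Phi_action g c) A B \<longleftrightarrow> before c (g -` A) (g -` B)"
proof -
  have "g ` F \<inter> S = {} \<longleftrightarrow> F \<inter> g -` S = {}" for F S by blast
  then show ?thesis unfolding before_def Phi_action_def by simp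
qed

lemma continuous_Phi_action:
  assumes X: "compact_space X" "Hausdorff_space X" "topspace X \<noteq> {}"
  shows "continuous_map (prod_topology (compact_open X (Homeo X)) (Phi X)) (Phi X) (\<lambda>(g, c). Phi_action g c)"
proof -
  let ?T = "compact_open X (Homeo X)"
  have "continuous_map (prod_topology ?T X) X (\<lambda>(g, x). g x)"
    by (rule continuous_map_compact_open_eval[OF X(1,2) Homeo_continuous])
  then have "continuous_map (prod_topology ?T (Vietoris X)) (Vietoris X) (\<lambda>(g, F). g ` F)"
    by (rule continuous_map_Vietoris_action[OF X(1,2)])
  then have "continuous_map (prod_topology ?T (Vietoris (Vietoris X))) (Vietoris (Vietoris X)) (\<lambda>(g, C). Phi_action g C)"
    unfolding Phi_action_def
    by (rule continuous_map_Vietoris_action[OF compact_space_Vietoris[OF X(1)] Hausdorff_space_Vietoris[OF X(1,2)]])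
  then have "continuous_map (subtopology (prod_topology ?T (Vietoris (Vietoris X))) (UNIV \<times> maximal_chains X))
      (Vietoris (Vietoris X)) (\<lambda>(g, C). Phi_action g C)"
    by (rule continuous_map_from_subtopology)
  moreover have "subtopology (prod_topology ?T (Vietoris (Vietoris X))) (UNIV \<times> maximal_chains X) = prod_topology ?T (Phi X)"
    unfolding Phi_def by (simp add: subtopology_Times)
  ultimately have cont: "continuous_map (prod_topology ?T (Phi X)) (Vietoris (Vietoris X)) (\<lambda>(g, C). Phi_action g C)"
    by simp
  have "(\<lambda>(g, C). Phi_action g C) \<in> topspace (prod_topology ?T (Phi X)) \<rightarrow> maximal_chains X"
    using Phi_action_maximal topspace_Phi[OF X] by auto
  with cont show ?thesis unfolding Phi_def by (simp add: continuous_map_in_subtopology image_subset_iff_funcset)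
qed

lemma Phi_G_space:
  assumes X: "compact_space X" "Hausdorff_space X" "zero_dimensional X" "topspace X \<noteq> {}"
  shows "G_space (Homeo X) (compact_open X (Homeo X)) (Phi X) Phi_action"
  unfolding G_space_def
  using Phi_compact_Hausdorff[OF X] continuous_Phi_action[OF X(1,2,4)]
  by (simp add: Phi_action_comp Phi_action_id)

section \<open>Labellings, their refinements and transitivity\<close>

definition fib :: "'a topology \<Rightarrow> ('a \<Rightarrow> nat) \<Rightarrow> nat \<Rightarrow> 'a set" where
  "fib X q i = {x \<in> topspace X. q x = i}"

text \<open>A partition is encoded by its labelling function, with the fibres as cells and no cell
  empty. Coarsening is then composition with a map of labels, and pullback is composition with a
  homeomorphism.\<close>

definition labelling :: "'a topology \<Rightarrow> nat \<Rightarrow> ('a \<Rightarrow> nat) \<Rightarrow> bool" where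
  "labelling X m q \<longleftrightarrow> q ` topspace X = {..<m} \<and> (\<forall>i. clopenin X (fib X q i))"

text \<open>Quantifying over points instead of labels keeps the number of cells out of the
  definition.\<close>

definition ordered :: "'a topology \<Rightarrow> 'a set set \<Rightarrow> ('a \<Rightarrow> nat) \<Rightarrow> bool" where
  "ordered X c q \<longleftrightarrow> (\<forall>x\<in>topspace X. \<forall>y\<in>topspace X. q x < q y \<longrightarrow> before c (fib X q (q x)) (fib X q (q y)))"

lemma clopenin_vimage:
  assumes "continuous_map X X g" "clopenin X A"
  shows "clopenin X {x \<in> topspace X. g x \<in> A}"
  using assms openin_continuous_map_preimage closedin_continuous_map_preimage
  unfolding clopenin_def by blast

lemma clopenin_Union: "finite I \<Longrightarrow> (\<And>i. i \<in> I \<Longrightarrow> clopenin X (S i)) \<Longrightarrow> clopenin X (\<Union>i\<in>I. S i)"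
  unfolding clopenin_def by (auto intro!: closedin_Union)

lemma clopenin_Int: "clopenin X A \<Longrightarrow> clopenin X B \<Longrightarrow> clopenin X (A \<inter> B)"
  by (auto simp: clopenin_def)

lemma labelling_range: "labelling X m q \<Longrightarrow> x \<in> topspace X \<Longrightarrow> q x < m"
  by (auto simp: labelling_def)

lemma labelling_onto:
  assumes "labelling X m q" "i < m"
  obtains x where "x \<in> topspace X" "q x = i"
  using assms unfolding labelling_def by (metis imageE lessThan_iff)

lemma fib_nonempty: "labelling X m q \<Longrightarrow> i < m \<Longrightarrow> fib X q i \<noteq> {}"
  unfolding fib_def by (erule labelling_onto) auto

lemma clopenin_labelling_Collect:
  assumes "labelling X m q"
  shows "clopenin X {x \<in> topspace X. P (q x)}"
proof -
  have "{x \<in> topspace X. P (q x)} = (\<Union>i\<in>{i. i < m \<and> P i}. fib X q i)"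
    using labelling_range[OF assms] by (auto simp: fib_def)
  moreover have "clopenin X (\<Union>i\<in>{i. i < m \<and> P i}. fib X q i)"
    by (rule clopenin_Union) (use assms in \<open>auto simp: labelling_def\<close>)
  ultimately show ?thesis by simp
qed

lemma labelling_map:
  assumes "labelling X m q" "s ` {..<m} = {..<k}"
  shows "labelling X k (\<lambda>x. s (q x))"
  unfolding labelling_def
proof (intro conjI allI)
  show "(\<lambda>x. s (q x)) ` topspace X = {..<k}"
    using assms by (metis image_image labelling_def)
  show "clopenin X (fib X (\<lambda>x. s (q x)) i)" for i
    unfolding fib_def using clopenin_labelling_Collect[OF assms(1), of "\<lambda>j. s j = i"] .
qed

lemma labelling_comp_Homeo:
  assumes "labelling X m q" "g \<in> Homeo X"
  shows "labelling X m (\<lambda>x. q (g x))"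
  unfolding labelling_def
proof (intro conjI allI)
  show "(\<lambda>x. q (g x)) ` topspace X = {..<m}"
    using assms Homeo_image[OF assms(2)] by (metis image_image labelling_def)
  fix i
  have "fib X (\<lambda>x. q (g x)) i = {x \<in> topspace X. g x \<in> fib X q i}"
    using Homeo_in_topspace[OF assms(2)] by (auto simp: fib_def)
  then show "clopenin X (fib X (\<lambda>x. q (g x)) i)"
    using clopenin_vimage[OF Homeo_continuous[OF assms(2)]] assms(1) by (simp add: labelling_def)
qed

lemma labelling_from_finite_map:
  fixes f :: "'a \<Rightarrow> 'b"
  assumes "finite (f ` topspace X)" "\<And>y. clopenin X {x \<in> topspace X. f x = y}"
  obtains m q s where "labelling X m q" "\<And>x. x \<in> topspace X \<Longrightarrow> f x = s (q x)"
proof -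
  obtain e where e: "bij_betw e (f ` topspace X) {0..<card (f ` topspace X)}"
    using ex_bij_betw_finite_nat[OF assms(1)] by blast
  define q where "q x = e (f x)" for x
  define s where "s = inv_into (f ` topspace X) e"
  have s: "f x = s (q x)" if "x \<in> topspace X" for x
    using e that by (simp add: s_def q_def bij_betw_def inv_into_f_f)
  have "labelling X (card (f ` topspace X)) q"
    unfolding labelling_def
  proof (intro conjI allI)
    show "q ` topspace X = {..<card (f ` topspace X)}"
      using e by (auto simp: q_def bij_betw_def image_image lessThan_atLeast0)
    fix i
    have "fib X q i = (\<Union>y\<in>{y \<in> f ` topspace X. e y = i}. {x \<in> topspace X. f x = y})"
      by (auto simp: fib_def q_def)
    moreover have "clopenin X (\<Union>y\<in>{y \<in> f ` topspace X. e y = i}. {x \<in> topspace X. f x = y})"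
      by (rule clopenin_Union) (use assms in auto)
    ultimately show "clopenin X (fib X q i)" by simp
  qed
  then show thesis using s that by blast
qed

lemma common_refinement:
  assumes "labelling X m q" "labelling X m' q'"
  obtains n r s s' where "labelling X n r" "\<And>x. x \<in> topspace X \<Longrightarrow> q x = s (r x)" "\<And>x. x \<in> topspace X \<Longrightarrow> q' x = s' (r x)"
proof -
  let ?f = "\<lambda>x. (q x, q' x)"
  have "?f ` topspace X \<subseteq> {..<m} \<times> {..<m'}" using labelling_range[OF assms(1)] labelling_range[OF assms(2)] by auto
  then have fin: "finite (?f ` topspace X)" by (rule finite_subset) simp
  have "clopenin X {x \<in> topspace X. ?f x = y}" for y
  proof -
    have "{x \<in> topspace X. ?f x = y} = fib X q (fst y) \<inter> fib X q' (snd y)" by (auto simp: fib_def)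
    then show ?thesis using assms clopenin_Int[of X] by (auto simp: labelling_def)
  qed
  from labelling_from_finite_map[OF fin this] obtain n r s where r: "labelling X n r"
    and s: "\<And>x. x \<in> topspace X \<Longrightarrow> ?f x = s (r x)" by metis
  show thesis
  proof (rule that[OF r])
    show "q x = (fst \<circ> s) (r x)" if "x \<in> topspace X" for x using s[OF that] by (metis comp_apply fst_conv)
    show "q' x = (snd \<circ> s) (r x)" if "x \<in> topspace X" for x using s[OF that] by (metis comp_apply snd_conv)
  qed
qed

lemma labelling_trivial: "topspace X \<noteq> {} \<Longrightarrow> labelling X 1 (\<lambda>_. 0)"
  by (auto simp: labelling_def fib_def clopenin_def image_constant_conv Collect_conj_eq)

lemma finite_common_refinement:
  assumes "topspace X \<noteq> {}" "finite J" "\<And>q. q \<in> J \<Longrightarrow> \<exists>m. labelling X m q"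
  shows "\<exists>n r. labelling X n r \<and> (\<forall>q\<in>J. \<exists>s. \<forall>x\<in>topspace X. q x = s (r x))"
  using assms(2,3)
proof (induction J rule: finite_induct)
  case empty
  then show ?case using labelling_trivial[OF assms(1)] by blast
next
  case (insert q J)
  then obtain n r where r: "labelling X n r" "\<forall>q\<in>J. \<exists>s. \<forall>x\<in>topspace X. q x = s (r x)" by auto
  obtain m where m: "labelling X m q" using insert.prems by blast
  obtain n' r' s s' where r': "labelling X n' r'" "\<And>x. x \<in> topspace X \<Longrightarrow> r x = s (r' x)" "\<And>x. x \<in> topspace X \<Longrightarrow> q x = s' (r' x)"
    using common_refinement[OF r(1) m] by metis
  have "\<exists>s. \<forall>x\<in>topspace X. p x = s (r' x)" if p: "p \<in> insert q J" for p
  proof (cases "p = q")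
    case True
    then show ?thesis using r' by blast
  next
    case False
    then obtain t where "\<forall>x\<in>topspace X. p x = t (r x)" using p r by blast
    then have "\<forall>x\<in>topspace X. p x = (t \<circ> s) (r' x)" using r' by simp
    then show ?thesis by blast
  qed
  then show ?case using r' by blast
qed

text \<open>By h-homogeneity every cell is homeomorphic to \<open>X\<close>, so cells with equal
  labels are homeomorphic to each other; these homeomorphisms are glued along the partition.\<close>

lemma labelling_transitive:
  assumes X: "h_homogeneous X" and q: "labelling X m q" "labelling X m q'"
  obtains g where "g \<in> Homeo X" "\<And>x. x \<in> topspace X \<Longrightarrow> q' (g x) = q x"
proof -
  have cH: "compact_space X" "Hausdorff_space X" using X by (auto simp: h_homogeneous_def)
  have "\<exists>h. homeomorphic_map (subtopology X (fib X q i)) (subtopology X (fib X q' i)) h" if "i < m" for i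
  proof -
    note ne = fib_nonempty[OF q(1) that] fib_nonempty[OF q(2) that]
    have "subtopology X (fib X q i) homeomorphic_space X" "subtopology X (fib X q' i) homeomorphic_space X"
      using X q ne by (auto simp: h_homogeneous_def labelling_def clopenin_def)
    then have "subtopology X (fib X q i) homeomorphic_space subtopology X (fib X q' i)"
      using homeomorphic_space_sym homeomorphic_space_trans by blast
    then show ?thesis by (simp add: homeomorphic_space)
  qed
  then obtain h where h: "\<And>i. i < m \<Longrightarrow> homeomorphic_map (subtopology X (fib X q i)) (subtopology X (fib X q' i)) (h i)"
    by metis
  define g where "g x = (if x \<in> topspace X then h (q x) x else x)" for x
  have fX: "topspace (subtopology X (fib X q i)) = fib X q i" "topspace (subtopology X (fib X q' i)) = fib X q' i" for i
    by (auto simp: fib_def)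
  have him: "h i ` fib X q i = fib X q' i" "inj_on (h i) (fib X q i)" if "i < m" for i
    using h[OF that] homeomorphic_imp_surjective_map homeomorphic_imp_injective_map fX by metis+
  have gq: "q' (g x) = q x" "g x \<in> topspace X" if "x \<in> topspace X" for x
  proof -
    have "h (q x) x \<in> fib X q' (q x)"
      using him(1)[OF labelling_range[OF q(1) that]] that by (auto simp: fib_def)
    then show "q' (g x) = q x" "g x \<in> topspace X" using that by (auto simp: g_def fib_def)
  qed
  have "continuous_map X X g"
  proof (rule pasting_lemma[where I = "{..<m}" and T = "fib X q" and f = h])
    show "openin X (fib X q i)" for i using q by (auto simp: labelling_def clopenin_def)
    show "continuous_map (subtopology X (fib X q i)) X (h i)" if "i \<in> {..<m}" for i
      using h[of i] that homeomorphic_imp_continuous_map continuous_map_into_fulltopology by (metis lessThan_iff)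
    show "\<exists>j. j \<in> {..<m} \<and> x \<in> fib X q j \<and> g x = h j x" if "x \<in> topspace X" for x
      using that labelling_range[OF q(1) that] by (auto simp: g_def fib_def)
  qed (auto simp: fib_def)
  moreover have "g ` topspace X = topspace X"
  proof
    show "g ` topspace X \<subseteq> topspace X" using gq by blast
    show "topspace X \<subseteq> g ` topspace X"
    proof
      fix y assume y: "y \<in> topspace X"
      have "y \<in> fib X q' (q' y)" "q' y < m" using y labelling_range[OF q(2)] by (auto simp: fib_def)
      then have "y \<in> h (q' y) ` fib X q (q' y)" using him(1) by simp
      then obtain x where x: "y = h (q' y) x" "x \<in> fib X q (q' y)" by (rule imageE)
      have "x \<in> topspace X" "q x = q' y" using x(2) by (auto simp: fib_def)
      then have "g x = y" "x \<in> topspace X" using x(1) by (simp_all add: g_def)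
      then show "y \<in> g ` topspace X" by blast
    qed
  qed
  moreover have "inj_on g (topspace X)"
  proof (rule inj_onI)
    fix x y assume xy: "x \<in> topspace X" "y \<in> topspace X" "g x = g y"
    then have eq: "q x = q y" using gq by metis
    have "h (q x) x = h (q x) y" using xy eq by (simp add: g_def)
    moreover have "x \<in> fib X q (q x)" "y \<in> fib X q (q x)" using xy eq by (auto simp: fib_def)
    ultimately show "x = y" using him(2)[OF labelling_range[OF q(1) xy(1)]] by (auto dest: inj_onD)
  qed
  ultimately have "homeomorphic_map X X g" using continuous_imp_homeomorphic_map cH by blast
  then have "g \<in> Homeo X" by (simp add: Homeo_def g_def)
  then show thesis using that gq by blast
qed

text \<open>Moves the homeomorphism from the chain to the labelling, so that questions on the orbit
  of a chain become questions on pulled-back labellings of one chain.\<close>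

lemma ordered_Phi_action:
  assumes "g \<in> Homeo X"
  shows "ordered X (Phi_action g c) q \<longleftrightarrow> ordered X c (\<lambda>x. q (g x))"
proof -
  have v: "before (Phi_action g c) (fib X q i) (fib X q j) \<longleftrightarrow> before c (fib X (\<lambda>x. q (g x)) i) (fib X (\<lambda>x. q (g x)) j)" for i j
  proof -
    have "g -` fib X q i = fib X (\<lambda>x. q (g x)) i" for i
      using Homeo_in_topspace[OF assms] by (auto simp: fib_def)
    then show ?thesis by (simp add: before_Phi_action)
  qed
  have "(\<forall>x\<in>topspace X. P x) \<longleftrightarrow> (\<forall>x\<in>topspace X. P (g x))" for P
    using Homeo_image[OF assms] by (metis (no_types, lifting) image_iff)
  note all = this
  have "(\<forall>x\<in>topspace X. \<forall>y\<in>topspace X. R x y) \<longleftrightarrow> (\<forall>x\<in>topspace X. \<forall>y\<in>topspace X. R (g x) (g y))" for R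
    unfolding all[of "\<lambda>x. \<forall>y\<in>topspace X. R x y"] all[of "R (g _)"] ..
  then show ?thesis unfolding ordered_def v .
qed

lemma ordered_cong:
  assumes "\<And>x. x \<in> topspace X \<Longrightarrow> q x = q' x"
  shows "ordered X c q \<longleftrightarrow> ordered X c q'"
proof -
  have "fib X q i = fib X q' i" for i using assms by (auto simp: fib_def)
  then show ?thesis unfolding ordered_def using assms by simp
qed

text \<open>A union of cells is reached when its cell of least label is, because a member of
  \<open>c\<close> that meets a cell meets all cells with smaller labels. Hence the order on a fine
  partition determines the order on every coarser one.\<close>

lemma before_ordered_iff:
  assumes c: "c \<in> maximal_chains X" and q: "labelling X m q" "ordered X c q" and ne: "topspace X \<noteq> {}"
  shows "before c {x \<in> topspace X. P (q x)} {x \<in> topspace X. Q (q x)} \<longleftrightarrow> (\<exists>i<m. P i \<and> (\<forall>j<m. Q j \<longrightarrow> i < j))"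
proof -
  have ch: "c \<subseteq> Exp X" "is_chain c" using maximal_chainsD[OF c] by auto
  have ord: "before c (fib X q i) (fib X q j)" if ij: "i < j" "j < m" for i j
  proof -
    obtain x y where "x \<in> topspace X" "q x = i" "y \<in> topspace X" "q y = j"
      using labelling_onto[OF q(1)] ij by (metis less_trans)
    then show ?thesis using q(2) ij unfolding ordered_def by blast
  qed
  have down: "F \<inter> fib X q i \<noteq> {}" if F: "F \<in> c" "F \<inter> fib X q j \<noteq> {}" and ij: "i < j" "j < m" for F i j
  proof -
    obtain E where E: "E \<in> c" "E \<inter> fib X q i \<noteq> {}" "E \<inter> fib X q j = {}" using ord[OF ij] unfolding before_def by blast
    then have "\<not> F \<subseteq> E" using F by blast
    then have "E \<subseteq> F" using ch(2) E F by (auto simp: is_chain_def)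
    then show ?thesis using E by blast
  qed
  show ?thesis
  proof
    assume "before c {x \<in> topspace X. P (q x)} {x \<in> topspace X. Q (q x)}"
    then obtain F x where F: "F \<in> c" "x \<in> F" "x \<in> topspace X" "P (q x)" "F \<inter> {x \<in> topspace X. Q (q x)} = {}"
      unfolding before_def by blast
    have "q x < j" if j: "j < m" "Q j" for j
    proof (rule ccontr)
      assume "\<not> q x < j"
      then consider "j = q x" | "j < q x" by linarith
      then have "F \<inter> fib X q j \<noteq> {}"
      proof cases
        case 1
        then show ?thesis using F by (auto simp: fib_def)
      next
        case 2
        have "F \<inter> fib X q (q x) \<noteq> {}" using F by (auto simp: fib_def)
        then show ?thesis using down[OF F(1) _ 2] labelling_range[OF q(1) F(3)] by blast
      qed
      then show False using F j by (auto simp: fib_def)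
    qed
    then show "\<exists>i<m. P i \<and> (\<forall>j<m. Q j \<longrightarrow> i < j)" using F labelling_range[OF q(1) F(3)] by blast
  next
    assume "\<exists>i<m. P i \<and> (\<forall>j<m. Q j \<longrightarrow> i < j)"
    then obtain i where i: "i < m" "P i" "\<And>j. j < m \<Longrightarrow> Q j \<Longrightarrow> i < j" by blast
    obtain x where x: "x \<in> topspace X" "q x = i" using labelling_onto[OF q(1) i(1)] .
    show "before c {x \<in> topspace X. P (q x)} {x \<in> topspace X. Q (q x)}"
    proof (cases "\<exists>j<m. Q j")
      case False
      then have "{x \<in> topspace X. Q (q x)} = {}" using labelling_range[OF q(1)] by blast
      then show ?thesis using topspace_in_maximal_chain[OF c ne] x i unfolding before_def by blast
    next
      case True
      define j0 where "j0 = (LEAST j. j < m \<and> Q j)"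
      have j0: "j0 < m" "Q j0" using LeastI_ex[OF True[unfolded]] by (auto simp: j0_def)
      have j0_le: "j0 \<le> j" if "j < m" "Q j" for j using that unfolding j0_def by (auto intro: Least_le)
      obtain F where F: "F \<in> c" "F \<inter> fib X q i \<noteq> {}" "F \<inter> fib X q j0 = {}"
        using ord[OF i(3)[OF j0] j0(1)] unfolding before_def by blast
      have "F \<inter> {x \<in> topspace X. Q (q x)} = {}"
      proof (rule ccontr)
        assume "F \<inter> {x \<in> topspace X. Q (q x)} \<noteq> {}"
        then obtain y where y: "y \<in> F" "y \<in> topspace X" "Q (q y)" by blast
        then have ym: "q y < m" using labelling_range[OF q(1)] by blast
        have Fy: "F \<inter> fib X q (q y) \<noteq> {}" using y by (auto simp: fib_def)
        have "j0 \<noteq> q y" using Fy F by auto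
        then have "j0 < q y" using j0_le[OF ym y(3)] by simp
        from down[OF F(1) Fy this ym] show False using F by blast
      qed
      moreover have "F \<inter> {x \<in> topspace X. P (q x)} \<noteq> {}" using F i by (auto simp: fib_def)
      ultimately show ?thesis using F unfolding before_def by blast
    qed
  qed
qed

section \<open>Minimality of the space of maximal chains\<close>

text \<open>The relation \<open>before\<close> is a strict total order on the cells;
  \<open>\<tau>\<close> is the rank in it, the number of predecessors, and \<open>\<sigma>\<close>
  extends the rank by the identity as \<open>permutes\<close> requires.\<close>

lemma ordering_labels:
  assumes X: "compact_space X" "Hausdorff_space X" and c: "c \<in> maximal_chains X" and q: "labelling X m q"
  obtains \<sigma> where "\<sigma> permutes {..<m}" "ordered X c (\<lambda>x. \<sigma> (q x))"
proof -
  note ch = maximal_chainsD(2)[OF c]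
  let ?b = "\<lambda>i j. before c (fib X q i) (fib X q j)"
  have tot: "?b i j \<or> ?b j i" if "i < m" "j < m" "i \<noteq> j" for i j
  proof (rule maximal_chain_total[OF X c])
    show "closedin X (fib X q i)" "openin X (fib X q i)" "openin X (fib X q j)"
      using q by (auto simp: labelling_def clopenin_def)
    show "fib X q i \<noteq> {}" using fib_nonempty[OF q that(1)] .
    show "fib X q i \<inter> fib X q j = {}" using that by (auto simp: fib_def)
  qed
  have irr: "\<not> ?b i i" for i by (auto simp: before_def)
  define \<tau> where "\<tau> i = card {j. j < m \<and> ?b j i}" for i
  have mono: "\<tau> i < \<tau> j" if "i < m" "j < m" "?b i j" for i j
    unfolding \<tau>_def
  proof (rule psubset_card_mono)
    show "{l. l < m \<and> ?b l i} \<subset> {l. l < m \<and> ?b l j}"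
      using that irr before_trans[OF ch] by blast
  qed simp
  have lt: "\<tau> i < m" if "i < m" for i
  proof -
    have "{j. j < m \<and> ?b j i} \<subset> {..<m}" using that irr by auto
    then show ?thesis unfolding \<tau>_def using psubset_card_mono[of "{..<m}"] by simp
  qed
  have inj: "inj_on \<tau> {..<m}"
    by (rule inj_onI) (metis lessThan_iff less_irrefl mono tot)
  have "\<tau> ` {..<m} = {..<m}" by (rule endo_inj_surj) (use lt inj in auto)
  then have bij: "bij_betw \<tau> {..<m} {..<m}" using inj by (simp add: bij_betw_def)
  define \<sigma> where "\<sigma> i = (if i < m then \<tau> i else i)" for i
  have perm: "\<sigma> permutes {..<m}"
  proof (rule bij_imp_permutes)
    have "bij_betw \<sigma> {..<m} {..<m} \<longleftrightarrow> bij_betw \<tau> {..<m} {..<m}" by (rule bij_betw_cong) (simp add: \<sigma>_def)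
    then show "bij_betw \<sigma> {..<m} {..<m}" using bij by simp
  qed (simp add: \<sigma>_def)
  have "ordered X c (\<lambda>x. \<sigma> (q x))"
    unfolding ordered_def
  proof (intro ballI impI)
    fix x y assume xy: "x \<in> topspace X" "y \<in> topspace X" "\<sigma> (q x) < \<sigma> (q y)"
    have m: "q x < m" "q y < m" using labelling_range[OF q] xy by auto
    have "\<tau> (q x) < \<tau> (q y)" using xy m by (simp add: \<sigma>_def)
    then have "\<not> ?b (q y) (q x)" "q x \<noteq> q y" using mono[OF m(2,1)] by auto
    then have b: "?b (q x) (q y)" using tot[OF m] by blast
    have "fib X (\<lambda>x. \<sigma> (q x)) (\<sigma> (q z)) = fib X q (q z)" for z
      unfolding fib_def by (simp add: inj_eq[OF permutes_inj[OF perm]])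
    then show "before c (fib X (\<lambda>x. \<sigma> (q x)) (\<sigma> (q x))) (fib X (\<lambda>x. \<sigma> (q x)) (\<sigma> (q y)))"
      using b xy by simp
  qed
  with perm show thesis by (rule that)
qed

lemma labelling_permute: "labelling X m q \<Longrightarrow> \<sigma> permutes {..<m} \<Longrightarrow> labelling X m (\<lambda>x. \<sigma> (q x))"
  using labelling_map[of X m q \<sigma> m] permutes_image[of \<sigma> "{..<m}"] by simp

lemma openin_finite_Collect:
  assumes "finite I" "\<And>i. i \<in> I \<Longrightarrow> openin X {x \<in> topspace X. P i x}"
  shows "openin X {x \<in> topspace X. \<forall>i\<in>I. P i x}"
  using assms
proof (induction I rule: finite_induct)
  case (insert i I)
  have "{x \<in> topspace X. \<forall>i\<in>insert i I. P i x} = {x \<in> topspace X. P i x} \<inter> {x \<in> topspace X. \<forall>i\<in>I. P i x}" by auto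
  then show ?case using insert by (simp add: openin_Int)
qed simp

lemma closedin_Collect_ball:
  assumes "\<And>i. i \<in> I \<Longrightarrow> closedin X {x \<in> topspace X. P i x}"
  shows "closedin X {x \<in> topspace X. \<forall>i\<in>I. P i x}"
proof (cases "I = {}")
  case False
  have "{x \<in> topspace X. \<forall>i\<in>I. P i x} = (\<Inter>i\<in>I. {x \<in> topspace X. P i x})" using False by auto
  moreover have "closedin X (\<Inter>i\<in>I. {x \<in> topspace X. P i x})" by (rule closedin_INT[OF False]) (rule assms)
  ultimately show ?thesis by simp
qed simp

text \<open>A form with finitely many pairs of labels, which makes the condition clopen in
  \<open>c\<close>.\<close>

lemma ordered_iff:
  assumes "labelling X m q"
  shows "ordered X c q \<longleftrightarrow> (\<forall>(i, j)\<in>{(i, j). i < j \<and> j < m}. before c (fib X q i) (fib X q j))"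
proof
  assume o: "ordered X c q"
  show "\<forall>(i, j)\<in>{(i, j). i < j \<and> j < m}. before c (fib X q i) (fib X q j)"
  proof clarify
    fix i j :: nat assume ij: "i < j" "j < m"
    then have "i < m" by simp
    obtain x where x: "x \<in> topspace X" "q x = i" using labelling_onto[OF assms \<open>i < m\<close>] .
    obtain y where y: "y \<in> topspace X" "q y = j" using labelling_onto[OF assms ij(2)] .
    show "before c (fib X q i) (fib X q j)" using o x y ij unfolding ordered_def by blast
  qed
qed (use labelling_range[OF assms] in \<open>auto simp: ordered_def\<close>)

lemma clopen_ordered:
  assumes X: "compact_space X" "Hausdorff_space X" "topspace X \<noteq> {}" and q: "labelling X m q"
  shows "openin (Phi X) {c \<in> topspace (Phi X). ordered X c q}"
    and "closedin (Phi X) {c \<in> topspace (Phi X). ordered X c q}"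
proof -
  have cl: "clopenin X (fib X q i)" for i using q by (simp add: labelling_def)
  have "finite {(i, j). i < j \<and> j < m}"
    by (rule finite_subset[of _ "{..<m} \<times> {..<m}"]) auto
  then show "openin (Phi X) {c \<in> topspace (Phi X). ordered X c q}"
    unfolding ordered_iff[OF q]
    by (rule openin_finite_Collect) (use clopen_before_Phi(1)[OF X cl cl] topspace_Phi[OF X] in auto)
  show "closedin (Phi X) {c \<in> topspace (Phi X). ordered X c q}"
    unfolding ordered_iff[OF q]
    by (rule closedin_Collect_ball) (use clopen_before_Phi(2)[OF X cl cl] topspace_Phi[OF X] in auto)
qed

lemma ordered_coarsening_transfer:
  assumes ne: "topspace X \<noteq> {}" and cd: "c \<in> maximal_chains X" "d \<in> maximal_chains X"
    and r: "labelling X n r" "ordered X c r" "ordered X d r"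
    and q: "labelling X m q" "\<And>x. x \<in> topspace X \<Longrightarrow> q x = s (r x)" "ordered X c q"
  shows "ordered X d q"
proof -
  have f: "fib X q i = {x \<in> topspace X. s (r x) = i}" for i using q by (auto simp: fib_def)
  have "before c (fib X q i) (fib X q j) \<longleftrightarrow> before d (fib X q i) (fib X q j)" for i j
    unfolding f before_ordered_iff[OF cd(1) r(1,2) ne, of "\<lambda>l. s l = i" "\<lambda>l. s l = j"]
      before_ordered_iff[OF cd(2) r(1,3) ne, of "\<lambda>l. s l = i" "\<lambda>l. s l = j"] ..
  then show ?thesis using q(3) unfolding ordered_def by blast
qed

text \<open>Two distinct chains order some pair \<open>A\<close>, \<open>B\<close> differently. The
  partition by membership in \<open>A\<close> and in \<open>B\<close> can be labelled so that
  \<open>c\<close> orders it; if \<open>d\<close> orders it too, the chains agree on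
  \<open>A\<close> and \<open>B\<close>.\<close>

lemma maximal_chain_eqI:
  assumes X: "compact_space X" "Hausdorff_space X" "zero_dimensional X" "topspace X \<noteq> {}"
    and cd: "c \<in> maximal_chains X" "d \<in> maximal_chains X"
    and same: "\<And>m q. labelling X m q \<Longrightarrow> ordered X c q \<Longrightarrow> ordered X d q"
  shows "c = d"
proof (rule ccontr)
  assume "c \<noteq> d"
  then obtain A B where AB: "clopenin X A" "clopenin X B" "A \<inter> B = {}" "before c A B" "before d B A"
    using maximal_chains_separated[OF X(3) cd] by metis
  define f :: "'a \<Rightarrow> bool \<times> bool" where "f x = (x \<in> A, x \<in> B)" for x
  have "clopenin X {x \<in> topspace X. f x = y}" for y
  proof -
    have "{x \<in> topspace X. f x = (a, b)} = (if a then A \<inter> topspace X else topspace X - A) \<inter> (if b then B \<inter> topspace X else topspace X - B)" for a b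
      by (auto simp: f_def)
    then show ?thesis using AB by (cases y) (auto simp: clopenin_def)
  qed
  then obtain m q s where q: "labelling X m q" and s: "\<And>x. x \<in> topspace X \<Longrightarrow> f x = s (q x)"
    using labelling_from_finite_map[of f X] by (metis finite)
  obtain \<sigma> where \<sigma>: "\<sigma> permutes {..<m}" "ordered X c (\<lambda>x. \<sigma> (q x))"
    using ordering_labels[OF X(1,2) cd(1) q] .
  define r where "r x = \<sigma> (q x)" for x
  have r: "labelling X m r" "ordered X c r" "ordered X d r"
    unfolding r_def using labelling_permute[OF q \<sigma>(1)] \<sigma>(2) same by blast+
  define t where "t = s \<circ> inv \<sigma>"
  have t: "t (r x) = (x \<in> A, x \<in> B)" if "x \<in> topspace X" for x
    using s[OF that] \<sigma>(1) by (simp add: t_def r_def permutes_inverses f_def)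
  have "A \<subseteq> topspace X" "B \<subseteq> topspace X"
    using AB(1,2) openin_subset by (metis clopenin_def)+
  then have "A = {x \<in> topspace X. fst (t (r x))}" "B = {x \<in> topspace X. snd (t (r x))}"
    using t by auto
  then have "before c A B \<longleftrightarrow> before d A B"
    using before_ordered_iff[OF cd(1) r(1,2) X(4), of "\<lambda>i. fst (t i)" "\<lambda>i. snd (t i)"]
      before_ordered_iff[OF cd(2) r(1,3) X(4), of "\<lambda>i. fst (t i)" "\<lambda>i. snd (t i)"] by simp
  then show False using AB before_asym[OF maximal_chainsD(2)[OF cd(2)]] by blast
qed

text \<open>To show that a closed invariant nonempty \<open>A\<close> contains \<open>d\<close>,
  refine finitely many labellings ordered by \<open>d\<close>; a homeomorphism turns the order that
  some \<open>c \<in> A\<close> puts on the refinement into that of \<open>d\<close>. Compactness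
  gives a chain in \<open>A\<close> that orders every labelling ordered by \<open>d\<close>, and
  this chain is \<open>d\<close>.\<close>

lemma Phi_minimal:
  assumes hh: "h_homogeneous X" and ne: "topspace X \<noteq> {}"
  shows "minimal_G_space (Homeo X) (compact_open X (Homeo X)) (Phi X) Phi_action"
proof -
  have X: "compact_space X" "Hausdorff_space X" "zero_dimensional X" "topspace X \<noteq> {}"
    using hh ne by (auto simp: h_homogeneous_def)
  note tP = topspace_Phi[OF X(1,2,4)]
  have "A = topspace (Phi X)" if A: "closedin (Phi X) A" "\<forall>g\<in>Homeo X. Phi_action g ` A \<subseteq> A" "A \<noteq> {}" for A
  proof
    show "A \<subseteq> topspace (Phi X)" using A closedin_subset by blast
    show "topspace (Phi X) \<subseteq> A"
    proof
      fix d assume "d \<in> topspace (Phi X)"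
      then have d: "d \<in> maximal_chains X" using tP by simp
      obtain c where cA: "c \<in> A" using A by blast
      then have c: "c \<in> maximal_chains X" using A closedin_subset tP by blast
      define I where "I = {q. (\<exists>m. labelling X m q) \<and> ordered X d q}"
      define K where "K q = A \<inter> {e \<in> topspace (Phi X). ordered X e q}" for q
      have cl: "closedin (Phi X) (K q)" if "q \<in> I" for q
        using that clopen_ordered(2)[OF X(1,2,4)] A unfolding K_def I_def by blast
      have fip: "\<exists>e\<in>topspace (Phi X). \<forall>q\<in>J. e \<in> K q" if J: "finite J" "J \<subseteq> I" for J
      proof -
        obtain n r where r: "labelling X n r" "\<forall>q\<in>J. \<exists>s. \<forall>x\<in>topspace X. q x = s (r x)"
          using finite_common_refinement[OF ne J(1)] J(2) unfolding I_def by blast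
        obtain \<sigma> where \<sigma>: "\<sigma> permutes {..<n}" "ordered X d (\<lambda>x. \<sigma> (r x))"
          using ordering_labels[OF X(1,2) d r(1)] .
        obtain \<tau> where \<tau>: "\<tau> permutes {..<n}" "ordered X c (\<lambda>x. \<tau> (r x))"
          using ordering_labels[OF X(1,2) c r(1)] .
        obtain g where g: "g \<in> Homeo X" "\<And>x. x \<in> topspace X \<Longrightarrow> \<sigma> (r (g x)) = \<tau> (r x)"
          using labelling_transitive[OF hh labelling_permute[OF r(1) \<tau>(1)] labelling_permute[OF r(1) \<sigma>(1)]] by blast
        have gc: "ordered X (Phi_action g c) (\<lambda>x. \<sigma> (r x))"
          unfolding ordered_Phi_action[OF g(1)] using \<tau>(2) ordered_cong[of X "\<lambda>x. \<sigma> (r (g x))" "\<lambda>x. \<tau> (r x)" c] g(2) by simp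
        have gcm: "Phi_action g c \<in> maximal_chains X" using Phi_action_maximal g c by blast
        have "Phi_action g c \<in> K q" if "q \<in> J" for q
        proof -
          from bspec[OF r(2) that] obtain s where s: "\<forall>x\<in>topspace X. q x = s (r x)" by (rule exE)
          have "q \<in> I" using J that by blast
          then obtain m where q: "labelling X m q" "ordered X d q" unfolding I_def by blast
          have "ordered X (Phi_action g c) q"
          proof (rule ordered_coarsening_transfer[OF ne d gcm labelling_permute[OF r(1) \<sigma>(1)] \<sigma>(2) gc q(1) _ q(2)])
            fix x assume "x \<in> topspace X"
            then show "q x = (s \<circ> inv \<sigma>) (\<sigma> (r x))" using s \<sigma>(1) by (simp add: permutes_inverses)
          qed
          moreover have "Phi_action g c \<in> A" using A(2) g(1) cA by blast
          ultimately show ?thesis using gcm tP by (simp add: K_def)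
        qed
        then show ?thesis using gcm tP by blast
      qed
      have "\<exists>e\<in>topspace (Phi X). \<forall>q\<in>I. e \<in> K q"
        by (rule compact_space_index_fip) (fact Phi_compact_Hausdorff(1)[OF X] cl fip)+
      then obtain e where e: "e \<in> topspace (Phi X)" "\<forall>q\<in>I. e \<in> K q" by blast
      have em: "e \<in> maximal_chains X" using e tP by simp
      have "ordered X e q" if "labelling X m q" "ordered X d q" for m q
        using e(2) that by (auto simp: I_def K_def)
      then have "d = e" by (rule maximal_chain_eqI[OF X d em])
      \<comment> \<open>One index suffices to read off from \<open>K\<close> that \<open>e\<close>
        lies in \<open>A\<close>.\<close>
      moreover have "(\<lambda>_. 0) \<in> I"
        using labelling_trivial[OF ne] by (auto simp: I_def ordered_def)
      ultimately show "d \<in> A" using e(2) by (auto simp: K_def)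
    qed
  qed
  then show ?thesis
    using Phi_G_space[OF X] maximal_chains_nonempty tP unfolding minimal_G_space_def by metis
qed

text \<open>A clopen cell is homeomorphic to \<open>X\<close>, so a labelling of \<open>X\<close>
  can be copied into it while the rest gets one more label. The second cell of \<open>p\<close>
  keeps the rest nonempty.\<close>

lemma many_labels:
  assumes hh: "h_homogeneous X" and ne: "topspace X \<noteq> {}" and p: "labelling X k p" "2 \<le> k"
  shows "\<exists>q. labelling X (Suc n) q"
proof (induction n)
  case 0
  then show ?case using labelling_trivial[OF ne] by auto
next
  case (Suc n)
  then obtain q where q: "labelling X (Suc n) q" by blast
  define A where "A = fib X p 0"
  have A: "clopenin X A" "A \<noteq> {}" "A \<subseteq> topspace X" using p fib_nonempty[OF p(1), of 0] by (auto simp: A_def labelling_def fib_def)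
  have "fib X p 1 \<noteq> {}" using fib_nonempty[OF p(1), of 1] p by simp
  then obtain y where y: "y \<in> topspace X" "y \<notin> A" by (auto simp: A_def fib_def)
  have "subtopology X A homeomorphic_space X" using hh A by (auto simp: h_homogeneous_def clopenin_def)
  then obtain h where h: "homeomorphic_map (subtopology X A) X h" by (auto simp: homeomorphic_space)
  then have hA: "h ` A = topspace X" using homeomorphic_imp_surjective_map[OF h] A by (simp add: Int_absorb1)
  have hc: "continuous_map (subtopology X A) X h" using h homeomorphic_imp_continuous_map by blast
  define r where "r x = (if x \<in> A then Suc (q (h x)) else 0)" for x
  have "labelling X (Suc (Suc n)) r"
    unfolding labelling_def
  proof (intro conjI allI)
    have "r ` topspace X = r ` A \<union> r ` (topspace X - A)" using A by blast
    also have "r ` A = Suc ` q ` h ` A" by (auto simp: r_def image_image)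
    also have "\<dots> = Suc ` {..<Suc n}" using hA q by (simp add: labelling_def)
    also have "r ` (topspace X - A) = {0}" using y by (auto simp: r_def)
    also have "Suc ` {..<Suc n} \<union> {0} = {..<Suc (Suc n)}"
      by (simp add: lessThan_Suc_eq_insert_0[of "Suc n"])
    finally show "r ` topspace X = {..<Suc (Suc n)}" .
    fix i
    show "clopenin X (fib X r i)"
    proof (cases i)
      case 0
      then have "fib X r i = topspace X - A" by (auto simp: fib_def r_def)
      then show ?thesis using A by (auto simp: clopenin_def)
    next
      case (Suc j)
      have eq: "fib X r i = {x \<in> topspace (subtopology X A). h x \<in> fib X q j}"
        using Suc A hA by (auto simp: fib_def r_def)
      have "openin X (fib X q j)" "closedin X (fib X q j)" using q by (auto simp: labelling_def clopenin_def)
      then have "openin (subtopology X A) (fib X r i)" "closedin (subtopology X A) (fib X r i)"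
        unfolding eq using openin_continuous_map_preimage[OF hc] closedin_continuous_map_preimage[OF hc] by blast+
      then show ?thesis using A openin_trans_full closedin_trans_full unfolding clopenin_def by blast
    qed
  qed
  then show ?case by blast
qed

lemma compact_clopen_between:
  assumes "zero_dimensional X" "compactin X K" "openin X U" "K \<subseteq> U"
  obtains C where "clopenin X C" "K \<subseteq> C" "C \<subseteq> U"
proof -
  let ?\<V> = "{V. clopenin X V \<and> V \<subseteq> U}"
  have "K \<subseteq> \<Union>?\<V>"
  proof
    fix x assume "x \<in> K"
    then have "openin X U \<and> x \<in> U" using assms by blast
    then obtain V where "openin X V" "closedin X V" "x \<in> V" "V \<subseteq> U" using assms(1) unfolding zero_dimensional_def by blast
    then show "x \<in> \<Union>?\<V>" by (auto simp: clopenin_def)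
  qed
  then have "\<exists>\<F>. finite \<F> \<and> \<F> \<subseteq> ?\<V> \<and> K \<subseteq> \<Union>\<F>"
    using assms(2) by (intro compactinD) (auto simp: clopenin_def)
  then obtain \<F> where \<F>: "finite \<F>" "\<F> \<subseteq> ?\<V>" "K \<subseteq> \<Union>\<F>" by blast
  have "clopenin X (\<Union>V\<in>\<F>. V)" by (rule clopenin_Union) (use \<F> in auto)
  then show thesis using that[of "\<Union>\<F>"] \<F> by auto
qed

text \<open>For a subbasic neighbourhood, put a clopen \<open>C\<close> between \<open>K\<close> and
  \<open>U\<close>: homeomorphisms preserving \<open>C\<close> send \<open>K\<close> into
  \<open>U\<close>. Finite intersections are handled by common refinements.\<close>

lemma neighbourhood_of_id:
  assumes zd: "zero_dimensional X" and ne: "topspace X \<noteq> {}"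
    and N: "openin (compact_open X (Homeo X)) N" "id \<in> N"
  obtains m q where "labelling X m q"
    "\<And>v. v \<in> Homeo X \<Longrightarrow> (\<And>x. x \<in> topspace X \<Longrightarrow> q (v x) = q x) \<Longrightarrow> v \<in> N"
proof -
  let ?P = "\<lambda>N. \<exists>m q. labelling X m q \<and> (\<forall>v\<in>Homeo X. (\<forall>x\<in>topspace X. q (v x) = q x) \<longrightarrow> v \<in> N)"
  have "generate_topology_on {{g \<in> Homeo X. g ` K \<subseteq> U} |K U. compactin X K \<and> openin X U} N"
    using N(1) unfolding compact_open_def by (rule openin_topology_generated_by)
  then have "id \<in> N \<longrightarrow> ?P N"
  proof induction
    case Empty
    then show ?case by simp
  next
    case (Int a b)
    show ?case
    proof
      assume "id \<in> a \<inter> b"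
      then have "id \<in> a" "id \<in> b" by simp_all
      then have "?P a" "?P b" using Int.IH by blast+
      then obtain m q m' q' where q: "labelling X m q" "\<forall>v\<in>Homeo X. (\<forall>x\<in>topspace X. q (v x) = q x) \<longrightarrow> v \<in> a"
        and q': "labelling X m' q'" "\<forall>v\<in>Homeo X. (\<forall>x\<in>topspace X. q' (v x) = q' x) \<longrightarrow> v \<in> b" by blast
      obtain n r s s' where r: "labelling X n r" and s: "\<And>x. x \<in> topspace X \<Longrightarrow> q x = s (r x)"
        and s': "\<And>x. x \<in> topspace X \<Longrightarrow> q' x = s' (r x)"
        using common_refinement[OF q(1) q'(1)] by metis
      have "v \<in> a \<inter> b" if v: "v \<in> Homeo X" "\<forall>x\<in>topspace X. r (v x) = r x" for v
      proof -
        have "\<forall>x\<in>topspace X. q (v x) = q x" "\<forall>x\<in>topspace X. q' (v x) = q' x"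
          using v s s' Homeo_in_topspace[OF v(1)] by auto
        then show ?thesis using q(2) q'(2) v(1) by blast
      qed
      then show "?P (a \<inter> b)" using r by blast
    qed
  next
    case (UN \<K>)
    show ?case
    proof
      assume "id \<in> \<Union>\<K>"
      then obtain k where k: "k \<in> \<K>" "id \<in> k" by blast
      then have "?P k" using UN.IH by blast
      then show "?P (\<Union>\<K>)" using k(1) by blast
    qed
  next
    case (Basis s)
    show ?case
    proof
      assume id: "id \<in> s"
      obtain K U where KU: "s = {g \<in> Homeo X. g ` K \<subseteq> U}" "compactin X K" "openin X U" using Basis by blast
      then have "K \<subseteq> U" using id by auto
      then obtain C where C: "clopenin X C" "K \<subseteq> C" "C \<subseteq> U" using compact_clopen_between[OF zd KU(2,3)] by blast
      have "clopenin X {x \<in> topspace X. (x \<in> C) = y}" for y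
      proof (cases y)
        case True
        moreover have "C \<subseteq> topspace X" using C openin_subset by (metis clopenin_def)
        ultimately have "{x \<in> topspace X. (x \<in> C) = y} = C" by auto
        then show ?thesis using C by simp
      next
        case False
        then have "{x \<in> topspace X. (x \<in> C) = y} = topspace X - C" by auto
        then show ?thesis using C by (auto simp: clopenin_def)
      qed
      then obtain m q t where q: "labelling X m q" "\<And>x. x \<in> topspace X \<Longrightarrow> (x \<in> C) = t (q x)"
        using labelling_from_finite_map[of "\<lambda>x. x \<in> C" X] by (metis finite)
      have "v \<in> s" if v: "v \<in> Homeo X" "\<forall>x\<in>topspace X. q (v x) = q x" for v
      proof -
        have "v x \<in> U" if "x \<in> K" for x
        proof -
          have x: "x \<in> topspace X" "x \<in> C" using that KU(2) C(2) compactin_subset_topspace by blast+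
          then have "v x \<in> C" using q(2)[of x] q(2)[of "v x"] v Homeo_in_topspace[OF v(1)] by simp
          then show ?thesis using C by blast
        qed
        then show ?thesis using KU v by auto
      qed
      then show "?P s" using q(1) by blast
    qed
  qed
  then show thesis using N(2) that by blast
qed

section \<open>Minimal subflows of the product\<close>

text \<open>The recursion unfolded: all parameters occur, and each letter is preceded by all smaller
  parameters. This form matches an order by first occurrence.\<close>

lemma rigid_iff:
  "rigid a k w \<longleftrightarrow> set w \<subseteq> {..<a + k} \<and> {a..<a + k} \<subseteq> set w \<and>
    (\<forall>l<length w. \<forall>y. a \<le> y \<and> y < w ! l \<longrightarrow> (\<exists>l'<l. w ! l' = y))"
  (is "_ \<longleftrightarrow> ?R a k w")
proof (induction w arbitrary: a k)
  case Nil
  then show ?case by auto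
next
  case (Cons x w)
  have all: "(\<forall>l<length (x # w). P l) \<longleftrightarrow> P 0 \<and> (\<forall>l<length w. P (Suc l))" for P
    by (simp add: All_less_Suc2)
  have ex: "(\<exists>l'<Suc l. (x # w) ! l' = y) \<longleftrightarrow> x = y \<or> (\<exists>l'<l. w ! l' = y)" for l y
    by (simp add: Ex_less_Suc2)
  have R: "?R a k (x # w) \<longleftrightarrow> x < a + k \<and> x \<le> a \<and> set w \<subseteq> {..<a + k} \<and> {a..<a + k} \<subseteq> insert x (set w) \<and>
    (\<forall>l<length w. \<forall>y. a \<le> y \<and> y < w ! l \<longrightarrow> x = y \<or> (\<exists>l'<l. w ! l' = y))"
  proof -
    have "(\<forall>y. a \<le> y \<and> y < x \<longrightarrow> (\<exists>l'<0. (x # w) ! l' = y)) \<longleftrightarrow> x \<le> a"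
      by (metis le_refl linorder_not_le not_less_zero order_le_less_trans)
    then show ?thesis unfolding all ex nth_Cons_0 nth_Cons_Suc by auto
  qed
  consider "x < a" | "x = a" | "a < x" by linarith
  then show ?case
  proof cases
    case 1
    then have "{a..<a + k} \<subseteq> insert x (set w) \<longleftrightarrow> {a..<a + k} \<subseteq> set w" by auto
    then show ?thesis unfolding R using 1 Cons.IH[of a k] by auto
  next
    case 2
    show ?thesis
    proof (cases k)
      case 0
      then show ?thesis unfolding R using 2 by simp
    next
      case (Suc k')
      have h1: "{a..<a + k} \<subseteq> insert a (set w) \<longleftrightarrow> {Suc a..<Suc a + k'} \<subseteq> set w"
      proof -
        have "{a..<a + k} = insert a {Suc a..<Suc a + k'}" using Suc by auto
        then show ?thesis by auto
      qed
      have h2: "(\<forall>y. a \<le> y \<and> y < z \<longrightarrow> a = y \<or> Q y) \<longleftrightarrow> (\<forall>y. Suc a \<le> y \<and> y < z \<longrightarrow> Q y)" for z Q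
      proof -
        have "a \<le> y \<longleftrightarrow> a = y \<or> Suc a \<le> y" for y by auto
        moreover have "\<not> Suc a \<le> a" by simp
        ultimately show ?thesis by metis
      qed
      have h3: "Suc a + k' = a + k" using Suc by simp
      have "rigid a k (x # w) \<longleftrightarrow> rigid (Suc a) k' w" using 2 Suc by simp
      also have "\<dots> \<longleftrightarrow> ?R a k (x # w)"
        unfolding Cons.IH R unfolding 2 h1 h2 unfolding h3 using Suc by simp
      finally show ?thesis .
    qed
  next
    case 3
    then show ?thesis unfolding R by auto
  qed
qed

lemma rwords_0_iff:
  "w \<in> rwords 0 k n \<longleftrightarrow> length w = n \<and> set w = {..<k} \<and> (\<forall>l<n. \<forall>y<w ! l. \<exists>l'<l. w ! l' = y)"
  unfolding rwords_def mem_Collect_eq rigid_iff by (auto simp: lessThan_atLeast0)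

text \<open>The link between chains and words. The chain orders the coarser cells by the least cell
  of \<open>b\<close> that each contains, that is by the first occurrence of the letter in
  \<open>v\<close>; so the coarser labels increase exactly if \<open>v\<close> is rigid.\<close>

lemma ordered_word_iff:
  assumes c: "c \<in> maximal_chains X" and ne: "topspace X \<noteq> {}"
    and b: "labelling X n b" "ordered X c b" and v: "length v = n" "set v = {..<k}"
  shows "ordered X c (\<lambda>x. v ! (b x)) \<longleftrightarrow> v \<in> rwords 0 k n"
proof -
  have lab: "labelling X k (\<lambda>x. v ! (b x))"
    by (rule labelling_map[OF b(1)]) (use v in \<open>auto simp: set_conv_nth\<close>)
  have bef: "before c (fib X (\<lambda>x. v ! (b x)) i) (fib X (\<lambda>x. v ! (b x)) j) \<longleftrightarrow>
    (\<exists>l<n. v ! l = i \<and> (\<forall>l'<n. v ! l' = j \<longrightarrow> l < l'))" for i j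
    unfolding fib_def by (rule before_ordered_iff[OF c b ne])
  show ?thesis
    unfolding ordered_iff[OF lab] bef rwords_0_iff
  proof (intro iffI conjI allI impI v)
    fix l y assume o: "\<forall>(i, j)\<in>{(i, j). i < j \<and> j < k}. \<exists>l<n. v ! l = i \<and> (\<forall>l'<n. v ! l' = j \<longrightarrow> l < l')"
      and l: "l < n" "y < v ! l"
    have "v ! l < k" using v l nth_mem[of l v] by auto
    then have "(y, v ! l) \<in> {(i, j). i < j \<and> j < k}" using l by simp
    from bspec[OF o this] show "\<exists>l'<l. v ! l' = y" using l(1) by auto
  next
    assume w: "length v = n \<and> set v = {..<k} \<and> (\<forall>l<n. \<forall>y<v ! l. \<exists>l'<l. v ! l' = y)"
    show "\<forall>(i, j)\<in>{(i, j). i < j \<and> j < k}. \<exists>l<n. v ! l = i \<and> (\<forall>l'<n. v ! l' = j \<longrightarrow> l < l')"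
    proof clarify
      fix i j assume ij: "i < j" "j < k"
      then have "j \<in> set v" using v by simp
      then have ex: "\<exists>l. l < n \<and> v ! l = j" using v by (auto simp: in_set_conv_nth)
      define l where "l = (LEAST l. l < n \<and> v ! l = j)"
      have l: "l < n" "v ! l = j" using LeastI_ex[OF ex] by (auto simp: l_def)
      have least: "l \<le> l'" if "l' < n" "v ! l' = j" for l' using that by (auto simp: l_def intro: Least_le)
      obtain l0 where l0: "l0 < l" "v ! l0 = i" using w l ij by blast
      have "\<forall>l'<n. v ! l' = j \<longrightarrow> l0 < l'" using least l0 by fastforce
      then show "\<exists>l<n. v ! l = i \<and> (\<forall>l'<n. v ! l' = j \<longrightarrow> l < l')" using l0 l by (intro exI[of _ l0]) auto
    qed
  qed
qed

section \<open>The product flow and its minimal subflows\<close>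

locale minimal_flow =
  fixes X :: "'a topology" and Z :: "'c topology" and act :: "('a \<Rightarrow> 'a) \<Rightarrow> 'c \<Rightarrow> 'c"
  assumes hh: "h_homogeneous X" and ne: "topspace X \<noteq> {}"
    and minZ: "minimal_G_space (Homeo X) (compact_open X (Homeo X)) Z act"
begin

lemma X_space: "compact_space X" "Hausdorff_space X" "zero_dimensional X" "topspace X \<noteq> {}"
  using hh ne by (auto simp: h_homogeneous_def)

lemma Z_space: "compact_space Z" "Hausdorff_space Z" "topspace Z \<noteq> {}"
  and act_cont: "continuous_map (prod_topology (compact_open X (Homeo X)) Z) Z (\<lambda>(g, y). act g y)"
  and act_id: "y \<in> topspace Z \<Longrightarrow> act id y = y"
  and act_comp: "g \<in> Homeo X \<Longrightarrow> h \<in> Homeo X \<Longrightarrow> y \<in> topspace Z \<Longrightarrow> act (g \<circ> h) y = act g (act h y)"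
  using minZ unfolding minimal_G_space_def G_space_def by auto

lemma Z_min: "closedin Z A \<Longrightarrow> (\<And>g. g \<in> Homeo X \<Longrightarrow> act g ` A \<subseteq> A) \<Longrightarrow> A \<noteq> {} \<Longrightarrow> A = topspace Z"
  using minZ[unfolded minimal_G_space_def, THEN conjunct2, THEN conjunct2, rule_format, of A] by blast

lemma Phi_min: "closedin (Phi X) A \<Longrightarrow> (\<And>g. g \<in> Homeo X \<Longrightarrow> Phi_action g ` A \<subseteq> A) \<Longrightarrow> A \<noteq> {} \<Longrightarrow> A = topspace (Phi X)"
  using Phi_minimal[OF hh ne, unfolded minimal_G_space_def, THEN conjunct2, THEN conjunct2, rule_format, of A] by blast

lemmas topspace_Phi_X = topspace_Phi[OF X_space(1,2,4)]

lemma act_topspace: "g \<in> Homeo X \<Longrightarrow> y \<in> topspace Z \<Longrightarrow> act g y \<in> topspace Z"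
  using act_cont[unfolded continuous_map_def, THEN conjunct1, THEN funcset_mem, of "(g, y)"] by simp

lemma continuous_act:
  assumes "g \<in> Homeo X"
  shows "continuous_map Z Z (act g)"
proof -
  have "continuous_map Z Z ((\<lambda>(g, y). act g y) \<circ> (\<lambda>y. (g, y)))"
    by (rule continuous_map_compose[OF _ act_cont]) (use assms in \<open>simp add: continuous_map_pairwise o_def\<close>)
  then show ?thesis by (simp add: o_def)
qed

lemma continuous_Phi_action_fixed:
  assumes "g \<in> Homeo X"
  shows "continuous_map (Phi X) (Phi X) (Phi_action g)"
proof -
  have "continuous_map (Phi X) (Phi X) ((\<lambda>(g, y). Phi_action g y) \<circ> (\<lambda>y. (g, y)))"
    by (rule continuous_map_compose[OF _ continuous_Phi_action[OF X_space(1,2,4)]])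
      (use assms in \<open>simp add: continuous_map_pairwise o_def\<close>)
  then show ?thesis by (simp add: o_def)
qed

definition product :: "('a set set \<times> 'c) topology" where "product = prod_topology (Phi X) Z"

definition pact :: "('a \<Rightarrow> 'a) \<Rightarrow> 'a set set \<times> 'c \<Rightarrow> 'a set set \<times> 'c" where
  "pact g = (\<lambda>(c, z). (Phi_action g c, act g z))"

lemma topspace_product: "topspace product = maximal_chains X \<times> topspace Z"
  by (simp add: product_def topspace_Phi_X)

lemma compact_space_product: "compact_space product"
  using Phi_compact_Hausdorff(1)[OF X_space] Z_space(1) by (simp add: product_def compact_space_prod_topology)

lemma continuous_pact: "g \<in> Homeo X \<Longrightarrow> continuous_map product product (pact g)"
  unfolding product_def pact_def case_prod_beta
  using continuous_map_compose[OF continuous_map_fst continuous_Phi_action_fixed]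
    continuous_map_compose[OF continuous_map_snd continuous_act]
  by (auto simp: continuous_map_pairwise o_def)

lemma pact_topspace: "g \<in> Homeo X \<Longrightarrow> p \<in> topspace product \<Longrightarrow> pact g p \<in> topspace product"
  using continuous_pact[unfolded continuous_map_def, THEN conjunct1, THEN funcset_mem] by blast

lemma pact_comp: "g \<in> Homeo X \<Longrightarrow> h \<in> Homeo X \<Longrightarrow> p \<in> topspace product \<Longrightarrow> pact (g \<circ> h) p = pact g (pact h p)"
  by (auto simp: pact_def topspace_product Phi_action_comp act_comp)

definition subflow :: "('a set set \<times> 'c) set \<Rightarrow> bool" where
  "subflow M \<longleftrightarrow> closedin product M \<and> M \<noteq> {} \<and> (\<forall>g\<in>Homeo X. \<forall>p\<in>M. pact g p \<in> M)"

text \<open>Zorn's lemma is applied to complements because it yields maximal elements; compactness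
  keeps the intersection of a chain of subflows nonempty.\<close>

lemma minimal_subflow: "\<exists>M. subflow M \<and> (\<forall>N. subflow N \<and> N \<subseteq> M \<longrightarrow> N = M)"
proof -
  let ?A = "{N. N \<subseteq> topspace product \<and> subflow (topspace product - N)}"
  have top: "subflow (topspace product)"
    using pact_topspace maximal_chains_nonempty[of X] Z_space(3) closedin_topspace[of product] unfolding subflow_def by (auto simp: topspace_product)
  have "\<exists>U\<in>?A. \<forall>D\<in>\<C>. D \<subseteq> U" if C: "subset.chain ?A \<C>" for \<C>
  proof (cases "\<C> = {}")
    case True
    then show ?thesis using top by (intro bexI[of _ "{}"]) auto
  next
    case False
    have CA: "D \<subseteq> topspace product" "subflow (topspace product - D)" if "D \<in> \<C>" for D
      using C that by (auto simp: subset.chain_def)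
    have cl: "closedin product (topspace product - D)" if "D \<in> \<C>" for D using CA(2)[OF that] by (simp add: subflow_def)
    have fip: "\<exists>y\<in>topspace product. \<forall>D\<in>J. y \<in> topspace product - D" if J: "finite J" "J \<subseteq> \<C>" for J
    proof (cases "J = {}")
      case True
      have "topspace product \<noteq> {}" using top unfolding subflow_def by blast
      then show ?thesis using True by blast
    next
      case False
      have "is_chain J"
        unfolding is_chain_def
      proof (intro ballI)
        fix D E assume "D \<in> J" "E \<in> J"
        then have "D \<subset> E \<or> D = E \<or> E \<subset> D" using C J(2) unfolding subset.chain_def by blast
        then show "D \<subseteq> E \<or> E \<subseteq> D" by (elim disjE) (simp_all add: less_le)
      qed
      from finite_chain_greatest[OF J(1) False this] obtain M where M: "M \<in> J" "\<forall>F\<in>J. F \<subseteq> M" by (rule bexE)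
      then have "topspace product - M \<noteq> {}" using CA(2)[of M] J by (auto simp: subflow_def)
      then show ?thesis using M by blast
    qed
    have "\<exists>y\<in>topspace product. \<forall>D\<in>\<C>. y \<in> topspace product - D"
      by (rule compact_space_index_fip) (fact compact_space_product cl fip)+
    then have ne: "topspace product - \<Union>\<C> \<noteq> {}" by auto
    have eq: "topspace product - \<Union>\<C> = (\<Inter>D\<in>\<C>. topspace product - D)" using False by auto
    have "closedin product (\<Inter>D\<in>\<C>. topspace product - D)" by (rule closedin_INT[OF False]) (rule cl)
    moreover have "pact g p \<in> topspace product - D" if "g \<in> Homeo X" "p \<in> topspace product - \<Union>\<C>" "D \<in> \<C>" for g p D
      using CA(2)[OF that(3)] that by (auto simp: subflow_def)
    ultimately have "subflow (topspace product - \<Union>\<C>)" using ne unfolding subflow_def eq by blast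
    then have "\<Union>\<C> \<in> ?A" using CA by auto
    then show ?thesis by (intro bexI[of _ "\<Union>\<C>"] ballI Union_upper)
  qed
  from subset_Zorn[OF this] obtain N where N: "N \<in> ?A" "\<forall>D\<in>?A. N \<subseteq> D \<longrightarrow> D = N" by (rule bexE)
  have "L = topspace product - N" if L: "subflow L" "L \<subseteq> topspace product - N" for L
  proof -
    have LY: "L \<subseteq> topspace product" using L(1) closedin_subset by (auto simp: subflow_def)
    then have "topspace product - (topspace product - L) = L" by blast
    then have "topspace product - L \<in> ?A" using L by simp
    moreover have "N \<subseteq> topspace product - L" using N L by auto
    ultimately have "topspace product - L = N" using N(2) by simp
    then show ?thesis using LY by blast
  qed
  note key = this
  show ?thesis
  proof (rule exI, rule conjI)
    show "subflow (topspace product - N)" using N(1) by simp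
    show "\<forall>L. subflow L \<and> L \<subseteq> topspace product - N \<longrightarrow> L = topspace product - N"
    proof (intro allI impI)
      fix L assume "subflow L \<and> L \<subseteq> topspace product - N"
      then show "L = topspace product - N" using key[OF conjunct1 conjunct2] by simp
    qed
  qed
qed

end

section \<open>Functionality of minimal subflows\<close>

lemma labelling_word:
  assumes "u \<in> rwords 0 j l" "labelling X l b"
  shows "labelling X j (\<lambda>x. u ! (b x))"
  by (rule labelling_map[OF assms(2)]) (use assms(1) in \<open>auto simp: rwords_0_iff set_conv_nth\<close>)

context minimal_flow
begin

text \<open>The difference vanishes at \<open>v = id\<close>. As \<open>Z\<close> is compact, the
  tube lemma bounds it uniformly in \<open>w\<close> for all \<open>v\<close> near
  \<open>id\<close>, and a neighbourhood of \<open>id\<close> contains all homeomorphisms preserving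
  the cells of some clopen partition.\<close>

lemma small_displacement:
  assumes f: "continuous_map Z euclideanreal f" and "0 < e"
  obtains k p where "labelling X k p"
    "\<And>v w. v \<in> Homeo X \<Longrightarrow> (\<And>x. x \<in> topspace X \<Longrightarrow> p (v x) = p x) \<Longrightarrow> w \<in> topspace Z \<Longrightarrow> \<bar>f (act v w) - f w\<bar> < e"
proof -
  let ?T = "compact_open X (Homeo X)"
  define F where "F p = f (act (fst p) (snd p)) - f (snd p)" for p
  have act': "continuous_map (prod_topology ?T Z) Z (\<lambda>p. act (fst p) (snd p))"
    using act_cont unfolding case_prod_unfold .
  have "continuous_map (prod_topology ?T Z) euclideanreal F"
    unfolding F_def
    using continuous_map_compose[OF act' f] continuous_map_compose[OF continuous_map_snd f]
    by (intro continuous_map_diff) (simp_all add: o_def)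
  then have op: "openin (prod_topology ?T Z) {p \<in> topspace (prod_topology ?T Z). F p \<in> {-e<..<e}}"
    by (rule openin_continuous_map_preimage) simp
  have cZ: "compactin Z (topspace Z)" using Z_space(1) by (simp add: compact_space_def)
  have idT: "id \<in> topspace ?T" using Homeo_id by simp
  have "{id} \<times> topspace Z \<subseteq> {p \<in> topspace (prod_topology ?T Z). F p \<in> {-e<..<e}}"
    using Homeo_id act_id \<open>0 < e\<close> by (auto simp: F_def)
  from tube_lemma_right[OF op cZ idT this] obtain N V where NV: "openin ?T N" "id \<in> N" "topspace Z \<subseteq> V"
    "N \<times> V \<subseteq> {p \<in> topspace (prod_topology ?T Z). F p \<in> {-e<..<e}}"
    by (elim exE conjE)
  obtain k p where kp: "labelling X k p" "\<And>v. v \<in> Homeo X \<Longrightarrow> (\<And>x. x \<in> topspace X \<Longrightarrow> p (v x) = p x) \<Longrightarrow> v \<in> N"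
    using neighbourhood_of_id[OF X_space(3,4) NV(1,2)] by metis
  show thesis
  proof (rule that[OF kp(1)])
    fix v w assume v: "v \<in> Homeo X" "\<And>x. x \<in> topspace X \<Longrightarrow> p (v x) = p x" and w: "w \<in> topspace Z"
    have "(v, w) \<in> N \<times> V" using kp(2)[OF v] w NV(3) by blast
    then have "F (v, w) \<in> {-e<..<e}" using NV(4) by blast
    then show "\<bar>f (act v w) - f w\<bar> < e" by (auto simp: F_def)
  qed
qed

text \<open>The maps \<open>s\<close> and \<open>s'\<close> express that both pullbacks of
  \<open>p\<close> are coarser than \<open>q\<close>; the common \<open>\<sigma>\<close> expresses
  that \<open>d\<close> puts the same order on them.\<close>

definition nearly_determined :: "nat \<Rightarrow> ('a \<Rightarrow> nat) \<Rightarrow> ('a \<Rightarrow> nat) \<Rightarrow> ('c \<Rightarrow> real) \<Rightarrow> 'a set set \<Rightarrow> 'c \<Rightarrow> bool" where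
  "nearly_determined k p q f d w \<longleftrightarrow> (\<forall>\<sigma> h h' s s'. \<sigma> permutes {..<k} \<longrightarrow> h \<in> Homeo X \<longrightarrow> h' \<in> Homeo X \<longrightarrow>
    (\<forall>x\<in>topspace X. p (h x) = s (q x)) \<longrightarrow> (\<forall>x\<in>topspace X. p (h' x) = s' (q x)) \<longrightarrow>
    ordered X d (\<lambda>x. \<sigma> (p (h x))) \<longrightarrow> ordered X d (\<lambda>x. \<sigma> (p (h' x))) \<longrightarrow> \<bar>f (act h w) - f (act h' w)\<bar> \<le> 1/2)"

text \<open>Take any \<open>(c0, w0)\<close> in \<open>M\<close> and an \<open>n\<close>-cell
  partition \<open>b\<close> ordered by \<open>c0\<close>. A rigid word \<open>w\<close> is coloured
  by the rounded values of \<open>f\<close> at \<open>H w \<sigma>\<close> applied to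
  \<open>w0\<close>, where \<open>H w \<sigma>\<close> pulls \<open>p\<close>, relabelled by
  \<open>\<sigma>\<close>, back to the coarsening of \<open>b\<close> along \<open>w\<close>. The
  Ramsey word \<open>W\<close> coarsens \<open>b\<close> to \<open>m\<close> cells, and a
  homeomorphism \<open>g\<close> carrying this coarsening to \<open>q\<close> moves
  \<open>(c0, w0)\<close> to the required point.\<close>

lemma ramsey_point:
  assumes M: "subflow M" and p: "labelling X k p" and q: "labelling X m q"
    and f: "\<And>w. w \<in> topspace Z \<Longrightarrow> 0 \<le> f w \<and> f w \<le> (1::real)"
    and disp: "\<And>v w. v \<in> Homeo X \<Longrightarrow> (\<And>x. x \<in> topspace X \<Longrightarrow> p (v x) = p x) \<Longrightarrow> w \<in> topspace Z \<Longrightarrow> \<bar>f (act v w) - f w\<bar> < 1/8"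
  shows "\<exists>d w. (d, w) \<in> M \<and> nearly_determined k p q f d w"
proof -
  obtain c0 w0 where cw: "(c0, w0) \<in> M" using M by (auto simp: subflow_def)
  have MY: "M \<subseteq> topspace product" using M closedin_subset by (auto simp: subflow_def)
  then have c0: "c0 \<in> maximal_chains X" and w0: "w0 \<in> topspace Z" using cw by (auto simp: topspace_product)
  obtain x0 where x0: "x0 \<in> topspace X" using ne by blast
  have km: "0 < k" "0 < m" using labelling_range[OF p x0] labelling_range[OF q x0] by auto
  show ?thesis
  \<comment> \<open>With a single cell every homeomorphism preserves \<open>p\<close> and the
    displacement bound suffices; with two cells there are partitions into any positive number of
    cells.\<close>
  proof (cases "k = 1")
    case True
    have "\<bar>f (act h w0) - f (act h' w0)\<bar> \<le> 1/2" if "h \<in> Homeo X" "h' \<in> Homeo X" for h h'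
    proof -
      have "\<bar>f (act h w0) - f w0\<bar> < 1/8" if "h \<in> Homeo X" for h
      proof (rule disp[OF that _ w0])
        fix x assume "x \<in> topspace X"
        then show "p (h x) = p x"
          using labelling_range[OF p] Homeo_in_topspace[OF that] True by (metis less_one)
      qed
      from this[OF that(1)] this[OF that(2)] show ?thesis by linarith
    qed
    then have "nearly_determined k p q f c0 w0" by (simp add: nearly_determined_def)
    then show ?thesis using cw by blast
  next
    case False
    then have k2: "2 \<le> k" using km by simp
    define D where "D = {\<sigma>. \<sigma> permutes {..<k}}"
    have finD: "finite D" by (simp add: D_def finite_permutations)
    obtain n where n: "0 < n" "ramsey 0 k m (9 ^ card D) n" using dual_ramsey[OF km] by blast
    obtain b0 where b0: "labelling X n b0" using many_labels[OF hh ne p k2, of "n - 1"] n(1) by auto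
    obtain \<beta> where \<beta>: "\<beta> permutes {..<n}" "ordered X c0 (\<lambda>x. \<beta> (b0 x))" using ordering_labels[OF X_space(1,2) c0 b0] .
    define b where "b x = \<beta> (b0 x)" for x
    have b: "labelling X n b" "ordered X c0 b" using labelling_permute[OF b0 \<beta>(1)] \<beta>(2) unfolding b_def by blast+
    define H :: "nat list \<Rightarrow> (nat \<Rightarrow> nat) \<Rightarrow> 'a \<Rightarrow> 'a" where "H w \<sigma> = (SOME g. g \<in> Homeo X \<and> (\<forall>x\<in>topspace X. \<sigma> (p (g x)) = w ! (b x)))" for w \<sigma>
    have H: "H w \<sigma> \<in> Homeo X \<and> (\<forall>x\<in>topspace X. \<sigma> (p (H w \<sigma> x)) = w ! (b x))"
      if w: "w \<in> rwords 0 k n" and \<sigma>: "\<sigma> permutes {..<k}" for w \<sigma>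
    proof -
      obtain g where g: "g \<in> Homeo X" "\<And>x. x \<in> topspace X \<Longrightarrow> \<sigma> (p (g x)) = w ! (b x)"
        using labelling_transitive[OF hh labelling_word[OF w b(1)] labelling_permute[OF p \<sigma>]] by blast
      have "\<exists>g. g \<in> Homeo X \<and> (\<forall>x\<in>topspace X. \<sigma> (p (g x)) = w ! (b x))" using g by blast
      then show ?thesis unfolding H_def by (rule someI_ex)
    qed
    define col where "col w \<sigma> = nat \<lfloor>8 * f (act (H w \<sigma>) w0)\<rfloor>" for w \<sigma>
    have col: "\<forall>w\<in>rwords 0 k n. \<forall>\<sigma>\<in>D. col w \<sigma> \<in> {..8}"
    proof (intro ballI)
      fix w \<sigma> assume "w \<in> rwords 0 k n" "\<sigma> \<in> D"
      then have "act (H w \<sigma>) w0 \<in> topspace Z" using H act_topspace w0 by (simp add: D_def)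
      then have "f (act (H w \<sigma>) w0) \<le> 1" using f by blast
      then have "8 * f (act (H w \<sigma>) w0) \<le> 8" by simp
      then have "\<lfloor>8 * f (act (H w \<sigma>) w0)\<rfloor> \<le> 8" by linarith
      then have "nat \<lfloor>8 * f (act (H w \<sigma>) w0)\<rfloor> \<le> nat 8" by (rule nat_mono)
      then show "col w \<sigma> \<in> {..8}" unfolding col_def atMost_iff by simp
    qed
    have "card {..(8::nat)} \<le> 9" by simp
    then obtain C' and \<gamma> :: "nat list \<Rightarrow> nat" where C': "finite C'" "card C' \<le> 9 ^ card D" "\<gamma> ` rwords 0 k n \<subseteq> C'"
      and eq: "\<forall>u u'. \<gamma> u = \<gamma> u' \<longrightarrow> (\<forall>\<sigma>\<in>D. col u \<sigma> = col u' \<sigma>)"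
      by (rule product_colouring[OF finD finite_atMost _ col])
    obtain W r where W: "W \<in> rwords 0 m n" and r: "\<And>v. v \<in> rwords 0 k m \<Longrightarrow> \<gamma> (subst 0 v W) = r"
      using ramseyD[OF n(2) C'] by metis
    obtain g where g: "g \<in> Homeo X" "\<And>x. x \<in> topspace X \<Longrightarrow> q (g x) = W ! (b x)"
      using labelling_transitive[OF hh labelling_word[OF W b(1)] q] by blast
    have oq: "ordered X c0 (\<lambda>x. q (g x))" "labelling X m (\<lambda>x. q (g x))"
    proof -
      have "ordered X c0 (\<lambda>x. W ! (b x))"
        using ordered_word_iff[OF c0 ne b] W by (auto simp: rwords_0_iff)
      then show "ordered X c0 (\<lambda>x. q (g x))" using ordered_cong[of X "\<lambda>x. q (g x)" "\<lambda>x. W ! (b x)" c0] g(2) by simp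
      show "labelling X m (\<lambda>x. q (g x))" by (rule labelling_comp_Homeo[OF q g(1)])
    qed
    have key: "\<exists>v\<in>rwords 0 k m. \<bar>f (act h (act g w0)) - f (act (H (subst 0 v W) \<sigma>) w0)\<bar> < 1/8"
      if \<sigma>: "\<sigma> permutes {..<k}" and h: "h \<in> Homeo X" "\<forall>x\<in>topspace X. p (h x) = s (q x)"
        and o: "ordered X (Phi_action g c0) (\<lambda>x. \<sigma> (p (h x)))" for \<sigma> h s
    proof -
      \<comment> \<open>The labels that \<open>\<sigma>\<close> after \<open>p\<close> and
        \<open>h\<close> gives to the cells of \<open>q\<close>; that the moved chain orders them
        makes this word rigid.\<close>
      define v where "v = map (\<lambda>i. \<sigma> (s i)) [0..<m]"
      have v_nth: "v ! i = \<sigma> (s i)" if "i < m" for i using that by (simp add: v_def)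
      have hg: "\<sigma> (p (h (g x))) = v ! (q (g x))" if "x \<in> topspace X" for x
        using h(2) that Homeo_in_topspace[OF g(1)] v_nth labelling_range[OF q] by simp
      have "set v = (\<lambda>i. \<sigma> (s i)) ` q ` topspace X" using q by (auto simp: v_def labelling_def)
      also have "\<dots> = (\<lambda>x. \<sigma> (p (h x))) ` topspace X" using h(2) by (auto simp: image_image)
      also have "\<dots> = {..<k}"
        using labelling_permute[OF labelling_comp_Homeo[OF p h(1)] \<sigma>] by (simp add: labelling_def)
      finally have sv: "set v = {..<k}" .
      have "ordered X c0 (\<lambda>x. \<sigma> (p (h (g x))))" using o ordered_Phi_action[OF g(1)] by simp
      then have "ordered X c0 (\<lambda>x. v ! (q (g x)))" using ordered_cong[of X "\<lambda>x. \<sigma> (p (h (g x)))" "\<lambda>x. v ! (q (g x))" c0] hg by simp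
      then have v: "v \<in> rwords 0 k m"
        using ordered_word_iff[OF c0 ne oq(2,1) _ sv] by (simp add: v_def)
      define V where "V = subst 0 v W"
      have V: "V \<in> rwords 0 k n" unfolding V_def by (rule subst_in_rwords[OF W v]) simp
      note HV = H[OF V \<sigma>]
      have Vb: "V ! (b x) = v ! (W ! (b x))" if "x \<in> topspace X" for x
        using labelling_range[OF b(1) that] W by (simp add: V_def subst_def rwords_def)
      have same: "p (h (g x)) = p (H V \<sigma> x)" if x: "x \<in> topspace X" for x
      proof -
        have "\<sigma> (p (h (g x))) = \<sigma> (p (H V \<sigma> x))" using hg[OF x] g(2)[OF x] Vb[OF x] HV x by simp
        then show ?thesis using permutes_inj[OF \<sigma>] by (auto dest: injD)
      qed
      \<comment> \<open>\<open>h \<circ> g\<close> and \<open>H V \<sigma>\<close> pull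
        \<open>p\<close> back to the same labelling, so they differ by a homeomorphism
        \<open>u\<close> that preserves the cells of \<open>p\<close> and displaces \<open>f\<close>
        by less than 1/8.\<close>
      define u where "u = (h \<circ> g) \<circ> inv (H V \<sigma>)"
      have uG: "u \<in> Homeo X" unfolding u_def using h(1) g(1) HV by (intro Homeo_comp Homeo_inv) simp_all
      have "p (u y) = p y" if y: "y \<in> topspace X" for y
      proof -
        let ?x = "inv (H V \<sigma>) y"
        have HG: "H V \<sigma> \<in> Homeo X" using HV by simp
        have "?x \<in> topspace X" using y Homeo_in_topspace[OF Homeo_inv[OF HG]] by simp
        moreover have "H V \<sigma> ?x = y" using fun_cong[OF Homeo_inv_comp(1)[OF HG], of y] by simp
        ultimately show ?thesis using same[of ?x] by (simp add: u_def)
      qed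
      then have "\<bar>f (act u (act (H V \<sigma>) w0)) - f (act (H V \<sigma>) w0)\<bar> < 1/8"
        using disp[OF uG] act_topspace HV w0 by blast
      moreover have "act u (act (H V \<sigma>) w0) = act h (act g w0)"
      proof -
        have "act u (act (H V \<sigma>) w0) = act (u \<circ> H V \<sigma>) w0" using act_comp[OF uG _ w0] HV by simp
        also have "u \<circ> H V \<sigma> = h \<circ> g" unfolding u_def comp_assoc using Homeo_inv_comp(2)[of "H V \<sigma>" X] HV by simp
        also have "act (h \<circ> g) w0 = act h (act g w0)" using act_comp[OF h(1) g(1) w0] .
        finally show ?thesis .
      qed
      ultimately show ?thesis using v unfolding V_def by auto
    qed
    show ?thesis
      unfolding nearly_determined_def
    proof (intro exI conjI allI impI)
      show "(Phi_action g c0, act g w0) \<in> M"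
        using M g(1) cw unfolding subflow_def pact_def by fastforce
      fix \<sigma> h h' s s'
      assume \<sigma>: "\<sigma> permutes {..<k}" and h: "h \<in> Homeo X" "h' \<in> Homeo X" "\<forall>x\<in>topspace X. p (h x) = s (q x)"
          "\<forall>x\<in>topspace X. p (h' x) = s' (q x)"
        and o: "ordered X (Phi_action g c0) (\<lambda>x. \<sigma> (p (h x)))" "ordered X (Phi_action g c0) (\<lambda>x. \<sigma> (p (h' x)))"
      obtain v where v: "v \<in> rwords 0 k m" "\<bar>f (act h (act g w0)) - f (act (H (subst 0 v W) \<sigma>) w0)\<bar> < 1/8"
        using key[OF \<sigma> h(1,3) o(1)] by blast
      obtain v' where v': "v' \<in> rwords 0 k m" "\<bar>f (act h' (act g w0)) - f (act (H (subst 0 v' W) \<sigma>) w0)\<bar> < 1/8"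
        using key[OF \<sigma> h(2,4) o(2)] by blast
      have "col (subst 0 v W) \<sigma> = col (subst 0 v' W) \<sigma>" using eq r v v' \<sigma> by (simp add: D_def)
      moreover have "0 \<le> f (act (H (subst 0 v W) \<sigma>) w0)" if "v \<in> rwords 0 k m" for v
        using H[OF subst_in_rwords[OF W that] \<sigma>] act_topspace[OF _ w0] f by simp
      ultimately have "\<lfloor>8 * f (act (H (subst 0 v W) \<sigma>) w0)\<rfloor> = \<lfloor>8 * f (act (H (subst 0 v' W) \<sigma>) w0)\<rfloor>"
        using v v' by (simp add: col_def eq_nat_nat_iff)
      then have "\<bar>f (act (H (subst 0 v W) \<sigma>) w0) - f (act (H (subst 0 v' W) \<sigma>) w0)\<bar> \<le> 1/8" by linarith
      then show "\<bar>f (act h (act g w0)) - f (act h' (act g w0))\<bar> \<le> 1/2" using v v' by linarith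
    qed
  qed
qed

lemma continuous_map_to_real_closed:
  assumes "continuous_map Z euclideanreal f" "h \<in> Homeo X" "h' \<in> Homeo X"
  shows "closedin product {p \<in> topspace product. \<bar>f (act h (snd p)) - f (act h' (snd p))\<bar> \<le> e}"
proof -
  have c: "continuous_map product euclideanreal (\<lambda>p. f (act g (snd p)))" if "g \<in> Homeo X" for g
    using continuous_map_compose[OF continuous_map_compose[OF continuous_map_snd continuous_act[OF that]] assms(1)]
    unfolding product_def by (simp add: o_def)
  have "continuous_map product euclideanreal (\<lambda>p. f (act h (snd p)) - f (act h' (snd p)))"
    by (intro continuous_map_diff c assms)
  then have "closedin product {p \<in> topspace product. f (act h (snd p)) - f (act h' (snd p)) \<in> {-e..e}}"
    by (rule closedin_continuous_map_preimage) simp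
  moreover have "{p \<in> topspace product. f (act h (snd p)) - f (act h' (snd p)) \<in> {-e..e}}
      = {p \<in> topspace product. \<bar>f (act h (snd p)) - f (act h' (snd p))\<bar> \<le> e}" by auto
  ultimately show ?thesis by simp
qed

lemma fst_continuous: "continuous_map product (Phi X) fst"
  unfolding product_def by (rule continuous_map_fst)

text \<open>Finitely many conditions involve finitely many pullbacks of \<open>p\<close>, and their
  common refinement is the \<open>q\<close> to which \<open>ramsey_point\<close> is applied.
  Invariance of the set of good points under \<open>g\<close> holds because the conditions for
  \<open>h\<close> and \<open>h'\<close> at a translated point are those for
  \<open>h \<circ> g\<close> and \<open>h' \<circ> g\<close> at the original one.\<close>

lemma uniform_equivariance:
  assumes M: "subflow M" "\<And>N. subflow N \<Longrightarrow> N \<subseteq> M \<Longrightarrow> N = M" and p: "labelling X k p"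
    and f: "continuous_map Z euclideanreal f" "\<And>w. w \<in> topspace Z \<Longrightarrow> 0 \<le> f w \<and> f w \<le> (1::real)"
    and disp: "\<And>v w. v \<in> Homeo X \<Longrightarrow> (\<And>x. x \<in> topspace X \<Longrightarrow> p (v x) = p x) \<Longrightarrow> w \<in> topspace Z \<Longrightarrow> \<bar>f (act v w) - f w\<bar> < 1/8"
    and cz: "(c, z) \<in> M" and \<sigma>: "\<sigma> permutes {..<k}" and h: "h \<in> Homeo X" "h' \<in> Homeo X"
    and o: "ordered X c (\<lambda>x. \<sigma> (p (h x)))" "ordered X c (\<lambda>x. \<sigma> (p (h' x)))"
  shows "\<bar>f (act h z) - f (act h' z)\<bar> \<le> 1/2"
proof -
  define I where "I = {\<sigma>. \<sigma> permutes {..<k}} \<times> Homeo X \<times> Homeo X"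
  define K where "K = (\<lambda>(\<sigma>, h, h'). {y \<in> M. ordered X (fst y) (\<lambda>x. \<sigma> (p (h x))) \<longrightarrow> ordered X (fst y) (\<lambda>x. \<sigma> (p (h' x))) \<longrightarrow>
    \<bar>f (act h (snd y)) - f (act h' (snd y))\<bar> \<le> 1/2})"
  have MY: "M \<subseteq> topspace product" and clM: "closedin product M" using M(1) closedin_subset by (auto simp: subflow_def)
  have clK: "closedin product (K i)" if iI: "i \<in> I" for i
  proof -
    obtain \<sigma> h h' where i: "i = (\<sigma>, h, h')" and \<sigma>: "\<sigma> permutes {..<k}" and h: "h \<in> Homeo X" "h' \<in> Homeo X"
      using iI by (auto simp: I_def)
    let ?O = "\<lambda>h. {y \<in> topspace product. fst y \<in> {d \<in> topspace (Phi X). ordered X d (\<lambda>x. \<sigma> (p (h x)))}}"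
    have op: "openin product (?O h)" if "h \<in> Homeo X" for h
      by (rule openin_continuous_map_preimage[OF fst_continuous])
        (rule clopen_ordered(1)[OF X_space(1,2,4) labelling_permute[OF labelling_comp_Homeo[OF p that] \<sigma>]])
    \<comment> \<open>The implication is a closed condition since its premises are open in the
      chain.\<close>
    have "K i = M \<inter> ((topspace product - ?O h) \<union> (topspace product - ?O h') \<union> {y \<in> topspace product. \<bar>f (act h (snd y)) - f (act h' (snd y))\<bar> \<le> 1/2})"
      using MY topspace_Phi_X by (auto simp: K_def i topspace_product)
    moreover have "closedin product \<dots>"
      by (intro closedin_Int closedin_Un closedin_diff closedin_topspace clM op h continuous_map_to_real_closed f)
    ultimately show ?thesis by simp
  qed
  have fip: "\<exists>y\<in>topspace product. \<forall>i\<in>J. y \<in> K i" if J: "finite J" "J \<subseteq> I" for J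
  proof -
    define L where "L = (\<lambda>(\<sigma>, h, h'). (\<lambda>x. p (h x))) ` J \<union> (\<lambda>(\<sigma>, h, h'). (\<lambda>x. p (h' x))) ` J"
    have "finite L" using J by (simp add: L_def)
    moreover have "\<exists>m. labelling X m q" if qL: "q \<in> L" for q
    proof -
      obtain h where "h \<in> Homeo X" "q = (\<lambda>x. p (h x))" using qL J by (auto simp: L_def I_def)
      then show ?thesis using labelling_comp_Homeo[OF p] by blast
    qed
    ultimately obtain m q where q: "labelling X m q" "\<forall>r\<in>L. \<exists>s. \<forall>x\<in>topspace X. r x = s (q x)"
      using finite_common_refinement[OF ne, of L] by metis
    have "\<exists>d w. (d, w) \<in> M \<and> nearly_determined k p q f d w"
      by (rule ramsey_point) (fact M(1) p q(1) f(2) disp)+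
    then obtain d w where dw: "(d, w) \<in> M" and R: "nearly_determined k p q f d w" by blast
    have "(d, w) \<in> K i" if iJ: "i \<in> J" for i
    proof -
      obtain \<sigma> h h' where i: "i = (\<sigma>, h, h')" and \<sigma>: "\<sigma> permutes {..<k}" and h: "h \<in> Homeo X" "h' \<in> Homeo X"
        using subsetD[OF J(2) iJ] by (auto simp: I_def)
      have "(\<lambda>x. p (h x)) \<in> L" "(\<lambda>x. p (h' x)) \<in> L"
        using image_eqI[OF _ iJ, of "\<lambda>x. p (h x)" "\<lambda>(\<sigma>, h, h'). (\<lambda>x. p (h x))"]
          image_eqI[OF _ iJ, of "\<lambda>x. p (h' x)" "\<lambda>(\<sigma>, h, h'). (\<lambda>x. p (h' x))"] by (auto simp: L_def i)
      then obtain s s' where "\<forall>x\<in>topspace X. p (h x) = s (q x)" "\<forall>x\<in>topspace X. p (h' x) = s' (q x)"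
        using bspec[OF q(2), of "\<lambda>x. p (h x)"] bspec[OF q(2), of "\<lambda>x. p (h' x)"] by blast
      then show ?thesis
        using R[unfolded nearly_determined_def, rule_format, OF \<sigma> h, of s s'] dw by (simp add: K_def i)
    qed
    then show ?thesis using dw MY by blast
  qed
  have "\<exists>y\<in>topspace product. \<forall>i\<in>I. y \<in> K i"
    by (rule compact_space_index_fip) (fact compact_space_product clK fip)+
  then obtain y where y: "y \<in> topspace product" "\<forall>i\<in>I. y \<in> K i" by blast
  define N where "N = (\<Inter>i\<in>I. K i)"
  have II: "(id, id, id) \<in> I" by (simp add: I_def permutes_id Homeo_id)
  then have Ine: "I \<noteq> {}" by blast
  have NM: "N \<subseteq> M" using II by (auto simp: N_def K_def)
  have "subflow N"
    unfolding subflow_def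
  proof (intro conjI ballI)
    show "closedin product N" unfolding N_def by (rule closedin_INT[OF Ine]) (rule clK)
    show "N \<noteq> {}" using y by (auto simp: N_def)
    fix g y assume g: "g \<in> Homeo X" and y: "y \<in> N"
    then have yM: "y \<in> M" using NM by blast
    then have gy: "pact g y \<in> M" using M(1) g by (simp add: subflow_def)
    obtain d w where dw: "y = (d, w)" "w \<in> topspace Z" using yM MY by (auto simp: topspace_product)
    show "pact g y \<in> N"
      unfolding N_def
    proof (rule INT_I)
      fix i assume "i \<in> I"
      then obtain \<sigma> h h' where i: "i = (\<sigma>, h, h')" and \<sigma>: "\<sigma> permutes {..<k}" and h: "h \<in> Homeo X" "h' \<in> Homeo X"
        by (auto simp: I_def)
      have "(\<sigma>, h \<circ> g, h' \<circ> g) \<in> I" using \<sigma> h g Homeo_comp by (auto simp: I_def)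
      then have "y \<in> K (\<sigma>, h \<circ> g, h' \<circ> g)" using y unfolding N_def by blast
      then show "pact g y \<in> K i"
        using gy act_comp[OF h(1) g dw(2)] act_comp[OF h(2) g dw(2)]
        by (simp add: K_def i dw pact_def ordered_Phi_action[OF g])
    qed
  qed
  then have "N = M" using M(2) NM by blast
  then have "(c, z) \<in> K (\<sigma>, h, h')" using cz \<sigma> h unfolding N_def I_def by blast
  then show ?thesis using o by (simp add: K_def)
qed

text \<open>With \<open>f z = 0\<close> and \<open>f z' = 1\<close>, density of the orbit of
  \<open>(c, z)\<close> in \<open>M\<close> gives \<open>h\<close> such that the moved chain still
  orders \<open>p\<close> relabelled by \<open>\<sigma>\<close> and \<open>f (act h z)\<close>
  exceeds 1/2. But then \<open>h\<close> and \<open>id\<close> induce the same order, so this value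
  differs from \<open>f z\<close> by at most 1/2.\<close>

lemma minimal_subflow_functional:
  assumes M: "subflow M" "\<And>N. subflow N \<Longrightarrow> N \<subseteq> M \<Longrightarrow> N = M" and cz: "(c, z) \<in> M" "(c, z') \<in> M"
  shows "z = z'"
proof (rule ccontr)
  assume neq: "z \<noteq> z'"
  have MY: "M \<subseteq> topspace product" and clM: "closedin product M" using M(1) closedin_subset by (auto simp: subflow_def)
  have zz: "z \<in> topspace Z" "z' \<in> topspace Z" and c: "c \<in> maximal_chains X" using cz MY by (auto simp: topspace_product)
  have nZ: "normal_space Z" using Z_space compact_Hausdorff_or_regular_imp_normal_space by blast
  have "closedin Z {z} \<and> closedin Z {z'} \<and> disjnt {z} {z'}"
    using closedin_Hausdorff_singleton[OF Z_space(2) zz(1)] closedin_Hausdorff_singleton[OF Z_space(2) zz(2)] neq by simp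
  from nZ[unfolded normal_space_iff_Urysohn, rule_format, OF this] obtain f :: "'c \<Rightarrow> real"
    where f01: "continuous_map Z (top_of_set {0..1}) f" and "f ` {z} \<subseteq> {0}" "f ` {z'} \<subseteq> {1}" by (elim exE conjE)
  then have fz: "f z = 0" "f z' = 1" by simp_all
  have f: "continuous_map Z euclideanreal f" "\<And>w. w \<in> topspace Z \<Longrightarrow> 0 \<le> f w \<and> f w \<le> 1"
    using f01 by (auto simp: continuous_map_in_subtopology)
  obtain k p where p: "labelling X k p"
    and disp: "\<And>v w. v \<in> Homeo X \<Longrightarrow> (\<And>x. x \<in> topspace X \<Longrightarrow> p (v x) = p x) \<Longrightarrow> w \<in> topspace Z \<Longrightarrow> \<bar>f (act v w) - f w\<bar> < 1/8"
    using small_displacement[OF f(1), of "1/8"] by auto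
  obtain \<sigma> where \<sigma>: "\<sigma> permutes {..<k}" "ordered X c (\<lambda>x. \<sigma> (p x))" using ordering_labels[OF X_space(1,2) c p] .
  define Orb where "Orb = (\<lambda>h. pact h (c, z)) ` Homeo X"
  have cY: "(c, z) \<in> topspace product" using cz MY by blast
  have OM: "Orb \<subseteq> M" using M(1) cz by (auto simp: Orb_def subflow_def)
  have OY: "Orb \<subseteq> topspace product" using OM MY by blast
  have "subflow (product closure_of Orb)"
    unfolding subflow_def
  proof (intro conjI ballI)
    have "pact id (c, z) \<in> Orb" using Homeo_id by (auto simp: Orb_def)
    then show "product closure_of Orb \<noteq> {}" using closure_of_subset[OF OY] by blast
    fix g y assume g: "g \<in> Homeo X" and y: "y \<in> product closure_of Orb"
    have "pact g ` Orb \<subseteq> Orb"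
      using pact_comp[OF g _ cY] Homeo_comp[OF g] by (auto simp: Orb_def simp flip: pact_comp[OF g _ cY])
    then have "pact g ` (product closure_of Orb) \<subseteq> product closure_of Orb"
      using continuous_map_image_closure_subset[OF continuous_pact[OF g], of Orb] closure_of_mono by blast
    then show "pact g y \<in> product closure_of Orb" using y by blast
  qed simp
  moreover have "product closure_of Orb \<subseteq> M" by (rule closure_of_minimal[OF OM clM])
  ultimately have "product closure_of Orb = M" using M(2) by blast
  then have cl: "(c, z') \<in> product closure_of Orb" using cz by simp
  define U where "U = {y \<in> topspace product. fst y \<in> {d \<in> topspace (Phi X). ordered X d (\<lambda>x. \<sigma> (p x))}}
    \<inter> {y \<in> topspace product. f (snd y) \<in> {1/2<..}}"
  have "openin product U"
    unfolding U_def
  proof (rule openin_Int)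
    show "openin product {y \<in> topspace product. fst y \<in> {d \<in> topspace (Phi X). ordered X d (\<lambda>x. \<sigma> (p x))}}"
      by (rule openin_continuous_map_preimage[OF fst_continuous])
        (rule clopen_ordered(1)[OF X_space(1,2,4) labelling_permute[OF p \<sigma>(1)]])
    have "continuous_map product euclideanreal (\<lambda>y. f (snd y))"
      using continuous_map_compose[OF continuous_map_snd f(1)] unfolding product_def by (simp add: o_def)
    then show "openin product {y \<in> topspace product. f (snd y) \<in> {1/2<..}}"
      by (rule openin_continuous_map_preimage) simp
  qed
  moreover have "(c, z') \<in> U" using \<sigma> c zz fz topspace_Phi_X by (auto simp: U_def topspace_product)
  ultimately obtain y where "y \<in> Orb" "y \<in> U" using cl unfolding in_closure_of by blast
  then obtain h where h: "h \<in> Homeo X" "pact h (c, z) \<in> U" by (auto simp: Orb_def)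
  have "ordered X c (\<lambda>x. \<sigma> (p (h x)))" "1/2 < f (act h z)"
    using h(2) by (auto simp: U_def pact_def ordered_Phi_action[OF h(1)])
  moreover have "\<bar>f (act h z) - f (act id z)\<bar> \<le> 1/2"
    by (rule uniform_equivariance[OF M p f disp cz(1) \<sigma>(1) h(1) Homeo_id]) (use calculation \<sigma> in auto)
  ultimately show False using fz act_id[OF zz(1)] by simp
qed

text \<open>Continuity of the function with graph \<open>M\<close>: the preimage of a closed set is
  the projection of a closed subset of \<open>M\<close>, and projecting along the compact space
  \<open>Z\<close> is a closed map.\<close>

lemma factor_map: "\<exists>f. equivariant_surjection (Homeo X) (Phi X) Phi_action Z act f"
proof -
  obtain M where M: "subflow M" "\<forall>N. subflow N \<and> N \<subseteq> M \<longrightarrow> N = M" using minimal_subflow by (elim exE conjE)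
  have uniq: "z = z'" if "(c, z) \<in> M" "(c, z') \<in> M" for c z z'
    by (rule minimal_subflow_functional[OF M(1) _ that]) (use M(2) in blast)
  have MY: "M \<subseteq> topspace product" and clM: "closedin product M" and Mne: "M \<noteq> {}" using M(1) closedin_subset by (auto simp: subflow_def)
  have inv: "(Phi_action g c, act g z) \<in> M" if "(c, z) \<in> M" "g \<in> Homeo X" for c z g
    using M(1) that by (fastforce simp: subflow_def pact_def)
  have fstM: "fst ` M = topspace (Phi X)"
  proof (rule Phi_min)
    show "closedin (Phi X) (fst ` M)"
      using closed_map_fst[OF Z_space(1), of "Phi X"] clM unfolding product_def closed_map_def by blast
    show "Phi_action g ` fst ` M \<subseteq> fst ` M" if "g \<in> Homeo X" for g
      using inv[OF _ that] by force
  qed (use Mne in simp)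
  have sndM: "snd ` M = topspace Z"
  proof (rule Z_min)
    show "closedin Z (snd ` M)"
      using closed_map_snd[OF Phi_compact_Hausdorff(1)[OF X_space], of Z] clM unfolding product_def closed_map_def by blast
    show "act g ` snd ` M \<subseteq> snd ` M" if "g \<in> Homeo X" for g
      using inv[OF _ that] by force
  qed (use Mne in simp)
  define f where "f c = (THE z. (c, z) \<in> M)" for c
  have f_eq: "f c = z" if "(c, z) \<in> M" for c z
    unfolding f_def using that uniq by blast
  have fM: "(c, f c) \<in> M" if "c \<in> topspace (Phi X)" for c
  proof -
    have "c \<in> fst ` M" using that fstM by simp
    then obtain z where "(c, z) \<in> M" by auto
    then show ?thesis using f_eq by simp
  qed
  have fZ: "f c \<in> topspace Z" if "c \<in> topspace (Phi X)" for c
    using imageI[OF fM[OF that], of snd] sndM by simp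
  have "continuous_map (Phi X) Z f"
    unfolding continuous_map_closedin
  proof (intro conjI allI impI ballI)
    show "f \<in> topspace (Phi X) \<rightarrow> topspace Z" using fZ by blast
    fix C assume C: "closedin Z C"
    have eq: "{c \<in> topspace (Phi X). f c \<in> C} = fst ` (M \<inter> (topspace (Phi X) \<times> C))"
    proof (intro subset_antisym subsetI)
      fix c assume "c \<in> {c \<in> topspace (Phi X). f c \<in> C}"
      then have "(c, f c) \<in> M \<inter> (topspace (Phi X) \<times> C)" using fM by blast
      then show "c \<in> fst ` (M \<inter> (topspace (Phi X) \<times> C))" by force
    next
      fix c assume "c \<in> fst ` (M \<inter> (topspace (Phi X) \<times> C))"
      then show "c \<in> {c \<in> topspace (Phi X). f c \<in> C}" using f_eq by auto
    qed
    have "closedin product (M \<inter> (topspace (Phi X) \<times> C))"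
      using clM C by (intro closedin_Int) (auto simp: product_def closedin_prod_Times_iff)
    then show "closedin (Phi X) {c \<in> topspace (Phi X). f c \<in> C}"
      unfolding eq using closed_map_fst[OF Z_space(1), of "Phi X"] unfolding product_def closed_map_def by blast
  qed
  moreover have "f ` topspace (Phi X) = topspace Z"
  proof
    show "f ` topspace (Phi X) \<subseteq> topspace Z" using fZ by blast
    show "topspace Z \<subseteq> f ` topspace (Phi X)"
    proof
      fix z assume "z \<in> topspace Z"
      then have "z \<in> snd ` M" using sndM by simp
      then obtain c where c: "(c, z) \<in> M" by auto
      then have "c \<in> fst ` M" by (rule image_eqI[rotated]) simp
      then have "c \<in> topspace (Phi X)" using fstM by simp
      then show "z \<in> f ` topspace (Phi X)" using f_eq[OF c] by blast
    qed
  qed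
  moreover have "f (Phi_action g c) = act g (f c)" if "g \<in> Homeo X" "c \<in> topspace (Phi X)" for g c
    by (rule f_eq) (rule inv[OF fM[OF that(2)] that(1)])
  ultimately show ?thesis unfolding equivariant_surjection_def by blast
qed

end

text \<open>The two clauses are the properties that characterise the universal minimal flow up to
  isomorphism. The carrier type of \<open>Z\<close> is a type variable, so minimal flows on any type
  are covered.\<close>

theorem theorem4p1:
  fixes X :: "'a topology"
  assumes "topspace X \<noteq> {}"
    and "zero_dimensional X" and "compact_space X" and "Hausdorff_space X"
    and "h_homogeneous X"
  shows "minimal_G_space (Homeo X) (compact_open X (Homeo X)) (Phi X) Phi_action \<and>
         (\<forall>(Z :: 'c topology) act.
            minimal_G_space (Homeo X) (compact_open X (Homeo X)) Z act \<longrightarrow>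
            (\<exists>f. equivariant_surjection (Homeo X) (Phi X) Phi_action Z act f))"
proof (intro conjI allI impI)
  show "minimal_G_space (Homeo X) (compact_open X (Homeo X)) (Phi X) Phi_action"
    using Phi_minimal assms by blast
  fix Z :: "'c topology" and act
  assume "minimal_G_space (Homeo X) (compact_open X (Homeo X)) Z act"
  then interpret minimal_flow X Z act using assms by unfold_locales
  show "\<exists>f. equivariant_surjection (Homeo X) (Phi X) Phi_action Z act f" by (rule factor_map)
qed

end
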